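(* There is a categorical duality between $\mathbf{SSub}$ and $\mathbf{Cov}$, witnessed by the functors $\mathsf{Ab}$ and $\mathsf{Sp}$ and the natural isomorphisms $\lambda$ and $\blacktriangleleft$ described in the context. That is: $\mathsf{Ab}:\mathbf{SSub}\to\mathbf{Cov}$ and $\mathsf{Sp}:\mathbf{Cov}\to\mathbf{SSub}$ are contravariant functors, $\lambda:1_{\mathbf{SSub}}\to\mathsf{Sp}\,\mathsf{Ab}$ and $\blacktriangleleft\,:1_{\mathbf{Cov}}\to\mathsf{Ab}\,\mathsf{Sp}$ are natural isomorphisms, and the zigzag identities $\mathsf{Ab}\lambda\bullet\blacktriangleleft\!\mathsf{Ab}=1_{\mathsf{Ab}}$ and $\mathsf{Sp}\!\blacktriangleleft\circ\,\lambda\mathsf{Sp}=1_{\mathsf{Sp}}$ hold, i.e. $\sqsubset_{\lambda_{(S,X)}}\bullet\blacktriangleleft_{\mathsf{Ab}(S,X)}\ =\ \vdash_\Subset$ for all $(S,X)\in\mathbf{SSub}$, and $\phi_{\blacktriangleleft_{(S,\vdash)}}\circ\lambda_{\mathsf{Sp}(S,\vdash)}=\mathrm{id}_{\mathsf{T}^S}$ for all $(S,\vdash)\in\mathbf{Cov}$.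
   Context: Finite subsets and cut-composition. $\mathsf{F}S$ is the set of finite subsets of $S$ (including $\emptyset$). For $\mathcal{F}\subseteq\mathsf{F}S$, $\mathcal{F}_\between=\{G\in\mathsf{F}S: G\cap F\neq\emptyset\ \forall F\in\mathcal{F}\}$. For $\mathcal{F},\mathcal{G}\in\mathsf{F}\mathsf{F}S$, $\mathcal{F}\bowtie\mathcal{G}$ means every element of $\mathcal{F}_\between$ contains some element of $\mathcal{G}$. For $\vdash\ \subseteq R\times\mathsf{F}S$ and $\vDash\ \subseteq\mathsf{F}S\times T$: $r\vdash\bullet\vDash t$ iff there are $\mathcal{F},\mathcal{G}\in\mathsf{F}\mathsf{F}S$ with $\mathcal{F}\bowtie\mathcal{G}$, $r\vdash F$ for all $F\in\mathcal{F}$ and $G\vDash t$ for all $G\in\mathcal{G}$. For a relation $\sqsubset\ \subseteq\mathsf{F}S\times\mathsf{F}R$: $F\sqsubset_{1\exists}G$ iff $F\sqsubset\{g\}$ for some $g\in G$. Cover relations. A relation $\vdash$ on $\mathsf{F}S$ is monotone if $F\vdash G$, $F\subseteq F'$, $G\subseteq G'$ imply $F'\vdash G'$; a strong idempotent if it is monotone and $\vdash\bullet\vdash\ \subseteq\ \vdash\ \subseteq\ \vdash\bullet\vdash_{1\exists}$. Let $\mathsf{B}S=\{F\in\mathsf{F}S:\exists G\in\mathsf{F}S\ (F\vdash G)\}$, and $F\Vdash G$ iff for all $H\in\mathsf{B}S$, if $H\vdash\{f\}$ for all $f\in F$ then $H\vdash G$. A cover relation is a strong idempotent such that $F\Vdash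 H$ and $\{h\}\cup F\vdash G$ for all $h\in H$ imply $F\vdash G$. The category $\mathbf{Cov}$. Objects: pairs $(S,\vdash)$ with $\vdash$ a cover relation on $\mathsf{F}S$. A morphism from $(R,\vDash)$ to $(S,\vdash)$ is a relation $\sqsubset\ \subseteq\mathsf{F}S\times\mathsf{F}R$ with $\sqsubset\ =\ \sqsubset\bullet\vDash\ =\ \vdash\bullet\sqsubset_{1\exists}$. Composition is cut-composition $\bullet$ (if $\sqsubset$ is a morphism from $(R,\vDash)$ to $(S,\vdash)$ and $\sqsubset'$ one from $(Q,\vDash')$ to $(R,\vDash)$, the composite is $\sqsubset\bullet\sqsubset'$), and the identity of $(S,\vdash)$ is $\vdash$. The category $\mathbf{SSub}$. For subsets of a space, $p\Subset q$ means every open cover of $q$ has a finite subfamily covering $p$. A space is stably locally compact if it is core compact (whenever $x\in p$ open there is open $q$ with $x\in q\Subset p$), core coherent ($p\Subset q,r$ open imply $p\Subset q\cap r$) and sober. A subbasis is a family of open sets covering the space and generating its topology; empty intersections are the whole space. Objects of $\mathbf{SSub}$: pairs $(S,X)$ with $S$ a subbasis of a stably locally compact space $X$. Morphisms from $(S,X)$ to $(R,Y)$: partial functions $\phi$ from $X$ to $Y$ whose domain $\mathrm{dom}(\phi)$ is open in $X$ and which are continuous on $\mathrm{dom}(\phi)$. Composition is composition of partial functions, defined wherever possible. The functor $\mathsf{Ab}$. $\mathsf{Ab}(S,X)=(S,\vdash_\Subset)$ with $F\vdash_\Subset G\Leftrightarrow\bigcap F\Subset\bigcup G$. For a morphism $\phi$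 from $(S,X)$ to $(R,Y)$, $\mathsf{Ab}(\phi)=\ \sqsubset_\phi\ \subseteq\mathsf{F}S\times\mathsf{F}R$ with $F\sqsubset_\phi G\Leftrightarrow\bigcap F\Subset\phi^{-1}[\bigcup G]$. The functor $\mathsf{Sp}$. $T\subseteq S$ is tight if for all $G\in\mathsf{F}S$: ($F\vdash G$ for some finite $F\subseteq T$) iff $T\cap G\neq\emptyset$. $\mathsf{T}^S$ is the space of non-empty tight subsets of $S$ with topology generated by $\mathsf{T}_p=\{T\in\mathsf{T}^S:p\in T\}$, $p\in S$. $\mathsf{Sp}(S,\vdash)=((\mathsf{T}_p)_{p\in S},\mathsf{T}^S)$. For a morphism $\sqsubset$ from $(R,\vDash)$ to $(S,\vdash)$, $\mathsf{Sp}(\sqsubset)=\phi_\sqsubset$ is the partial function from $\mathsf{T}^S$ to $\mathsf{T}^R$ with $\phi_\sqsubset(T)=\{r\in R:\exists F\in\mathsf{F}T\ (F\sqsubset\{r\})\}$, defined at exactly those $T$ for which this set is non-empty. The transformations. $\lambda_{(S,X)}(x)=S_x=\{p\in S:x\in p\}$ for $x\in X$. Writing $F_\mathsf{T}=\{\mathsf{T}_f:f\in F\}$ for $F\in\mathsf{F}S$, $\blacktriangleleft_{(S,\vdash)}$ is the relation between finite subsets of $(\mathsf{T}_p)_{p\in S}$ and finite subsets of $S$ given by $F_\mathsf{T}\blacktriangleleft_{(S,\vdash)}G\Leftrightarrow F\vdash G$.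
   Formalization: In the cut-composition used for morphisms of Cov and their composition, the family F is required to be non-empty; with F empty allowed, the empty partial map on a one-point space has Ab(φ) ≠ Ab(φ)•⊢, so Ab(φ) is not a morphism. Cover relations are unaffected. *)

theory Defs
  imports "HOL-Analysis.Analysis"
begin

section \<open>Cut-composition\<close>

text \<open>
  The finite subsets of \<open>S\<close> are \<^term>\<open>Fpow S\<close>.  Relations are sets of pairs, so that equality of
  relations is equality of sets; the carriers therefore have to be passed explicitly.
\<close>

definition transversals :: "'s set \<Rightarrow> 's set set \<Rightarrow> 's set set" where
  "transversals S \<F> = {G \<in> Fpow S. \<forall>F\<in>\<F>. G \<inter> F \<noteq> {}}"

definition bowtie :: "'s set \<Rightarrow> 's set set \<Rightarrow> 's set set \<Rightarrow> bool" where
  "bowtie S \<F> \<G> \<longleftrightarrow> (\<forall>H\<in>transversals S \<F>. \<exists>G\<in>\<G>. G \<subseteq> H)"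

definition cut_comp ::
    "'r set \<Rightarrow> 's set \<Rightarrow> 't set \<Rightarrow> ('r \<times> 's set) set \<Rightarrow> ('s set \<times> 't) set \<Rightarrow> ('r \<times> 't) set" where
  "cut_comp R S T A B = {(r, t) \<in> R \<times> T. \<exists>\<F>\<in>Fpow (Fpow S). \<exists>\<G>\<in>Fpow (Fpow S).
     bowtie S \<F> \<G> \<and> (\<forall>F\<in>\<F>. (r, F) \<in> A) \<and> (\<forall>G\<in>\<G>. (G, t) \<in> B)}"

text \<open>
  The same with \<open>\<F>\<close> non-empty.  For \<open>\<F> = {}\<close> the condition \<open>bowtie S \<F> \<G>\<close> says \<open>{} \<in> \<G>\<close>, so
  \<^const>\<open>cut_comp\<close> relates every \<open>r\<close> whatsoever to \<open>t\<close> as soon as \<open>{}\<close> is related to \<open>t\<close>.  That is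
  harmless for cover relations (see \<open>strong_idempotent_cut_comp_ne\<close> below), but a morphism with
  \<open>\<sqsubset> = \<sqsubset> \<bullet> \<Turnstile>\<close> would then have to relate everything to \<open>G\<close> whenever \<open>{} \<Turnstile> G\<close>, which fails for
  partial maps into compact spaces and for total maps from non-compact to compact spaces
  (see \<open>cut_comp_empty_family_counterexample\<close> below).  Hence morphisms and their composition use
  this version.
\<close>

definition cut_comp_ne ::
    "'r set \<Rightarrow> 's set \<Rightarrow> 't set \<Rightarrow> ('r \<times> 's set) set \<Rightarrow> ('s set \<times> 't) set \<Rightarrow> ('r \<times> 't) set" where
  "cut_comp_ne R S T A B = {(r, t) \<in> R \<times> T. \<exists>\<F>\<in>Fpow (Fpow S). \<exists>\<G>\<in>Fpow (Fpow S).
     \<F> \<noteq> {} \<and> bowtie S \<F> \<G> \<and> (\<forall>F\<in>\<F>. (r, F) \<in> A) \<and> (\<forall>G\<in>\<G>. (G, t) \<in> B)}"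

definition one_ex :: "'r set \<Rightarrow> ('s set \<times> 'r set) set \<Rightarrow> ('s set \<times> 'r set) set" where
  "one_ex R A = {(F, G). G \<in> Fpow R \<and> (\<exists>g\<in>G. (F, {g}) \<in> A)}"


section \<open>The category of cover relations\<close>

definition monotone_rel :: "'s set \<Rightarrow> ('s set \<times> 's set) set \<Rightarrow> bool" where
  "monotone_rel S R \<longleftrightarrow> (\<forall>F\<in>Fpow S. \<forall>G\<in>Fpow S. \<forall>F'\<in>Fpow S. \<forall>G'\<in>Fpow S.
     (F, G) \<in> R \<and> F \<subseteq> F' \<and> G \<subseteq> G' \<longrightarrow> (F', G') \<in> R)"

definition strong_idempotent :: "'s set \<Rightarrow> ('s set \<times> 's set) set \<Rightarrow> bool" where
  "strong_idempotent S R \<longleftrightarrow> R \<subseteq> Fpow S \<times> Fpow S \<and> monotone_rel S R \<and>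
     cut_comp (Fpow S) S (Fpow S) R R \<subseteq> R \<and>
     R \<subseteq> cut_comp (Fpow S) S (Fpow S) R (one_ex S R)"

definition bounded_sets :: "'s set \<Rightarrow> ('s set \<times> 's set) set \<Rightarrow> 's set set" where
  "bounded_sets S R = {F \<in> Fpow S. \<exists>G\<in>Fpow S. (F, G) \<in> R}"

definition Vdash :: "'s set \<Rightarrow> ('s set \<times> 's set) set \<Rightarrow> ('s set \<times> 's set) set" where
  "Vdash S R = {(F, G) \<in> Fpow S \<times> Fpow S.
     \<forall>H\<in>bounded_sets S R. (\<forall>f\<in>F. (H, {f}) \<in> R) \<longrightarrow> (H, G) \<in> R}"

definition cover_relation :: "'s set \<Rightarrow> ('s set \<times> 's set) set \<Rightarrow> bool" where
  "cover_relation S R \<longleftrightarrow> strong_idempotent S R \<and>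
     (\<forall>F\<in>Fpow S. \<forall>G\<in>Fpow S. \<forall>H\<in>Fpow S.
        (F, H) \<in> Vdash S R \<and> (\<forall>h\<in>H. ({h} \<union> F, G) \<in> R) \<longrightarrow> (F, G) \<in> R)"

text \<open>
  Objects live over arbitrary types; \<open>Cov\<close> and \<open>SSub\<close> are polymorphic families and morphisms may go
  between objects over different types.
\<close>

type_synonym 's cov = "'s set \<times> ('s set \<times> 's set) set"

definition Cov :: "'s cov set" where
  "Cov = {(S, R). cover_relation S R}"

text \<open>A morphism from \<open>(R, V)\<close> to \<open>(S, W)\<close> is a relation from \<^term>\<open>Fpow S\<close> to \<^term>\<open>Fpow R\<close>.\<close>

fun Cov_hom :: "'r cov \<Rightarrow> 's cov \<Rightarrow> ('s set \<times> 'r set) set set" where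
  "Cov_hom (R, V) (S, W) = {A. A \<subseteq> Fpow S \<times> Fpow R \<and>
     A = cut_comp_ne (Fpow S) R (Fpow R) A V \<and>
     A = cut_comp_ne (Fpow S) S (Fpow R) W (one_ex R A)}"

text \<open>\<open>Cov_comp X Y Z A B\<close> is the composite of \<open>B\<close> from \<open>X\<close> to \<open>Y\<close> with \<open>A\<close> from \<open>Y\<close> to \<open>Z\<close>.\<close>

definition Cov_comp :: "'q cov \<Rightarrow> 'r cov \<Rightarrow> 's cov \<Rightarrow>
    ('s set \<times> 'r set) set \<Rightarrow> ('r set \<times> 'q set) set \<Rightarrow> ('s set \<times> 'q set) set" where
  "Cov_comp X Y Z A B = cut_comp_ne (Fpow (fst Z)) (fst Y) (Fpow (fst X)) A B"

definition Cov_id :: "'s cov \<Rightarrow> ('s set \<times> 's set) set" where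
  "Cov_id X = snd X"

definition Cov_iso :: "'r cov \<Rightarrow> 's cov \<Rightarrow> ('s set \<times> 'r set) set \<Rightarrow> bool" where
  "Cov_iso X Y A \<longleftrightarrow> A \<in> Cov_hom X Y \<and>
     (\<exists>B\<in>Cov_hom Y X. Cov_comp X Y X B A = Cov_id X \<and> Cov_comp Y X Y A B = Cov_id Y)"


section \<open>The category of subbases of stably locally compact spaces\<close>

definition way_below :: "'a topology \<Rightarrow> 'a set \<Rightarrow> 'a set \<Rightarrow> bool" where
  "way_below X p q \<longleftrightarrow> (\<forall>\<U>. (\<forall>U\<in>\<U>. openin X U) \<and> q \<subseteq> \<Union>\<U> \<longrightarrow>
     (\<exists>\<V>. finite \<V> \<and> \<V> \<subseteq> \<U> \<and> p \<subseteq> \<Union>\<V>))"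

definition core_compact :: "'a topology \<Rightarrow> bool" where
  "core_compact X \<longleftrightarrow> (\<forall>p x. openin X p \<and> x \<in> p \<longrightarrow>
     (\<exists>q. openin X q \<and> x \<in> q \<and> way_below X q p))"

definition core_coherent :: "'a topology \<Rightarrow> bool" where
  "core_coherent X \<longleftrightarrow> (\<forall>p q r. p \<subseteq> topspace X \<and> openin X q \<and> openin X r \<and>
     way_below X p q \<and> way_below X p r \<longrightarrow> way_below X p (q \<inter> r))"

definition irreducible_closed :: "'a topology \<Rightarrow> 'a set \<Rightarrow> bool" where
  "irreducible_closed X C \<longleftrightarrow> closedin X C \<and> C \<noteq> {} \<and>
     (\<forall>D E. closedin X D \<and> closedin X E \<and> C = D \<union> E \<longrightarrow> C = D \<or> C = E)"

definition sober_space :: "'a topology \<Rightarrow> bool" where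
  "sober_space X \<longleftrightarrow>
     (\<forall>C. irreducible_closed X C \<longrightarrow> (\<exists>!x. x \<in> topspace X \<and> C = X closure_of {x}))"

definition stably_locally_compact :: "'a topology \<Rightarrow> bool" where
  "stably_locally_compact X \<longleftrightarrow> core_compact X \<and> core_coherent X \<and> sober_space X"

definition subbasis :: "'a topology \<Rightarrow> 'a set set \<Rightarrow> bool" where
  "subbasis X S \<longleftrightarrow> (\<forall>p\<in>S. openin X p) \<and> \<Union>S = topspace X \<and> topology_generated_by S = X"

type_synonym 'a ssub = "'a set set \<times> 'a topology"

definition SSub :: "'a ssub set" where
  "SSub = {(S, X). stably_locally_compact X \<and> subbasis X S}"

text \<open>Composition of morphisms is \<open>\<circ>\<^sub>m\<close>.\<close>

fun SSub_hom :: "'a ssub \<Rightarrow> 'b ssub \<Rightarrow> ('a \<rightharpoonup> 'b) set" where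
  "SSub_hom (S, X) (R, Y) = {\<phi>. openin X (dom \<phi>) \<and>
     continuous_map (subtopology X (dom \<phi>)) Y (the \<circ> \<phi>)}"

definition SSub_id :: "'a ssub \<Rightarrow> ('a \<rightharpoonup> 'a)" where
  "SSub_id A = Some |` topspace (snd A)"

definition SSub_iso :: "'a ssub \<Rightarrow> 'b ssub \<Rightarrow> ('a \<rightharpoonup> 'b) \<Rightarrow> bool" where
  "SSub_iso A B \<phi> \<longleftrightarrow> \<phi> \<in> SSub_hom A B \<and>
     (\<exists>\<psi>\<in>SSub_hom B A. \<psi> \<circ>\<^sub>m \<phi> = SSub_id A \<and> \<phi> \<circ>\<^sub>m \<psi> = SSub_id B)"


section \<open>The functors\<close>

definition Inter_in :: "'a topology \<Rightarrow> 'a set set \<Rightarrow> 'a set" where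
  "Inter_in X F = topspace X \<inter> \<Inter>F"

fun Ab :: "'a ssub \<Rightarrow> 'a set cov" where
  "Ab (S, X) = (S, {(F, G) \<in> Fpow S \<times> Fpow S. way_below X (Inter_in X F) (\<Union>G)})"

fun Ab_mor :: "'a ssub \<Rightarrow> 'b ssub \<Rightarrow> ('a \<rightharpoonup> 'b) \<Rightarrow> ('a set set \<times> 'b set set) set" where
  "Ab_mor (S, X) (R, Y) \<phi> = {(F, G) \<in> Fpow S \<times> Fpow R.
     way_below X (Inter_in X F) {x. \<exists>y\<in>\<Union>G. \<phi> x = Some y}}"

fun tight :: "'s cov \<Rightarrow> 's set \<Rightarrow> bool" where
  "tight (S, R) T \<longleftrightarrow> T \<subseteq> S \<and>
     (\<forall>G\<in>Fpow S. (\<exists>F\<in>Fpow T. (F, G) \<in> R) \<longleftrightarrow> T \<inter> G \<noteq> {})"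

definition tight_sets :: "'s cov \<Rightarrow> 's set set" where
  "tight_sets A = {T. tight A T \<and> T \<noteq> {}}"

definition tight_at :: "'s cov \<Rightarrow> 's \<Rightarrow> 's set set" where
  "tight_at A p = {T \<in> tight_sets A. p \<in> T}"

text \<open>
  The sets \<^term>\<open>tight_at A p\<close> cover \<^term>\<open>tight_sets A\<close>, so the topology generated by them has
  \<^term>\<open>tight_sets A\<close> as its carrier.
\<close>

definition Sp :: "'s cov \<Rightarrow> 's set ssub" where
  "Sp A = (tight_at A ` fst A, topology_generated_by (tight_at A ` fst A))"

definition Sp_image :: "'r cov \<Rightarrow> ('s set \<times> 'r set) set \<Rightarrow> 's set \<Rightarrow> 'r set" where
  "Sp_image A C T = {r \<in> fst A. \<exists>F\<in>Fpow T. (F, {r}) \<in> C}"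

text \<open>For \<open>C\<close> a morphism from \<open>A\<close> to \<open>B\<close>, \<open>Sp_mor A B C\<close> is a morphism from \<open>Sp B\<close> to \<open>Sp A\<close>.\<close>

definition Sp_mor :: "'r cov \<Rightarrow> 's cov \<Rightarrow> ('s set \<times> 'r set) set \<Rightarrow> ('s set \<rightharpoonup> 'r set)" where
  "Sp_mor A B C = (\<lambda>T. if T \<in> tight_sets B \<and> Sp_image A C T \<noteq> {}
     then Some (Sp_image A C T) else None)"


section \<open>The transformations\<close>

fun lam :: "'a ssub \<Rightarrow> ('a \<rightharpoonup> 'a set set)" where
  "lam (S, X) = (\<lambda>x. if x \<in> topspace X then Some {p \<in> S. x \<in> p} else None)"

text \<open>
  Different \<open>F\<close> may have the same image \<^term>\<open>tight_at (S, R) ` F\<close>; that membership of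
  \<^term>\<open>(tight_at (S, R) ` F, G)\<close> in the following relation does not depend on the choice of \<open>F\<close> is
  part of the theorem.
\<close>

fun btl :: "'s cov \<Rightarrow> ('s set set set \<times> 's set) set" where
  "btl (S, R) = {(tight_at (S, R) ` F, G) | F G. F \<in> Fpow S \<and> G \<in> Fpow S \<and> (F, G) \<in> R}"


section \<open>The empty family in cut-compositions\<close>

lemma empty_in_Fpow: "{} \<in> Fpow S" by (simp add: Fpow_def)

lemma cut_comp_ne_subset: "cut_comp_ne R S T A B \<subseteq> cut_comp R S T A B"
  unfolding cut_comp_ne_def cut_comp_def by blast

lemma cut_comp_cases:
  assumes "(r, t) \<in> cut_comp R S T A B"
  shows "(r, t) \<in> cut_comp_ne R S T A B \<or> r \<in> R \<and> t \<in> T \<and> ({}, t) \<in> B"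
proof -
  obtain \<F> \<G> where h: "r \<in> R" "t \<in> T" "\<F> \<in> Fpow (Fpow S)" "\<G> \<in> Fpow (Fpow S)" "bowtie S \<F> \<G>"
    "\<forall>F\<in>\<F>. (r, F) \<in> A" "\<forall>G\<in>\<G>. (G, t) \<in> B"
    using assms unfolding cut_comp_def by blast
  show ?thesis
  proof (cases "\<F> = {}")
    case True
    then have "{} \<in> transversals S \<F>" by (simp add: transversals_def Fpow_def)
    then have "{} \<in> \<G>" using h(5) unfolding bowtie_def by fastforce
    then show ?thesis using h by blast
  next
    case False
    then show ?thesis using h unfolding cut_comp_ne_def by blast
  qed
qed

lemma monotone_relD:
  "\<lbrakk>monotone_rel S R; (F, G) \<in> R; F \<subseteq> F'; G \<subseteq> G'; F \<in> Fpow S; G \<in> Fpow S; F' \<in> Fpow S; G' \<in> Fpow S\<rbrakk>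
    \<Longrightarrow> (F', G') \<in> R"
  unfolding monotone_rel_def by (elim ballE) blast+

lemma strong_idempotent_cut_comp_ne:
  "strong_idempotent S R \<longleftrightarrow> R \<subseteq> Fpow S \<times> Fpow S \<and> monotone_rel S R \<and>
     cut_comp_ne (Fpow S) S (Fpow S) R R \<subseteq> R \<and>
     R \<subseteq> cut_comp_ne (Fpow S) S (Fpow S) R (one_ex S R)" (is "_ \<longleftrightarrow> ?r")
proof
  assume si: "strong_idempotent S R"
  then have sub: "R \<subseteq> Fpow S \<times> Fpow S" and mono: "monotone_rel S R"
    and i1: "cut_comp (Fpow S) S (Fpow S) R R \<subseteq> R"
    and i2: "R \<subseteq> cut_comp (Fpow S) S (Fpow S) R (one_ex S R)"
    unfolding strong_idempotent_def by auto
  have "(F, G) \<in> cut_comp_ne (Fpow S) S (Fpow S) R (one_ex S R)" if "(F, G) \<in> R" for F G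
  proof -
    have "(F, G) \<in> cut_comp (Fpow S) S (Fpow S) R (one_ex S R)" using that i2 by blast
    from cut_comp_cases[OF this] show ?thesis
    proof
      assume a: "F \<in> Fpow S \<and> G \<in> Fpow S \<and> ({}, G) \<in> one_ex S R"
      then obtain g where g: "g \<in> G" "({}, {g}) \<in> R" unfolding one_ex_def by blast
      have gS: "{g} \<in> Fpow S" using sub g(2) by blast
      have m: "(H, {g}) \<in> R" if "H \<in> Fpow S" for H
        by (rule monotone_relD[OF mono g(2) empty_subsetI subset_refl empty_in_Fpow gS that gS])
      have b: "bowtie S {{g}} {{g}}" by (auto simp: bowtie_def transversals_def)
      have f: "{{g}} \<in> Fpow (Fpow S)" using gS by (simp add: Fpow_def)
      have r1: "\<forall>F'\<in>{{g}}. (F, F') \<in> R" using m a by blast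
      have r2: "\<forall>F'\<in>{{g}}. (F', G) \<in> one_ex S R" using m gS a g(1) unfolding one_ex_def by blast
      show ?thesis unfolding cut_comp_ne_def using a b f r1 r2 by blast
    qed
  qed
  then have "R \<subseteq> cut_comp_ne (Fpow S) S (Fpow S) R (one_ex S R)" by auto
  then show ?r using sub mono subset_trans[OF cut_comp_ne_subset i1] by blast
next
  assume r: ?r
  have "(F, G) \<in> R" if c: "(F, G) \<in> cut_comp (Fpow S) S (Fpow S) R R" for F G
    using cut_comp_cases[OF c]
  proof
    assume "(F, G) \<in> cut_comp_ne (Fpow S) S (Fpow S) R R"
    then show ?thesis using r by blast
  next
    assume "F \<in> Fpow S \<and> G \<in> Fpow S \<and> ({}, G) \<in> R"
    then show ?thesis
      using r monotone_relD[OF _ _ empty_subsetI subset_refl empty_in_Fpow] by blast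
  qed
  then have "cut_comp (Fpow S) S (Fpow S) R R \<subseteq> R" by auto
  then show "strong_idempotent S R"
    unfolding strong_idempotent_def
    using r subset_trans[OF _ cut_comp_ne_subset, of R "Fpow S" S "Fpow S" R "one_ex S R"] by blast
qed

lemma cut_comp_empty_family_counterexample:
  defines "A \<equiv> ({UNIV}, discrete_topology UNIV) :: unit ssub"
  shows "A \<in> SSub" and "Map.empty \<in> SSub_hom A A"
    and "Ab_mor A A Map.empty \<noteq>
      cut_comp (Fpow (fst A)) (fst A) (Fpow (fst A)) (Ab_mor A A Map.empty) (snd (Ab A))"
proof -
  let ?X = "discrete_topology UNIV :: unit topology"
  have wb: "way_below ?X p q \<longleftrightarrow> p \<subseteq> q" for p q
  proof
    assume "way_below ?X p q"
    then obtain \<V> where "\<V> \<subseteq> {q}" "p \<subseteq> \<Union>\<V>"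
      unfolding way_below_def by (force dest: spec[of _ "{q}"])
    then show "p \<subseteq> q" by blast
  next
    assume "p \<subseteq> q"
    then show "way_below ?X p q"
      unfolding way_below_def by (intro allI impI, rule_tac x = \<U> in exI) auto
  qed
  have unit_set: "C = {} \<or> C = {()}" for C :: "unit set" by auto
  have "openin (topology_generated_by {UNIV :: unit set}) U \<longleftrightarrow> openin ?X U" for U
    using unit_set[of U] openin_topspace[of "topology_generated_by {UNIV :: unit set}"]
    by (auto simp: topology_generated_by_topspace UNIV_unit)
  then have "topology_generated_by {UNIV :: unit set} = ?X"
    unfolding topology_eq by blast
  moreover have "core_compact ?X" unfolding core_compact_def wb by blast
  moreover have "core_coherent ?X" unfolding core_coherent_def wb by blast
  moreover have "sober_space ?X"
    unfolding sober_space_def irreducible_closed_def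
  proof (intro allI impI)
    fix C :: "unit set"
    assume "closedin ?X C \<and> C \<noteq> {} \<and>
      (\<forall>D E. closedin ?X D \<and> closedin ?X E \<and> C = D \<union> E \<longrightarrow> C = D \<or> C = E)"
    then have "C = {()}" using unit_set by blast
    then show "\<exists>!x. x \<in> topspace ?X \<and> C = ?X closure_of {x}"
      by (auto simp: discrete_topology_closure_of intro!: ex1I[of _ "()"])
  qed
  ultimately show "A \<in> SSub"
    by (simp add: A_def SSub_def stably_locally_compact_def subbasis_def)
  show "Map.empty \<in> SSub_hom A A"
    by (simp add: A_def continuous_map_def)
  have ab: "snd (Ab A) = {(F, G) \<in> Fpow (fst A) \<times> Fpow (fst A). Inter_in ?X F \<subseteq> \<Union>G}"
    by (simp add: A_def wb)
  have "({}, {UNIV}) \<in> snd (Ab A)" unfolding ab by (simp add: A_def Fpow_def)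
  moreover have "bowtie (fst A) {} {{}}" by (simp add: bowtie_def)
  moreover have "{} \<in> Fpow (Fpow (fst A))" "{{}} \<in> Fpow (Fpow (fst A))" "{} \<in> Fpow (fst A)"
    "{UNIV} \<in> Fpow (fst A)"
    by (simp_all add: A_def Fpow_def)
  ultimately have mem: "({}, {UNIV}) \<in>
      cut_comp (Fpow (fst A)) (fst A) (Fpow (fst A)) (Ab_mor A A Map.empty) (snd (Ab A))"
    unfolding cut_comp_def by blast
  have not_mem: "({}, {UNIV}) \<notin> Ab_mor A A Map.empty"
    by (simp add: A_def wb Inter_in_def)
  show "Ab_mor A A Map.empty \<noteq>
      cut_comp (Fpow (fst A)) (fst A) (Fpow (fst A)) (Ab_mor A A Map.empty) (snd (Ab A))"
    by (rule notI, drule equalityD2, drule subsetD, rule mem, erule notE[OF not_mem])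
qed

end

theory Submission
  imports Defs
begin

text \<open>
  Let \<open>X\<close> and \<open>Y\<close> be stably locally compact with subbases listed as indexed families \<open>U\<close> and
  \<open>W\<close>.  A partial map \<open>\<phi>\<close> from \<open>X\<close> to \<open>Y\<close> induces a relation between finite sets of indices:
  \<open>F\<close> is related to \<open>G\<close> iff \<open>\<Inter>i\<in>F. U i\<close> is way below the \<open>\<phi>\<close>-preimage of \<open>\<Union>j\<in>G. W j\<close>.  The theorem
  follows from three facts about such relations.

  Cut-composition is composition of maps (\<open>induced_rel_comp\<close>).  The condition \<open>bowtie J \<F> \<G>\<close> says
  that \<open>\<Inter>F\<in>\<F>. \<Union>j\<in>F. W j \<subseteq> \<Union>G\<in>\<G>. \<Inter>j\<in>G. W j\<close> for every family \<open>W\<close> of sets indexed by \<open>J\<close>.  So if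
  \<open>p\<close> is way below the preimage of \<open>\<Union>j\<in>F. W j\<close> for each \<open>F \<in> \<F>\<close>, core coherence puts \<open>p\<close> way below
  the preimage of \<open>\<Union>G\<in>\<G>. \<Inter>j\<in>G. W j\<close>.  Conversely, a \<open>p\<close> way below an open set is, by core
  compactness, way below a finite union of basic sets \<open>\<Inter>j\<in>G. W j\<close>, and distributing this union over
  the intersections produces the family \<open>\<F>\<close>.  The same argument shows that the relation induced by
  an identity is a cover relation and that induced relations are morphisms.

  Every cover relation and every morphism is induced (\<open>cover_relation_spatial\<close>,
  \<open>Cov_hom_spatial\<close>), by the space of tight sets and by \<open>Sp_mor\<close>.  The points come from Zorn's
  lemma in the style of the prime ideal theorem (\<open>exists_tight_set\<close>): if \<open>H\<close> is related to no finite
  subset of \<open>C\<close>, a maximal set \<open>V \<supseteq> H\<close> with the same property determines a tight set that avoids \<open>C\<close>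
  and meets every \<open>G\<close> to which \<open>H\<close> is related.  Together with a version of Alexander's subbase
  theorem for the way-below relation this shows that related sets are way below each other; the
  axiom that distinguishes cover relations among strong idempotents gives the converse.

  Sobriety makes the tight sets of an induced cover relation exactly the sets
  \<open>{i. x \<in> U i}\<close> of indices of neighbourhoods of points \<open>x\<close> (\<open>tight_point\<close>), which is the reason why
  \<open>lam\<close> is an isomorphism.

  Families are indexed because \<open>tight_at A\<close> need not be injective.  Both \<open>A\<close> and \<open>Ab (Sp A)\<close>
  are induced by the space of tight sets of \<open>A\<close>, with two different indexings of its subbasis, and
  \<open>btl A\<close> is the relation induced by the identity map between them.  Thus the category laws of
  \<open>Cov\<close>, naturality of \<open>btl\<close> and the zigzag identities all become computations with composites
  of partial maps.
\<close>

section \<open>The way-below relation\<close>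

lemma way_belowD:
  assumes "way_below X p q" "\<And>U. U \<in> \<U> \<Longrightarrow> openin X U" "q \<subseteq> \<Union>\<U>"
  obtains \<V> where "finite \<V>" "\<V> \<subseteq> \<U>" "p \<subseteq> \<Union>\<V>"
  using assms unfolding way_below_def by meson

lemma way_below_mono:
  assumes "way_below X p q" "p' \<subseteq> p" "q \<subseteq> q'"
  shows "way_below X p' q'"
  using assms unfolding way_below_def by (meson order_trans)

lemma way_below_subset:
  assumes "way_below X p q" "openin X q"
  shows "p \<subseteq> q"
proof -
  obtain \<V> where "\<V> \<subseteq> {q}" "p \<subseteq> \<Union>\<V>"
    by (rule way_belowD[OF assms(1), of "{q}"]) (use assms(2) in auto)
  then show ?thesis by blast
qed

lemma way_below_Union:
  assumes "finite \<P>" "\<And>p. p \<in> \<P> \<Longrightarrow> way_below X p q"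
  shows "way_below X (\<Union>\<P>) q"
  unfolding way_below_def
proof (intro allI impI)
  fix \<U> assume "(\<forall>U\<in>\<U>. openin X U) \<and> q \<subseteq> \<Union>\<U>"
  then have "\<exists>\<V>. finite \<V> \<and> \<V> \<subseteq> \<U> \<and> p \<subseteq> \<Union>\<V>" if "p \<in> \<P>" for p
    using way_belowD[OF assms(2)[OF that]] by metis
  then obtain v where v: "\<And>p. p \<in> \<P> \<Longrightarrow> finite (v p) \<and> v p \<subseteq> \<U> \<and> p \<subseteq> \<Union>(v p)"
    by metis
  show "\<exists>\<V>. finite \<V> \<and> \<V> \<subseteq> \<U> \<and> \<Union>\<P> \<subseteq> \<Union>\<V>"
    by (rule exI[of _ "\<Union>(v ` \<P>)"]) (use assms(1) v in fastforce)
qed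

lemma way_below_Inter:
  assumes "core_coherent X" "finite \<Q>" "\<Q> \<noteq> {}" "p \<subseteq> topspace X"
    and "\<And>q. q \<in> \<Q> \<Longrightarrow> openin X q" "\<And>q. q \<in> \<Q> \<Longrightarrow> way_below X p q"
  shows "way_below X p (\<Inter>\<Q>)"
  using assms(2,3,5,6)
proof (induction rule: finite_ne_induct)
  case (insert q \<Q>)
  have "openin X (\<Inter>\<Q>)" using insert by (intro openin_Inter) auto
  then show ?case using insert assms(1,4) unfolding core_coherent_def by simp
qed simp

text \<open>
  Interpolation in the form in which it is used: a cover of \<open>q\<close> has a finite part that \<open>p\<close> is way
  below, not only contained in, because the cover can be replaced by the sets way below its members.
\<close>

lemma way_below_finite_subcover:
  assumes cc: "core_compact X" and wb: "way_below X p q"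
    and op: "\<And>U. U \<in> \<U> \<Longrightarrow> openin X U" and cov: "q \<subseteq> \<Union>\<U>"
  shows "\<exists>\<V>\<subseteq>\<U>. finite \<V> \<and> way_below X p (\<Union>\<V>)"
proof -
  let ?\<W> = "{w. openin X w \<and> (\<exists>U\<in>\<U>. way_below X w U)}"
  have "q \<subseteq> \<Union>?\<W>"
  proof
    fix x assume "x \<in> q"
    then obtain U where U: "U \<in> \<U>" "x \<in> U" using cov by blast
    then obtain w where "openin X w" "x \<in> w" "way_below X w U"
      using cc op[OF U(1)] unfolding core_compact_def by meson
    then show "x \<in> \<Union>?\<W>" using U(1) by blast
  qed
  then obtain \<W> where W: "finite \<W>" "\<W> \<subseteq> ?\<W>" "p \<subseteq> \<Union>\<W>"
    using way_belowD[OF wb, of ?\<W>] by (metis (no_types, lifting) mem_Collect_eq)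
  then have "\<forall>w\<in>\<W>. \<exists>U. U \<in> \<U> \<and> way_below X w U" by blast
  then obtain u where u: "\<And>w. w \<in> \<W> \<Longrightarrow> u w \<in> \<U> \<and> way_below X w (u w)"
    by metis
  have "way_below X (\<Union>\<W>) (\<Union>(u ` \<W>))"
  proof (rule way_below_Union[OF W(1)])
    fix w assume "w \<in> \<W>"
    then show "way_below X w (\<Union>(u ` \<W>))" using u way_below_mono by blast
  qed
  then have "way_below X p (\<Union>(u ` \<W>))" using W(3) way_below_mono by blast
  then show ?thesis using W(1) u by (intro exI[of _ "u ` \<W>"]) auto
qed

lemma Inter_in_Un: "Inter_in X (U ` (F \<union> G)) = Inter_in X (U ` F) \<inter> Inter_in X (U ` G)"
  by (auto simp: Inter_in_def)

lemma mem_Inter_in: "x \<in> Inter_in X (U ` F) \<longleftrightarrow> x \<in> topspace X \<and> (\<forall>i\<in>F. x \<in> U i)"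
  by (auto simp: Inter_in_def)

lemma openin_Inter_in:
  assumes "\<And>i. i \<in> F \<Longrightarrow> openin X (U i)" "finite F"
  shows "openin X (Inter_in X (U ` F))"
proof (cases "F = {}")
  case False
  have "openin X (\<Inter>(U ` F))" using assms False by (intro openin_Inter) auto
  then show ?thesis unfolding Inter_in_def by blast
qed (simp add: Inter_in_def)

lemma subbasis_openin:
  assumes "subbasis X (U ` I)" "i \<in> I"
  shows "openin X (U i)"
  using assms unfolding subbasis_def by blast

lemma subbasis_cover:
  assumes "subbasis X (U ` I)" "x \<in> topspace X"
  obtains i where "i \<in> I" "x \<in> U i"
  using assms unfolding subbasis_def by blast

lemma subbasis_nbhd:
  assumes sb: "subbasis X (U ` I)" and W: "openin X W" "x \<in> W"
  shows "\<exists>F\<in>Fpow I. F \<noteq> {} \<and> x \<in> Inter_in X (U ` F) \<and> Inter_in X (U ` F) \<subseteq> W"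
proof -
  have "generate_topology_on (U ` I) W"
    using sb W(1) unfolding subbasis_def by (metis openin_topology_generated_by_iff)
  then show ?thesis using W(2)
  proof induction
    case (Int a b)
    then obtain F G where F: "F \<in> Fpow I" "F \<noteq> {}" "x \<in> Inter_in X (U ` F)" "Inter_in X (U ` F) \<subseteq> a"
      and G: "G \<in> Fpow I" "x \<in> Inter_in X (U ` G)" "Inter_in X (U ` G) \<subseteq> b" by blast
    show ?case
      by (rule bexI[of _ "F \<union> G"]) (use F G in \<open>auto simp: Inter_in_Un Fpow_def\<close>)
  next
    case (Basis s)
    then obtain i where i: "i \<in> I" "s = U i" by blast
    moreover have "x \<in> topspace X"
      using subbasis_openin[OF sb i(1)] openin_subset Basis i by blast
    ultimately show ?case
      by (intro bexI[of _ "{i}"]) (use Basis in \<open>auto simp: Inter_in_def Fpow_def\<close>)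
  next
    case (UN K)
    then obtain k where "k \<in> K" "x \<in> k" by blast
    then show ?case using UN.IH[of k] by (meson Union_upper order_trans)
  qed simp
qed

lemma SSub_iff: "(S, X) \<in> SSub \<longleftrightarrow> core_compact X \<and> core_coherent X \<and> sober_space X \<and> subbasis X S"
  by (simp add: SSub_def stably_locally_compact_def)

lemma way_below_nbhd:
  assumes "(U ` I, X) \<in> SSub" "openin X W" "x \<in> W"
  shows "\<exists>F\<in>Fpow I. F \<noteq> {} \<and> x \<in> Inter_in X (U ` F) \<and> way_below X (Inter_in X (U ` F)) W"
proof -
  obtain q where q: "openin X q" "x \<in> q" "way_below X q W"
    using assms unfolding SSub_iff core_compact_def by blast
  moreover have "subbasis X (U ` I)" using assms(1) by (simp add: SSub_iff)
  ultimately show ?thesis using subbasis_nbhd[of X U I q x] way_below_mono[OF q(3)] by blast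
qed


section \<open>Finite families and cut-composition\<close>

lemma Fpow_Fpow_mem: "\<lbrakk>\<G> \<in> Fpow (Fpow J); G \<in> \<G>\<rbrakk> \<Longrightarrow> G \<in> Fpow J"
  by (auto simp: Fpow_def)

lemma Fpow_finite: "F \<in> Fpow J \<Longrightarrow> finite F"
  and Fpow_subset: "F \<in> Fpow J \<Longrightarrow> F \<subseteq> J"
  by (auto simp: Fpow_def)

text \<open>
  Although \<open>bowtie\<close> quantifies over finite \<open>T\<close> only, a set meeting all of \<open>\<F>\<close> has a finite part
  that does so too.  This is how the relation is applied to tight sets and to sets of neighbourhoods.
\<close>

lemma bowtie_subset:
  assumes bt: "bowtie J \<F> \<G>" and F: "\<F> \<in> Fpow (Fpow J)" and T: "\<And>F. F \<in> \<F> \<Longrightarrow> T \<inter> F \<noteq> {}"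
  shows "\<exists>G\<in>\<G>. G \<subseteq> T"
proof -
  have "T \<inter> \<Union>\<F> \<in> Fpow J" using F by (auto simp: Fpow_def)
  moreover have "T \<inter> \<Union>\<F> \<inter> F \<noteq> {}" if "F \<in> \<F>" for F using T[OF that] that by blast
  ultimately have "T \<inter> \<Union>\<F> \<in> transversals J \<F>" by (simp add: transversals_def)
  then obtain G where "G \<in> \<G>" "G \<subseteq> T \<inter> \<Union>\<F>" using bt unfolding bowtie_def by meson
  then show ?thesis by (meson Int_lower1 order_trans)
qed

text \<open>
  The family \<open>\<F>\<close> in the distributive law \<open>\<Union>G\<in>\<G>. \<Inter>j\<in>G. W j = \<Inter>F\<in>\<F>. \<Union>j\<in>F. W j\<close>.  If some set meets
  all of \<open>\<F>\<close> without including a member of \<open>\<G>\<close>, its complement in \<open>\<Union>\<G>\<close> belongs to \<open>\<F>\<close>.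
  Members of \<open>\<G>\<close> have to be non-empty to make \<open>\<F>\<close> non-empty.
\<close>

lemma bowtie_transversals:
  assumes "\<G> \<in> Fpow (Fpow J)" "{} \<notin> \<G>"
  defines "\<F> \<equiv> {F. F \<subseteq> \<Union>\<G> \<and> (\<forall>G\<in>\<G>. F \<inter> G \<noteq> {})}"
  shows "\<F> \<in> Fpow (Fpow J)" "\<F> \<noteq> {}" "bowtie J \<F> \<G>"
proof -
  have fin: "finite (\<Union>\<G>)" "\<Union>\<G> \<subseteq> J" using assms(1) by (auto simp: Fpow_def)
  then have "\<F> \<subseteq> Fpow J" unfolding \<F>_def Fpow_def by (auto dest: finite_subset)
  moreover have "finite \<F>"
    by (rule finite_subset[of _ "Pow (\<Union>\<G>)"]) (use fin in \<open>auto simp: \<F>_def\<close>)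
  ultimately show "\<F> \<in> Fpow (Fpow J)" by (simp add: Fpow_def)
  have "\<Union>\<G> \<inter> G \<noteq> {}" if "G \<in> \<G>" for G
  proof -
    have "\<Union>\<G> \<inter> G = G" using that by auto
    then show ?thesis using assms(2) that by auto
  qed
  then have "\<Union>\<G> \<in> \<F>" by (simp add: \<F>_def)
  then show "\<F> \<noteq> {}" by auto
  show "bowtie J \<F> \<G>"
    unfolding bowtie_def
  proof
    fix H assume H: "H \<in> transversals J \<F>"
    show "\<exists>G\<in>\<G>. G \<subseteq> H"
    proof (rule ccontr)
      assume no: "\<not> ?thesis"
      have "(\<Union>\<G> - H) \<inter> G \<noteq> {}" if "G \<in> \<G>" for G
      proof -
        have "\<not> G \<subseteq> H" using no that by simp
        then obtain x where "x \<in> G" "x \<notin> H" by fast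
        then have "x \<in> (\<Union>\<G> - H) \<inter> G" using that by auto
        then show ?thesis by auto
      qed
      then have "\<Union>\<G> - H \<in> \<F>" by (simp add: \<F>_def)
      then show False using H by (auto simp: transversals_def)
    qed
  qed
qed


lemma cut_comp_neI:
  assumes "r \<in> R" "t \<in> T" "\<F> \<in> Fpow (Fpow J)" "\<G> \<in> Fpow (Fpow J)" "\<F> \<noteq> {}" "bowtie J \<F> \<G>"
    and "\<And>F. F \<in> \<F> \<Longrightarrow> (r, F) \<in> A" "\<And>G. G \<in> \<G> \<Longrightarrow> (G, t) \<in> B"
  shows "(r, t) \<in> cut_comp_ne R J T A B"
proof -
  have "\<forall>F\<in>\<F>. (r, F) \<in> A" "\<forall>G\<in>\<G>. (G, t) \<in> B" using assms(7,8) by auto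
  then show ?thesis unfolding cut_comp_ne_def using assms(1-6) by auto
qed

lemma cut_comp_neE:
  assumes "(r, t) \<in> cut_comp_ne R J T A B"
  obtains \<F> \<G> where "r \<in> R" "t \<in> T" "\<F> \<in> Fpow (Fpow J)" "\<G> \<in> Fpow (Fpow J)" "\<F> \<noteq> {}"
    "bowtie J \<F> \<G>" "\<And>F. F \<in> \<F> \<Longrightarrow> (r, F) \<in> A" "\<And>G. G \<in> \<G> \<Longrightarrow> (G, t) \<in> B"
proof -
  obtain \<F> \<G> where "r \<in> R" "t \<in> T" "\<F> \<in> Fpow (Fpow J)" "\<G> \<in> Fpow (Fpow J)" "\<F> \<noteq> {}"
    "bowtie J \<F> \<G>" "\<forall>F\<in>\<F>. (r, F) \<in> A" "\<forall>G\<in>\<G>. (G, t) \<in> B"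
    using assms unfolding cut_comp_ne_def by auto
  then show thesis using that[of \<F> \<G>] by simp
qed


section \<open>Relations induced by partial maps\<close>

definition partial_vimage :: "('a \<rightharpoonup> 'b) \<Rightarrow> 'b set \<Rightarrow> 'a set" where
  "partial_vimage \<phi> V = {x. \<exists>y\<in>V. \<phi> x = Some y}"

text \<open>
  The relation \<open>Ab_mor\<close> for subbases given as indexed families; \<open>Ab_mor\<close> is the case where
  each open set is its own index.
\<close>

definition induced_rel :: "'a topology \<Rightarrow> 'i set \<Rightarrow> ('i \<Rightarrow> 'a set) \<Rightarrow> 'j set \<Rightarrow> ('j \<Rightarrow> 'b set) \<Rightarrow>
    ('a \<rightharpoonup> 'b) \<Rightarrow> ('i set \<times> 'j set) set" where
  "induced_rel X I U J W \<phi> = {(F, G) \<in> Fpow I \<times> Fpow J.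
     way_below X (Inter_in X (U ` F)) (partial_vimage \<phi> (\<Union>(W ` G)))}"

abbreviation id_on_space :: "'a topology \<Rightarrow> ('a \<rightharpoonup> 'a)" where
  "id_on_space X \<equiv> Some |` topspace X"

lemma openin_partial_vimage:
  assumes "\<phi> \<in> SSub_hom (S, X) (R, Y)" "openin Y V"
  shows "openin X (partial_vimage \<phi> V)"
proof -
  have od: "openin X (dom \<phi>)" and c: "continuous_map (subtopology X (dom \<phi>)) Y (the \<circ> \<phi>)"
    using assms(1) by simp_all
  have "{x \<in> topspace (subtopology X (dom \<phi>)). (the \<circ> \<phi>) x \<in> V} = partial_vimage \<phi> V"
    using openin_subset[OF od] by (auto simp: partial_vimage_def)
  then show ?thesis using openin_continuous_map_preimage[OF c assms(2)] openin_trans_full[OF _ od] by simp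
qed

lemma SSub_hom_topspace:
  assumes "\<phi> \<in> SSub_hom (S, X) (R, Y)" "\<phi> x = Some y"
  shows "x \<in> topspace X" "y \<in> topspace Y"
proof -
  show x: "x \<in> topspace X" using assms openin_subset[of X "dom \<phi>"] by auto
  have "(the \<circ> \<phi>) \<in> topspace (subtopology X (dom \<phi>)) \<rightarrow> topspace Y"
    using assms(1) by (simp add: continuous_map_def)
  then show "y \<in> topspace Y" using x assms(2) by (force simp: Pi_iff)
qed

text \<open>
  Subbasic sets cover the codomain, so openness of their preimages also makes the domain open.
\<close>

lemma SSub_homI:
  assumes sb: "subbasis Y (W ` J)" and dom: "\<And>x y. \<phi> x = Some y \<Longrightarrow> y \<in> topspace Y"
    and op: "\<And>j. j \<in> J \<Longrightarrow> openin X (partial_vimage \<phi> (W j))"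
  shows "\<phi> \<in> SSub_hom (S, X) (R, Y)"
proof -
  have "dom \<phi> = \<Union>((\<lambda>j. partial_vimage \<phi> (W j)) ` J)"
  proof (intro equalityI subsetI)
    fix x assume "x \<in> dom \<phi>"
    then obtain y where y: "\<phi> x = Some y" by auto
    then obtain j where "j \<in> J" "y \<in> W j" using subbasis_cover[OF sb dom] by metis
    then show "x \<in> \<Union>((\<lambda>j. partial_vimage \<phi> (W j)) ` J)" using y by (auto simp: partial_vimage_def)
  qed (auto simp: partial_vimage_def)
  then have od: "openin X (dom \<phi>)" using op by auto
  have gen: "topology_generated_by (W ` J) = Y" and UW: "\<Union>(W ` J) = topspace Y"
    using sb by (auto simp: subbasis_def)
  have "continuous_map (subtopology X (dom \<phi>)) (topology_generated_by (W ` J)) (the \<circ> \<phi>)"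
  proof (rule continuous_on_generated_topo)
    fix V assume "V \<in> W ` J"
    then obtain j where j: "j \<in> J" "V = W j" by blast
    have "(the \<circ> \<phi>) -` V \<inter> topspace (subtopology X (dom \<phi>)) = dom \<phi> \<inter> partial_vimage \<phi> (W j)"
      using j openin_subset[OF od] by (auto simp: partial_vimage_def)
    then show "openin (subtopology X (dom \<phi>)) ((the \<circ> \<phi>) -` V \<inter> topspace (subtopology X (dom \<phi>)))"
      using op[OF j(1)] by (auto simp: openin_subtopology_Int2)
  next
    show "(the \<circ> \<phi>) ` topspace (subtopology X (dom \<phi>)) \<subseteq> \<Union>(W ` J)"
      unfolding UW using dom by auto
  qed
  then show ?thesis using od gen by simp
qed

lemma SSub_hom_id: "id_on_space X \<in> SSub_hom (S, X) (R, X)"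
proof -
  have "continuous_map X X (the \<circ> id_on_space X)"
    by (rule continuous_map_eq[of _ _ id]) auto
  moreover have "dom (id_on_space X) = topspace X" by (simp add: dom_def restrict_map_def)
  ultimately show ?thesis by (simp add: continuous_map_from_subtopology)
qed

lemma partial_vimage_comp: "partial_vimage (\<psi> \<circ>\<^sub>m \<phi>) V = partial_vimage \<phi> (partial_vimage \<psi> V)"
  by (auto simp: partial_vimage_def map_comp_def split: option.splits)

lemma partial_vimage_id: "V \<subseteq> topspace X \<Longrightarrow> partial_vimage (id_on_space X) V = V"
  by (auto simp: partial_vimage_def restrict_map_def)

lemma SSub_hom_comp:
  assumes \<phi>: "\<phi> \<in> SSub_hom (S, X) (R, Y)" and \<psi>: "\<psi> \<in> SSub_hom (R', Y) (Q, Z)"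
    and sb: "subbasis Z (W ` K)"
  shows "\<psi> \<circ>\<^sub>m \<phi> \<in> SSub_hom (S', X) (Q', Z)"
proof (rule SSub_homI[OF sb])
  fix x z assume "(\<psi> \<circ>\<^sub>m \<phi>) x = Some z"
  then obtain y where "\<psi> y = Some z" by (auto simp: map_comp_def split: option.splits)
  then show "z \<in> topspace Z" by (rule SSub_hom_topspace(2)[OF \<psi>])
next
  fix k assume "k \<in> K"
  then have "openin Y (partial_vimage \<psi> (W k))"
    using openin_partial_vimage[OF \<psi>] subbasis_openin[OF sb] by blast
  then show "openin X (partial_vimage (\<psi> \<circ>\<^sub>m \<phi>) (W k))"
    using openin_partial_vimage[OF \<phi>] by (simp add: partial_vimage_comp)
qed



lemma partial_vimage_Union: "partial_vimage \<phi> (\<Union>(A ` I)) = (\<Union>i\<in>I. partial_vimage \<phi> (A i))"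
  by (auto simp: partial_vimage_def)

lemma partial_vimage_mono: "V \<subseteq> V' \<Longrightarrow> partial_vimage \<phi> V \<subseteq> partial_vimage \<phi> V'"
  by (auto simp: partial_vimage_def)

text \<open>
  The consequence of core compactness behind every inclusion into a cut-composition:
  \<open>way_below_finite_subcover\<close> selects a finite \<open>\<G>\<close> from a cover by basic sets, and distributivity
  turns the union over \<open>\<G>\<close> into an intersection over \<open>\<F>\<close>.
\<close>

lemma cut_of_way_below:
  assumes cc: "core_compact X" and \<phi>: "\<phi> \<in> SSub_hom (S, X) (R, Y)"
    and W: "\<And>j. j \<in> J \<Longrightarrow> openin Y (W j)"
    and wb: "way_below X p V"
    and H: "\<H> \<subseteq> Fpow J" "{} \<notin> \<H>" "V \<subseteq> (\<Union>H\<in>\<H>. partial_vimage \<phi> (Inter_in Y (W ` H)))"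
  obtains \<F> \<G> where "\<F> \<in> Fpow (Fpow J)" "\<G> \<in> Fpow (Fpow J)" "\<F> \<noteq> {}" "\<G> \<subseteq> \<H>" "bowtie J \<F> \<G>"
    "\<And>F. F \<in> \<F> \<Longrightarrow> way_below X p (partial_vimage \<phi> (\<Union>(W ` F)))"
proof -
  let ?b = "\<lambda>H. partial_vimage \<phi> (Inter_in Y (W ` H))"
  have op: "openin X (?b H)" if "H \<in> \<H>" for H
  proof -
    have "H \<in> Fpow J" using H(1) that by auto
    then have "openin Y (Inter_in Y (W ` H))"
      by (intro openin_Inter_in W) (auto simp: Fpow_def)
    then show ?thesis by (rule openin_partial_vimage[OF \<phi>])
  qed
  have "\<exists>\<V>\<subseteq>?b ` \<H>. finite \<V> \<and> way_below X p (\<Union>\<V>)"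
    by (rule way_below_finite_subcover[OF cc wb]) (use op H(3) in auto)
  then obtain \<G> where G: "\<G> \<subseteq> \<H>" "finite \<G>" "way_below X p (\<Union>(?b ` \<G>))"
    by (metis finite_subset_image)
  have GF: "\<G> \<in> Fpow (Fpow J)" using G(1,2) H(1) by (auto simp: Fpow_def)
  have G0: "{} \<notin> \<G>" using G(1) H(2) by auto
  let ?\<F> = "{F. F \<subseteq> \<Union>\<G> \<and> (\<forall>G\<in>\<G>. F \<inter> G \<noteq> {})}"
  show thesis
  proof (rule that[OF bowtie_transversals(1)[OF GF G0] GF bowtie_transversals(2)[OF GF G0] G(1)
        bowtie_transversals(3)[OF GF G0]])
    fix F assume F: "F \<in> ?\<F>"
    have "?b G \<subseteq> partial_vimage \<phi> (\<Union>(W ` F))" if "G \<in> \<G>" for G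
    proof (rule partial_vimage_mono)
      have "F \<inter> G \<noteq> {}" using F that by simp
      then obtain j where "j \<in> F" "j \<in> G" by auto
      then show "Inter_in Y (W ` G) \<subseteq> \<Union>(W ` F)" by (auto simp: Inter_in_def)
    qed
    then have "\<Union>(?b ` \<G>) \<subseteq> partial_vimage \<phi> (\<Union>(W ` F))" by (rule UN_least)
    then show "way_below X p (partial_vimage \<phi> (\<Union>(W ` F)))"
      by (rule way_below_mono[OF G(3) subset_refl])
  qed
qed

text \<open>
  The converse of \<open>cut_of_way_below\<close>, from core coherence.  A non-empty \<open>\<F>\<close> is essential here: an
  empty intersection would be the whole space rather than the domain of \<open>\<phi>\<close>.
\<close>

lemma way_below_of_cut:
  assumes co: "core_coherent X" and \<phi>: "\<phi> \<in> SSub_hom (S, X) (R, Y)"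
    and W: "\<And>j. j \<in> J \<Longrightarrow> openin Y (W j)" and p: "p \<subseteq> topspace X"
    and F: "\<F> \<in> Fpow (Fpow J)" "\<F> \<noteq> {}" and bt: "bowtie J \<F> \<G>"
    and wb: "\<And>F. F \<in> \<F> \<Longrightarrow> way_below X p (partial_vimage \<phi> (\<Union>(W ` F)))"
    and V: "\<And>G. G \<in> \<G> \<Longrightarrow> partial_vimage \<phi> (Inter_in Y (W ` G)) \<subseteq> V"
  shows "way_below X p V"
proof -
  let ?c = "\<lambda>F. partial_vimage \<phi> (\<Union>(W ` F))"
  have op: "openin X (?c F)" if "F \<in> \<F>" for F
    by (rule openin_partial_vimage[OF \<phi>]) (use Fpow_subset[OF Fpow_Fpow_mem[OF F(1) that]] W in auto)
  have "way_below X p (\<Inter>(?c ` \<F>))"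
    by (rule way_below_Inter[OF co _ _ p]) (use F op wb in \<open>auto simp: Fpow_def\<close>)
  moreover have "\<Inter>(?c ` \<F>) \<subseteq> V"
  proof
    fix x assume x: "x \<in> \<Inter>(?c ` \<F>)"
    then obtain y where y: "\<phi> x = Some y" using F(2) by (auto simp: partial_vimage_def)
    have "{j. y \<in> W j} \<inter> F \<noteq> {}" if "F \<in> \<F>" for F
      using x y that by (auto simp: partial_vimage_def)
    then obtain G where G: "G \<in> \<G>" "G \<subseteq> {j. y \<in> W j}" using bowtie_subset[OF bt F(1)] by metis
    then have "y \<in> Inter_in Y (W ` G)"
      using SSub_hom_topspace(2)[OF \<phi> y] by (auto simp: mem_Inter_in)
    then have "x \<in> partial_vimage \<phi> (Inter_in Y (W ` G))" using y by (auto simp: partial_vimage_def)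
    then show "x \<in> V" using V[OF G(1)] by auto
  qed
  ultimately show ?thesis by (rule way_below_mono[OF _ subset_refl])
qed

lemma Inter_in_subset: "Inter_in X F \<subseteq> topspace X"
  by (simp add: Inter_in_def)

lemma induced_rel_iff:
  "(F, G) \<in> induced_rel X I U J W \<phi> \<longleftrightarrow> F \<in> Fpow I \<and> G \<in> Fpow J \<and>
     way_below X (Inter_in X (U ` F)) (partial_vimage \<phi> (\<Union>(W ` G)))"
  by (simp add: induced_rel_def)

lemma openin_UN_subbasis:
  assumes "subbasis Y (W ` J)" "G \<in> Fpow J"
  shows "openin Y (\<Union>(W ` G))"
  using subbasis_openin[OF assms(1)] Fpow_subset[OF assms(2)] by auto

lemma nbhds_cover:
  assumes Y: "(W ` J, Y) \<in> SSub" and V: "openin Y V"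
  shows "partial_vimage \<phi> V \<subseteq>
    (\<Union>H\<in>{H \<in> Fpow J. H \<noteq> {} \<and> way_below Y (Inter_in Y (W ` H)) V}.
        partial_vimage \<phi> (Inter_in Y (W ` H)))"
proof
  fix x assume "x \<in> partial_vimage \<phi> V"
  then obtain y where y: "y \<in> V" "\<phi> x = Some y" by (auto simp: partial_vimage_def)
  obtain H where "H \<in> Fpow J" "H \<noteq> {}" "y \<in> Inter_in Y (W ` H)" "way_below Y (Inter_in Y (W ` H)) V"
    using way_below_nbhd[OF Y V y(1)] by auto
  then show "x \<in> (\<Union>H\<in>{H \<in> Fpow J. H \<noteq> {} \<and> way_below Y (Inter_in Y (W ` H)) V}.
        partial_vimage \<phi> (Inter_in Y (W ` H)))"
    using y(2) by (auto simp: partial_vimage_def)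
qed

text \<open>
  A preimage is covered by the preimages of the basic sets way below the given open set, which are
  the sets related to \<open>G\<close> by the second relation; \<open>cut_of_way_below\<close> and \<open>way_below_of_cut\<close> then give
  the two inclusions.
\<close>

theorem induced_rel_comp:
  assumes X: "(U ` I, X) \<in> SSub" and Y: "(W ` J, Y) \<in> SSub" and Z: "(Q ` K, Z) \<in> SSub"
    and \<phi>: "\<phi> \<in> SSub_hom (S, X) (R, Y)" and \<psi>: "\<psi> \<in> SSub_hom (R', Y) (P, Z)"
  shows "cut_comp_ne (Fpow I) J (Fpow K) (induced_rel X I U J W \<phi>) (induced_rel Y J W K Q \<psi>) =
    induced_rel X I U K Q (\<psi> \<circ>\<^sub>m \<phi>)" (is "?c = ?r")
proof (intro equalityI subrelI)
  have sX: "core_compact X" "core_coherent X" using X by (auto simp: SSub_iff)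
  have sbY: "subbasis Y (W ` J)" and sbZ: "subbasis Z (Q ` K)" using Y Z by (auto simp: SSub_iff)
  have Wo: "\<And>j. j \<in> J \<Longrightarrow> openin Y (W j)" using subbasis_openin[OF sbY] by simp
  have op: "openin Y (partial_vimage \<psi> (\<Union>(Q ` G)))" if "G \<in> Fpow K" for G
    by (rule openin_partial_vimage[OF \<psi> openin_UN_subbasis[OF sbZ that]])
  {
    fix F G assume "(F, G) \<in> ?c"
    then obtain \<F> \<G> where FG: "F \<in> Fpow I" "G \<in> Fpow K" "\<F> \<in> Fpow (Fpow J)" "\<F> \<noteq> {}" "bowtie J \<F> \<G>"
      and F: "\<And>F'. F' \<in> \<F> \<Longrightarrow> (F, F') \<in> induced_rel X I U J W \<phi>"
      and G: "\<And>G'. G' \<in> \<G> \<Longrightarrow> (G', G) \<in> induced_rel Y J W K Q \<psi>"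
      by (rule cut_comp_neE) metis
    have "way_below X (Inter_in X (U ` F)) (partial_vimage \<phi> (partial_vimage \<psi> (\<Union>(Q ` G))))"
    proof (rule way_below_of_cut[OF sX(2) \<phi> Wo Inter_in_subset FG(3,4,5)])
      fix F' assume "F' \<in> \<F>"
      then show "way_below X (Inter_in X (U ` F)) (partial_vimage \<phi> (\<Union>(W ` F')))"
        using F by (simp add: induced_rel_iff)
    next
      fix G' assume "G' \<in> \<G>"
      then have "way_below Y (Inter_in Y (W ` G')) (partial_vimage \<psi> (\<Union>(Q ` G)))"
        using G by (simp add: induced_rel_iff)
      then have "Inter_in Y (W ` G') \<subseteq> partial_vimage \<psi> (\<Union>(Q ` G))"
        by (rule way_below_subset[OF _ op[OF FG(2)]])
      then show "partial_vimage \<phi> (Inter_in Y (W ` G')) \<subseteq> partial_vimage \<phi> (partial_vimage \<psi> (\<Union>(Q ` G)))"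
        by (rule partial_vimage_mono)
    qed
    then show "(F, G) \<in> ?r" using FG by (simp add: induced_rel_iff partial_vimage_comp)
  next
    fix F G assume "(F, G) \<in> ?r"
    then have FG: "F \<in> Fpow I" "G \<in> Fpow K"
      and wb: "way_below X (Inter_in X (U ` F)) (partial_vimage \<phi> (partial_vimage \<psi> (\<Union>(Q ` G))))"
      by (simp_all add: induced_rel_iff partial_vimage_comp)
    let ?H = "{H \<in> Fpow J. H \<noteq> {} \<and> way_below Y (Inter_in Y (W ` H)) (partial_vimage \<psi> (\<Union>(Q ` G)))}"
    have H: "?H \<subseteq> Fpow J" "{} \<notin> ?H" by auto
    obtain \<F> \<G> where "\<F> \<in> Fpow (Fpow J)" "\<G> \<in> Fpow (Fpow J)" "\<F> \<noteq> {}" "\<G> \<subseteq> ?H" "bowtie J \<F> \<G>"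
      "\<And>F'. F' \<in> \<F> \<Longrightarrow> way_below X (Inter_in X (U ` F)) (partial_vimage \<phi> (\<Union>(W ` F')))"
      by (rule cut_of_way_below[OF sX(1) \<phi> Wo wb H nbhds_cover[OF Y op[OF FG(2)]]]) auto
    then show "(F, G) \<in> ?c"
      by (intro cut_comp_neI[of _ _ _ _ \<F> _ \<G>])
        (use FG in \<open>auto simp: induced_rel_iff dest: Fpow_Fpow_mem\<close>)
  }
qed

text \<open>
  Here the relevant cover of the preimage of \<open>\<Union>j\<in>G. W j\<close> consists of the basic sets of \<open>X\<close> that are
  way below the preimage of a single \<open>W j\<close>.
\<close>

theorem induced_rel_one_ex:
  assumes X: "(U ` I, X) \<in> SSub" and Y: "(W ` J, Y) \<in> SSub"
    and \<phi>: "\<phi> \<in> SSub_hom (S, X) (R, Y)"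
  shows "cut_comp_ne (Fpow I) I (Fpow J) (induced_rel X I U I U (id_on_space X))
      (one_ex J (induced_rel X I U J W \<phi>)) = induced_rel X I U J W \<phi>" (is "?c = ?r")
proof (intro equalityI subrelI)
  have sX: "core_compact X" "core_coherent X" "subbasis X (U ` I)" and sbY: "subbasis Y (W ` J)"
    using X Y by (auto simp: SSub_iff)
  have Uo: "\<And>i. i \<in> I \<Longrightarrow> openin X (U i)" using subbasis_openin[OF sX(3)] by simp
  have id: "id_on_space X \<in> SSub_hom (U ` I, X) (U ` I, X)" by (rule SSub_hom_id)
  have vid: "partial_vimage (id_on_space X) (Inter_in X V) = Inter_in X V" for V
    by (rule partial_vimage_id) (simp add: Inter_in_def)
  have op: "openin X (partial_vimage \<phi> (W j))" if "j \<in> J" for j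
    by (rule openin_partial_vimage[OF \<phi> subbasis_openin[OF sbY that]])
  {
    fix F G assume "(F, G) \<in> ?c"
    then obtain \<F> \<G> where FG: "F \<in> Fpow I" "G \<in> Fpow J" "\<F> \<in> Fpow (Fpow I)" "\<F> \<noteq> {}" "bowtie I \<F> \<G>"
      and F: "\<And>F'. F' \<in> \<F> \<Longrightarrow> (F, F') \<in> induced_rel X I U I U (id_on_space X)"
      and G: "\<And>G'. G' \<in> \<G> \<Longrightarrow> (G', G) \<in> one_ex J (induced_rel X I U J W \<phi>)"
      by (rule cut_comp_neE) metis
    have "way_below X (Inter_in X (U ` F)) (partial_vimage \<phi> (\<Union>(W ` G)))"
    proof (rule way_below_of_cut[OF sX(2) id Uo Inter_in_subset FG(3,4,5)])
      fix F' assume "F' \<in> \<F>"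
      then show "way_below X (Inter_in X (U ` F)) (partial_vimage (id_on_space X) (\<Union>(U ` F')))"
        using F by (simp add: induced_rel_iff)
    next
      fix G' assume "G' \<in> \<G>"
      then obtain g where g: "g \<in> G" "way_below X (Inter_in X (U ` G')) (partial_vimage \<phi> (W g))"
        using G by (auto simp: induced_rel_iff one_ex_def)
      then have "Inter_in X (U ` G') \<subseteq> partial_vimage \<phi> (W g)"
        using op Fpow_subset[OF FG(2)] by (intro way_below_subset) auto
      also have "\<dots> \<subseteq> partial_vimage \<phi> (\<Union>(W ` G))" using g(1) by (intro partial_vimage_mono) auto
      finally show "partial_vimage (id_on_space X) (Inter_in X (U ` G')) \<subseteq> partial_vimage \<phi> (\<Union>(W ` G))"
        by (simp add: vid)
    qed
    then show "(F, G) \<in> ?r" using FG by (simp add: induced_rel_iff)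
  next
    fix F G assume "(F, G) \<in> ?r"
    then have FG: "F \<in> Fpow I" "G \<in> Fpow J"
      and wb: "way_below X (Inter_in X (U ` F)) (partial_vimage \<phi> (\<Union>(W ` G)))"
      by (simp_all add: induced_rel_iff)
    let ?H = "{H \<in> Fpow I. H \<noteq> {} \<and> (\<exists>g\<in>G. way_below X (Inter_in X (U ` H)) (partial_vimage \<phi> (W g)))}"
    have H: "?H \<subseteq> Fpow I" "{} \<notin> ?H" by auto
    have cov: "partial_vimage \<phi> (\<Union>(W ` G)) \<subseteq>
        (\<Union>H\<in>?H. partial_vimage (id_on_space X) (Inter_in X (U ` H)))"
    proof
      fix x assume "x \<in> partial_vimage \<phi> (\<Union>(W ` G))"
      then obtain g where g: "g \<in> G" "x \<in> partial_vimage \<phi> (W g)"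
        by (auto simp: partial_vimage_def)
      have "g \<in> J" using g(1) Fpow_subset[OF FG(2)] by auto
      obtain H where "H \<in> Fpow I" "H \<noteq> {}" "x \<in> Inter_in X (U ` H)"
          "way_below X (Inter_in X (U ` H)) (partial_vimage \<phi> (W g))"
        using way_below_nbhd[OF X op[OF \<open>g \<in> J\<close>] g(2)] by auto
      then show "x \<in> (\<Union>H\<in>?H. partial_vimage (id_on_space X) (Inter_in X (U ` H)))"
        using g(1) unfolding vid by auto
    qed
    obtain \<F> \<G> where c: "\<F> \<in> Fpow (Fpow I)" "\<G> \<in> Fpow (Fpow I)" "\<F> \<noteq> {}" "\<G> \<subseteq> ?H" "bowtie I \<F> \<G>"
      "\<And>F'. F' \<in> \<F> \<Longrightarrow> way_below X (Inter_in X (U ` F)) (partial_vimage (id_on_space X) (\<Union>(U ` F')))"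
      by (rule cut_of_way_below[OF sX(1) id Uo wb H cov]) auto
    have "(G', G) \<in> one_ex J (induced_rel X I U J W \<phi>)" if G': "G' \<in> \<G>" for G'
    proof -
      obtain g where "g \<in> G" "way_below X (Inter_in X (U ` G')) (partial_vimage \<phi> (W g))"
        using subsetD[OF c(4) G'] by auto
      moreover have "{g} \<in> Fpow J" using \<open>g \<in> G\<close> FG(2) by (auto simp: Fpow_def)
      ultimately show ?thesis
        using FG(2) Fpow_Fpow_mem[OF c(2) G'] by (auto simp: one_ex_def induced_rel_iff)
    qed
    then show "(F, G) \<in> ?c"
      by (intro cut_comp_neI[of _ _ _ _ \<F> _ \<G>])
        (use FG c in \<open>auto simp: induced_rel_iff dest: Fpow_Fpow_mem\<close>)
  }
qed

lemma id_map_comp: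
  assumes "\<phi> \<in> SSub_hom (S, X) (R, Y)"
  shows "\<phi> \<circ>\<^sub>m id_on_space X = \<phi>" "id_on_space Y \<circ>\<^sub>m \<phi> = \<phi>"
proof -
  show "\<phi> \<circ>\<^sub>m id_on_space X = \<phi>"
  proof
    fix x show "(\<phi> \<circ>\<^sub>m id_on_space X) x = \<phi> x"
      using SSub_hom_topspace(1)[OF assms, of x]
      by (cases "\<phi> x") (auto simp: map_comp_def restrict_map_def)
  qed
  show "id_on_space Y \<circ>\<^sub>m \<phi> = \<phi>"
  proof
    fix x show "(id_on_space Y \<circ>\<^sub>m \<phi>) x = \<phi> x"
      using SSub_hom_topspace(2)[OF assms, of x]
      by (cases "\<phi> x") (auto simp: map_comp_def restrict_map_def)
  qed
qed

definition induced_cov :: "'a topology \<Rightarrow> 'i set \<Rightarrow> ('i \<Rightarrow> 'a set) \<Rightarrow> 'i cov" where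
  "induced_cov X I U = (I, induced_rel X I U I U (id_on_space X))"

lemma induced_rel_Cov_hom:
  assumes X: "(U ` I, X) \<in> SSub" and Y: "(W ` J, Y) \<in> SSub"
    and \<phi>: "\<phi> \<in> SSub_hom (S, X) (R, Y)"
  shows "induced_rel X I U J W \<phi> \<in> Cov_hom (induced_cov Y J W) (induced_cov X I U)"
  using induced_rel_comp[OF X Y Y \<phi> SSub_hom_id] induced_rel_one_ex[OF X Y \<phi>] id_map_comp[OF \<phi>]
  by (auto simp: induced_cov_def induced_rel_iff)

lemma induced_rel_id_iff:
  assumes "subbasis X (U ` I)"
  shows "(F, G) \<in> induced_rel X I U I U (id_on_space X) \<longleftrightarrow>
    F \<in> Fpow I \<and> G \<in> Fpow I \<and> way_below X (Inter_in X (U ` F)) (\<Union>(U ` G))"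
proof (cases "G \<in> Fpow I")
  case True
  then show ?thesis
    using partial_vimage_id[OF openin_subset[OF openin_UN_subbasis[OF assms True]]]
    by (simp add: induced_rel_iff)
qed (simp add: induced_rel_iff)

text \<open>
  The remaining axiom holds because \<open>Vdash\<close> of the induced relation relates \<open>F\<close> to \<open>H\<close> only if
  \<open>\<Inter>F \<subseteq> \<Union>H\<close>: each point of \<open>\<Inter>F\<close> lies in a basic set way below \<open>\<Inter>F\<close>.  Then \<open>\<Inter>F\<close> is the finite union of the sets
  \<open>\<Inter>({h} \<union> F)\<close> over \<open>h \<in> H\<close>.
\<close>

theorem induced_cov_Cov:
  assumes X: "(U ` I, X) \<in> SSub"
  shows "induced_cov X I U \<in> Cov"
proof -
  let ?R = "induced_rel X I U I U (id_on_space X)"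
  have sb: "subbasis X (U ` I)" using X by (simp add: SSub_iff)
  note Riff = induced_rel_id_iff[OF sb]
  have id: "id_on_space X \<in> SSub_hom (U ` I, X) (U ` I, X)" by (rule SSub_hom_id)
  have "monotone_rel I ?R"
    unfolding monotone_rel_def
  proof (intro ballI impI)
    fix F G F' G' assume FG: "F' \<in> Fpow I" "G' \<in> Fpow I" and h: "(F, G) \<in> ?R \<and> F \<subseteq> F' \<and> G \<subseteq> G'"
    have "way_below X (Inter_in X (U ` F')) (\<Union>(U ` G'))"
      by (rule way_below_mono[of _ "Inter_in X (U ` F)" "\<Union>(U ` G)"])
        (use h in \<open>auto simp: Riff Inter_in_def\<close>)
    then show "(F', G') \<in> ?R" using FG by (simp add: Riff)
  qed
  moreover have "?R \<subseteq> Fpow I \<times> Fpow I" by (auto simp: induced_rel_iff)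
  ultimately have "strong_idempotent I ?R"
    unfolding strong_idempotent_cut_comp_ne
    using induced_rel_comp[OF X X X id id] induced_rel_one_ex[OF X X id] id_map_comp(1)[OF id] by simp
  moreover have "(F, G) \<in> ?R" if F: "F \<in> Fpow I" and G: "G \<in> Fpow I"
    and V: "(F, H) \<in> Vdash I ?R" and h: "\<forall>h\<in>H. ({h} \<union> F, G) \<in> ?R" for F G H
  proof -
    have HI: "H \<in> Fpow I" and Vd: "\<And>K. \<lbrakk>K \<in> bounded_sets I ?R; \<forall>f\<in>F. (K, {f}) \<in> ?R\<rbrakk> \<Longrightarrow> (K, H) \<in> ?R"
      using V unfolding Vdash_def by auto
    have "Inter_in X (U ` F) \<subseteq> \<Union>((\<lambda>h. Inter_in X (U ` ({h} \<union> F))) ` H)"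
    proof
      fix x assume x: "x \<in> Inter_in X (U ` F)"
      then have xt: "x \<in> topspace X" by (simp add: mem_Inter_in)
      obtain i where i: "i \<in> I" "x \<in> U i" using subbasis_cover[OF sb xt] .
      \<comment> \<open>The index \<open>i\<close> keeps \<open>K\<close> bounded even if \<open>F\<close> is empty.\<close>
      have "openin X (Inter_in X (U ` insert i F))"
        by (rule openin_Inter_in) (use F i subbasis_openin[OF sb] in \<open>auto simp: Fpow_def\<close>)
      moreover have "x \<in> Inter_in X (U ` insert i F)" using x i by (simp add: Inter_in_def)
      ultimately obtain K where K: "K \<in> Fpow I" "x \<in> Inter_in X (U ` K)"
        "way_below X (Inter_in X (U ` K)) (Inter_in X (U ` insert i F))"
        using way_below_nbhd[OF X] by metis
      have "(K, {f}) \<in> ?R" if "f \<in> insert i F" for f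
      proof -
        have "way_below X (Inter_in X (U ` K)) (U f)"
          by (rule way_below_mono[OF K(3)]) (use that in \<open>auto simp: Inter_in_def\<close>)
        then show ?thesis using K(1) that i F by (auto simp: Riff Fpow_def)
      qed
      moreover from this[of i] have "K \<in> bounded_sets I ?R"
        using K(1) i by (auto simp: bounded_sets_def Fpow_def)
      ultimately have "(K, H) \<in> ?R" using Vd by simp
      then have "Inter_in X (U ` K) \<subseteq> \<Union>(U ` H)"
        by (intro way_below_subset[OF _ openin_UN_subbasis[OF sb HI]]) (simp add: Riff)
      then have "x \<in> \<Union>(U ` H)" using K(2) by auto
      then show "x \<in> \<Union>((\<lambda>h. Inter_in X (U ` ({h} \<union> F))) ` H)" using x by (auto simp: Inter_in_def)
    qed
    moreover have "way_below X (\<Union>((\<lambda>h. Inter_in X (U ` ({h} \<union> F))) ` H)) (\<Union>(U ` G))"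
      by (rule way_below_Union) (use Fpow_finite[OF HI] h in \<open>auto simp: Riff\<close>)
    ultimately have "way_below X (Inter_in X (U ` F)) (\<Union>(U ` G))"
      using way_below_mono by (metis subset_refl)
    then show ?thesis using F G by (simp add: Riff)
  qed
  ultimately have "cover_relation I ?R" unfolding cover_relation_def by metis
  then show ?thesis by (simp add: Cov_def induced_cov_def)
qed



section \<open>Tight sets of a cover relation\<close>

lemma cover_relation_subset: "cover_relation S R \<Longrightarrow> R \<subseteq> Fpow S \<times> Fpow S"
  by (simp add: cover_relation_def strong_idempotent_def)

lemma cover_relation_mono:
  assumes "cover_relation S R" "(F, G) \<in> R" "F \<subseteq> F'" "G \<subseteq> G'" "F' \<in> Fpow S" "G' \<in> Fpow S"
  shows "(F', G') \<in> R"
proof (rule monotone_relD[of S R F G])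
  show "monotone_rel S R" using assms(1) by (simp add: cover_relation_def strong_idempotent_def)
  show "F \<in> Fpow S" "G \<in> Fpow S" using cover_relation_subset[OF assms(1)] assms(2) by auto
qed (use assms in auto)

lemma cover_relation_trans:
  assumes cr: "cover_relation S R" and E: "E \<in> Fpow S" and F: "(F, G) \<in> R" "\<And>f. f \<in> F \<Longrightarrow> (E, {f}) \<in> R"
  shows "(E, G) \<in> R"
proof -
  have FG: "F \<in> Fpow S" "G \<in> Fpow S" using cover_relation_subset[OF cr] F(1) by auto
  have 1: "(\<lambda>f. {f}) ` F \<in> Fpow (Fpow S)" "{F} \<in> Fpow (Fpow S)" using FG by (auto simp: Fpow_def)
  have 2: "bowtie S ((\<lambda>f. {f}) ` F) {F}" by (auto simp: bowtie_def transversals_def)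
  have 3: "\<forall>F'\<in>(\<lambda>f. {f}) ` F. (E, F') \<in> R" "\<forall>G'\<in>{F}. (G', G) \<in> R" using F by auto
  have "(E, G) \<in> cut_comp (Fpow S) S (Fpow S) R R"
    unfolding cut_comp_def using E FG 1 2 3 by auto
  then show ?thesis using cr by (auto simp: cover_relation_def strong_idempotent_def)
qed

lemma cover_relation_interpolate:
  assumes cr: "cover_relation S R" and FG: "(F, G) \<in> R"
  obtains \<F> \<G> where "\<F> \<in> Fpow (Fpow S)" "\<G> \<in> Fpow (Fpow S)" "\<F> \<noteq> {}" "bowtie S \<F> \<G>"
    "\<And>F'. F' \<in> \<F> \<Longrightarrow> (F, F') \<in> R" "\<And>G'. G' \<in> \<G> \<Longrightarrow> \<exists>g\<in>G. (G', {g}) \<in> R"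
proof -
  have "(F, G) \<in> cut_comp_ne (Fpow S) S (Fpow S) R (one_ex S R)"
    using cr FG by (auto simp: cover_relation_def strong_idempotent_cut_comp_ne)
  then show thesis
    by (rule cut_comp_neE) (rule that, auto simp: one_ex_def)
qed

text \<open>
  The cut rule in its usual form; it follows from the axiom of cover relations because a relation
  transitive for singletons is contained in its \<open>Vdash\<close>.
\<close>

lemma cover_relation_cut:
  assumes cr: "cover_relation S R" and F: "F \<in> Fpow S" "(F, H) \<in> R"
    and G: "G \<in> Fpow S" "\<And>h. h \<in> H \<Longrightarrow> (insert h F, G) \<in> R"
  shows "(F, G) \<in> R"
proof -
  have H: "H \<in> Fpow S" using cover_relation_subset[OF cr] F(2) by auto
  have "(K, H) \<in> R" if "K \<in> bounded_sets S R" "\<forall>f\<in>F. (K, {f}) \<in> R" for K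
    using that by (intro cover_relation_trans[OF cr _ F(2)]) (auto simp: bounded_sets_def)
  then have "(F, H) \<in> Vdash S R" using F(1) H by (simp add: Vdash_def)
  moreover have "\<forall>h\<in>H. ({h} \<union> F, G) \<in> R" using G(2) by simp
  ultimately show ?thesis using cr F(1) G(1) H unfolding cover_relation_def by meson
qed

lemma Fpow_UN:
  assumes "finite F" "\<And>f. f \<in> F \<Longrightarrow> e f \<in> Fpow V"
  shows "(\<Union>f\<in>F. e f) \<in> Fpow V"
  using assms by (fastforce simp: Fpow_def)

text \<open>
  The prime ideal theorem for cover relations; say that \<open>F\<close> covers \<open>G\<close> if \<open>(F, G) \<in> R\<close>.  Choose
  \<open>V \<supseteq> H\<close> maximal among the sets none of whose finite subsets covers a finite subset of \<open>C\<close>, and let \<open>T\<close> consist of all \<open>p\<close> such that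
  \<open>{p}\<close> is covered by a finite subset of \<open>V\<close>.  The set \<open>V\<close> itself need not be tight, since it may contain
  elements that no finite part of it covers.  If a finite \<open>F \<subseteq> V\<close> covers \<open>G\<close>, interpolation and the cut rule show
  that \<open>T\<close> meets \<open>G\<close>: otherwise \<open>V\<close> misses some \<open>F'\<close> that \<open>F\<close> covers, while by maximality
  adding any element of \<open>F'\<close> to \<open>V\<close> covers a finite subset of \<open>C\<close>, and cutting on \<open>F'\<close> shows that \<open>V\<close> does
  so already.
\<close>

theorem exists_tight_set:
  assumes cr: "cover_relation S R" and H: "H \<in> Fpow S" and C: "C \<subseteq> S"
    and no: "\<And>D. D \<in> Fpow C \<Longrightarrow> (H, D) \<notin> R"
  obtains T where "tight (S, R) T" "T \<inter> C = {}" "\<And>G. (H, G) \<in> R \<Longrightarrow> T \<inter> G \<noteq> {}"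
proof -
  note sub = cover_relation_subset[OF cr] and mono = cover_relation_mono[OF cr]
  define \<A> where "\<A> = {V. H \<subseteq> V \<and> V \<subseteq> S \<and> (\<forall>F\<in>Fpow V. \<forall>D\<in>Fpow C. (F, D) \<notin> R)}"
  have FpowC: "D \<in> Fpow S" if "D \<in> Fpow C" for D using that C by (auto simp: Fpow_def)
  have "H \<in> \<A>"
  proof -
    have "(F, D) \<notin> R" if "F \<in> Fpow H" "D \<in> Fpow C" for F D
      using mono[of F D H D] no[OF that(2)] Fpow_subset[OF that(1)] H FpowC[OF that(2)] by auto
    then show ?thesis using H by (auto simp: \<A>_def Fpow_def)
  qed
  have "\<exists>V\<in>\<A>. \<forall>V'\<in>\<A>. V \<subseteq> V' \<longrightarrow> V' = V"
  proof (rule subset_Zorn_nonempty)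
    show "\<A> \<noteq> {}" using \<open>H \<in> \<A>\<close> by auto
  next
    fix \<C> assume ne: "\<C> \<noteq> {}" and ch: "subset.chain \<A> \<C>"
    have CA: "\<C> \<subseteq> \<A>" using ch by (simp add: subset_chain_def)
    have "(F, D) \<notin> R" if F: "F \<in> Fpow (\<Union>\<C>)" and D: "D \<in> Fpow C" for F D
    proof -
      obtain V where "V \<in> \<C>" "F \<subseteq> V"
        using finite_subset_Union_chain[OF Fpow_finite[OF F] Fpow_subset[OF F] ne ch] by auto
      then have "V \<in> \<A>" "F \<in> Fpow V" using CA Fpow_finite[OF F] by (auto simp: Fpow_def)
      then show ?thesis using D by (simp add: \<A>_def)
    qed
    moreover have "H \<subseteq> \<Union>\<C>"
    proof -
      obtain V where V: "V \<in> \<C>" using ne by auto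
      then have "H \<subseteq> V" using subsetD[OF CA V] by (simp add: \<A>_def)
      then show ?thesis using V by auto
    qed
    moreover have "\<Union>\<C> \<subseteq> S"
      by (rule Union_least) (use subsetD[OF CA] in \<open>simp add: \<A>_def\<close>)
    ultimately show "\<Union>\<C> \<in> \<A>" by (simp add: \<A>_def)
  qed
  then obtain V where VA: "V \<in> \<A>" and max: "\<And>V'. \<lbrakk>V' \<in> \<A>; V \<subseteq> V'\<rbrakk> \<Longrightarrow> V' = V" by metis
  then have HV: "H \<subseteq> V" and VS: "V \<subseteq> S" and Vno: "\<And>F D. \<lbrakk>F \<in> Fpow V; D \<in> Fpow C\<rbrakk> \<Longrightarrow> (F, D) \<notin> R"
    by (auto simp: \<A>_def)
  have FpowV: "F \<in> Fpow S" if "F \<in> Fpow V" for F using that VS by (auto simp: Fpow_def)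
  define T where "T = {p \<in> S. \<exists>E\<in>Fpow V. (E, {p}) \<in> R}"
  have out: "\<exists>E\<in>Fpow V. \<exists>D\<in>Fpow C. (insert p E, D) \<in> R" if p: "p \<in> S" "p \<notin> V" for p
  proof -
    have "insert p V \<notin> \<A>" using max[of "insert p V"] p by auto
    then obtain F D where F: "F \<in> Fpow (insert p V)" "D \<in> Fpow C" "(F, D) \<in> R"
      using HV VS p(1) by (auto simp: \<A>_def)
    have E: "F - {p} \<in> Fpow V" using F(1) by (auto simp: Fpow_def)
    have "(insert p (F - {p}), D) \<in> R"
      by (rule mono[OF F(3)]) (use E F(2) p VS C in \<open>auto simp: Fpow_def\<close>)
    then show ?thesis using E F(2) by meson
  qed
  have prime: "T \<inter> G \<noteq> {}" if F: "F \<in> Fpow V" and FG: "(F, G) \<in> R" for F G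
  proof -
    obtain \<F> \<G> where c: "\<F> \<in> Fpow (Fpow S)" "\<G> \<in> Fpow (Fpow S)" "bowtie S \<F> \<G>"
      and cF: "\<And>F'. F' \<in> \<F> \<Longrightarrow> (F, F') \<in> R" and cG: "\<And>G'. G' \<in> \<G> \<Longrightarrow> \<exists>g\<in>G. (G', {g}) \<in> R"
      by (rule cover_relation_interpolate[OF cr FG]) metis
    have "V \<inter> F' \<noteq> {}" if F': "F' \<in> \<F>" for F'
    proof
      assume e: "V \<inter> F' = {}"
      have F'S: "F' \<in> Fpow S" by (rule Fpow_Fpow_mem[OF c(1) F'])
      have "\<forall>f\<in>F'. \<exists>E D. E \<in> Fpow V \<and> D \<in> Fpow C \<and> (insert f E, D) \<in> R"
        using out e Fpow_subset[OF F'S] by (metis IntI empty_iff subsetD)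
      then obtain e d where ed: "\<And>f. f \<in> F' \<Longrightarrow> e f \<in> Fpow V \<and> d f \<in> Fpow C \<and> (insert f (e f), d f) \<in> R"
        by metis
      let ?E = "F \<union> (\<Union>f\<in>F'. e f)" and ?D = "\<Union>f\<in>F'. d f"
      have E: "?E \<in> Fpow V" and D: "?D \<in> Fpow C"
        using Fpow_UN[OF Fpow_finite[OF F'S], of e V] Fpow_UN[OF Fpow_finite[OF F'S], of d C] ed F
        by (auto simp: Fpow_def)
      have "(?E, ?D) \<in> R"
      proof (rule cover_relation_cut[OF cr FpowV[OF E] _ FpowC[OF D]])
        show "(?E, F') \<in> R" by (rule mono[OF cF[OF F']]) (use FpowV[OF E] F'S in auto)
      next
        fix f assume f: "f \<in> F'"
        have 1: "insert f ?E \<in> Fpow S" using f FpowV[OF E] F'S by (auto simp: Fpow_def)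
        have 2: "insert f (e f) \<subseteq> insert f ?E" "d f \<subseteq> ?D" using f by auto
        have 3: "(insert f (e f), d f) \<in> R" using ed[OF f] by simp
        show "(insert f ?E, ?D) \<in> R" by (rule mono[OF 3 2 1 FpowC[OF D]])
      qed
      then show False using Vno[OF E D] by simp
    qed
    then obtain G' where G': "G' \<in> \<G>" "G' \<subseteq> V" using bowtie_subset[OF c(3,1)] by metis
    then have "G' \<in> Fpow V" using Fpow_Fpow_mem[OF c(2) G'(1)] by (auto simp: Fpow_def)
    moreover obtain g where g: "g \<in> G" "(G', {g}) \<in> R" using cG[OF G'(1)] by auto
    moreover have "g \<in> S" using g(2) sub by (auto simp: Fpow_def)
    ultimately have "g \<in> T" by (auto simp: T_def)
    then show ?thesis using g(1) by auto
  qed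
  have lift: "\<exists>E\<in>Fpow V. \<forall>f\<in>F. (E, {f}) \<in> R" if F: "F \<in> Fpow T" for F
  proof -
    have "\<forall>f\<in>F. \<exists>E. E \<in> Fpow V \<and> (E, {f}) \<in> R" using Fpow_subset[OF F] by (auto simp: T_def)
    then obtain e where e: "\<And>f. f \<in> F \<Longrightarrow> e f \<in> Fpow V \<and> (e f, {f}) \<in> R" by metis
    have E: "(\<Union>f\<in>F. e f) \<in> Fpow V" by (rule Fpow_UN[OF Fpow_finite[OF F]]) (use e in simp)
    have "((\<Union>f\<in>F. e f), {f}) \<in> R" if f: "f \<in> F" for f
    proof (rule mono)
      show "(e f, {f}) \<in> R" using e[OF f] by simp
      then show "{f} \<in> Fpow S" using sub by auto
    qed (use f FpowV[OF E] in auto)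
    then show ?thesis using E by auto
  qed
  have "tight (S, R) T"
    unfolding tight.simps
  proof (intro conjI ballI iffI)
    show "T \<subseteq> S" by (auto simp: T_def)
  next
    fix G assume "G \<in> Fpow S" "\<exists>F\<in>Fpow T. (F, G) \<in> R"
    then obtain F where F: "F \<in> Fpow T" "(F, G) \<in> R" by auto
    then obtain E where E: "E \<in> Fpow V" "\<forall>f\<in>F. (E, {f}) \<in> R" using lift by metis
    have "(E, G) \<in> R"
      by (rule cover_relation_trans[OF cr FpowV[OF E(1)] F(2)]) (use E(2) in simp)
    then show "T \<inter> G \<noteq> {}" by (rule prime[OF E(1)])
  next
    fix G assume G: "G \<in> Fpow S" "T \<inter> G \<noteq> {}"
    then obtain g where g: "g \<in> T" "g \<in> G" by auto
    then obtain E where E: "E \<in> Fpow V" "(E, {g}) \<in> R" by (auto simp: T_def)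
    obtain \<F> \<G> where c: "\<F> \<in> Fpow (Fpow S)" "\<G> \<in> Fpow (Fpow S)" "bowtie S \<F> \<G>"
      and cF: "\<And>F'. F' \<in> \<F> \<Longrightarrow> (E, F') \<in> R" and cG: "\<And>G'. G' \<in> \<G> \<Longrightarrow> \<exists>g\<in>{g}. (G', {g}) \<in> R"
      by (rule cover_relation_interpolate[OF cr E(2)]) metis
    obtain G' where G': "G' \<in> \<G>" "G' \<subseteq> T"
      using bowtie_subset[OF c(3,1) prime[OF E(1) cF]] by metis
    have "(G', {g}) \<in> R" using cG[OF G'(1)] by simp
    then have "(G', G) \<in> R"
      by (rule mono) (use g(2) G(1) Fpow_Fpow_mem[OF c(2) G'(1)] in auto)
    moreover have "G' \<in> Fpow T" using G' Fpow_Fpow_mem[OF c(2) G'(1)] by (auto simp: Fpow_def)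
    ultimately show "\<exists>F\<in>Fpow T. (F, G) \<in> R" by auto
  qed
  moreover have "T \<inter> C = {}"
  proof -
    have "c \<notin> T" if "c \<in> C" for c
    proof
      assume "c \<in> T"
      then obtain E where "E \<in> Fpow V" "(E, {c}) \<in> R" by (auto simp: T_def)
      moreover have "{c} \<in> Fpow C" using that by (simp add: Fpow_def)
      ultimately show False using Vno by simp
    qed
    then show ?thesis by auto
  qed
  moreover have "T \<inter> G \<noteq> {}" if "(H, G) \<in> R" for G
    by (rule prime[OF _ that]) (use H HV in \<open>auto simp: Fpow_def\<close>)
  ultimately show thesis by (rule that)
qed


section \<open>The space of tight sets\<close>

text \<open>
  As in Alexander's theorem for compactness, a maximal open cover of \<open>q\<close> without finite subcover of \<open>p\<close>
  is prime: whenever it has a member that includes a finite intersection of subbasic sets, it contains one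
  of these subbasic sets.  Hence its subbasic members already cover \<open>q\<close>.
\<close>

lemma Alexander_way_below:
  assumes sb: "subbasis X (U ` I)"
    and cov: "\<And>C. \<lbrakk>C \<subseteq> I; q \<subseteq> \<Union>(U ` C)\<rbrakk> \<Longrightarrow> \<exists>D\<in>Fpow C. p \<subseteq> \<Union>(U ` D)"
  shows "way_below X p q"
proof (rule ccontr)
  assume "\<not> way_below X p q"
  then obtain \<U> where U: "\<forall>U\<in>\<U>. openin X U" "q \<subseteq> \<Union>\<U>"
    and no: "\<And>\<V>. \<lbrakk>finite \<V>; \<V> \<subseteq> \<U>\<rbrakk> \<Longrightarrow> \<not> p \<subseteq> \<Union>\<V>"
    unfolding way_below_def by meson
  define \<A> where "\<A> = {\<M>. \<U> \<subseteq> \<M> \<and> (\<forall>U\<in>\<M>. openin X U) \<and> (\<forall>\<V>. finite \<V> \<longrightarrow> \<V> \<subseteq> \<M> \<longrightarrow> \<not> p \<subseteq> \<Union>\<V>)}"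
  have "\<exists>\<M>\<in>\<A>. \<forall>\<M>'\<in>\<A>. \<M> \<subseteq> \<M>' \<longrightarrow> \<M>' = \<M>"
  proof (rule subset_Zorn_nonempty)
    show "\<A> \<noteq> {}" using U(1) no by (auto simp: \<A>_def)
  next
    fix \<C> assume ne: "\<C> \<noteq> {}" and ch: "subset.chain \<A> \<C>"
    have CA: "\<C> \<subseteq> \<A>" using ch by (simp add: subset_chain_def)
    have "\<not> p \<subseteq> \<Union>\<V>" if V: "finite \<V>" "\<V> \<subseteq> \<Union>\<C>" for \<V>
    proof -
      obtain \<M> where M: "\<M> \<in> \<C>" "\<V> \<subseteq> \<M>" using finite_subset_Union_chain[OF V ne ch] by auto
      then have "\<M> \<in> \<A>" using CA by auto
      then show ?thesis using M(2) V(1) by (simp add: \<A>_def)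
    qed
    moreover have "\<U> \<subseteq> \<Union>\<C>"
    proof -
      obtain \<M> where M: "\<M> \<in> \<C>" using ne by auto
      then have "\<U> \<subseteq> \<M>" using subsetD[OF CA M] by (simp add: \<A>_def)
      then show ?thesis using M by auto
    qed
    moreover have "\<forall>U\<in>\<Union>\<C>. openin X U"
    proof
      fix U assume "U \<in> \<Union>\<C>"
      then obtain \<M> where M: "\<M> \<in> \<C>" "U \<in> \<M>" by auto
      then show "openin X U" using subsetD[OF CA M(1)] by (simp add: \<A>_def)
    qed
    ultimately show "\<Union>\<C> \<in> \<A>" by (simp add: \<A>_def)
  qed
  then obtain \<M> where MA: "\<M> \<in> \<A>" and max: "\<And>\<M>'. \<lbrakk>\<M>' \<in> \<A>; \<M> \<subseteq> \<M>'\<rbrakk> \<Longrightarrow> \<M>' = \<M>" by metis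
  have UM: "\<U> \<subseteq> \<M>" and Mo: "\<forall>U\<in>\<M>. openin X U"
    and Mno: "\<And>\<V>. \<lbrakk>finite \<V>; \<V> \<subseteq> \<M>\<rbrakk> \<Longrightarrow> \<not> p \<subseteq> \<Union>\<V>"
    using MA by (auto simp: \<A>_def)
  define C where "C = {i \<in> I. U i \<in> \<M>}"
  have "q \<subseteq> \<Union>(U ` C)"
  proof
    fix x assume "x \<in> q"
    then obtain W where W: "W \<in> \<M>" "x \<in> W" using U(2) UM by auto
    obtain F where F: "F \<in> Fpow I" "F \<noteq> {}" "x \<in> Inter_in X (U ` F)" "Inter_in X (U ` F) \<subseteq> W"
      using subbasis_nbhd[OF sb _ W(2)] Mo W(1) by metis
    have "\<exists>i\<in>F. U i \<in> \<M>"
    proof (rule ccontr)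
      assume nM: "\<not> ?thesis"
      have "\<exists>\<V>. finite \<V> \<and> \<V> \<subseteq> \<M> \<and> p \<subseteq> U i \<union> \<Union>\<V>" if i: "i \<in> F" for i
      proof -
        have "openin X (U i)" using subbasis_openin[OF sb] Fpow_subset[OF F(1)] i by auto
        moreover have "insert (U i) \<M> \<notin> \<A>" using max[of "insert (U i) \<M>"] nM i by auto
        ultimately obtain \<V> where V: "finite \<V>" "\<V> \<subseteq> insert (U i) \<M>" "p \<subseteq> \<Union>\<V>"
          using UM Mo by (auto simp: \<A>_def)
        then show ?thesis by (intro exI[of _ "\<V> - {U i}"]) auto
      qed
      then obtain v where v: "\<And>i. i \<in> F \<Longrightarrow> finite (v i) \<and> v i \<subseteq> \<M> \<and> p \<subseteq> U i \<union> \<Union>(v i)" by metis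
      let ?V = "insert W (\<Union>i\<in>F. v i)"
      have "finite ?V" "?V \<subseteq> \<M>" using v W(1) Fpow_finite[OF F(1)] by auto
      moreover have "p \<subseteq> \<Union>?V"
      proof
        fix y assume y: "y \<in> p"
        show "y \<in> \<Union>?V"
        proof (cases "\<forall>i\<in>F. y \<in> U i")
          case True
          obtain i where i: "i \<in> F" using F(2) by auto
          then have "openin X (U i)" using Fpow_subset[OF F(1)] by (intro subbasis_openin[OF sb]) auto
          then have "y \<in> topspace X" using openin_subset True i by auto
          then have "y \<in> W" using True F(4) by (auto simp: Inter_in_def)
          then show ?thesis by simp
        next
          case False
          then obtain i where "i \<in> F" "y \<notin> U i" by auto
          then show ?thesis using v[of i] y by auto
        qed
      qed
      ultimately show False using Mno by metis
    qed
    then obtain i where "i \<in> F" "U i \<in> \<M>" by auto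
    then show "x \<in> \<Union>(U ` C)" using F(1,3) by (auto simp: C_def Inter_in_def Fpow_def)
  qed
  then obtain D where D: "D \<in> Fpow C" "p \<subseteq> \<Union>(U ` D)" using cov[of C] by (auto simp: C_def)
  have "U ` D \<subseteq> \<M>" using Fpow_subset[OF D(1)] by (auto simp: C_def)
  then show False using Mno[of "U ` D"] D Fpow_finite[OF D(1)] by simp
qed

abbreviation Sp_top :: "'s cov \<Rightarrow> 's set topology" where
  "Sp_top A \<equiv> topology_generated_by (tight_at A ` fst A)"

lemma Sp_eq: "Sp A = (tight_at A ` fst A, Sp_top A)"
  by (simp add: Sp_def)

lemma topspace_Sp: "topspace (Sp_top A) = tight_sets A"
proof -
  obtain S R where A: "A = (S, R)" by (cases A)
  have "\<Union>(tight_at A ` S) = tight_sets A"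
    by (auto simp: tight_at_def tight_sets_def A)
  then show ?thesis by (simp add: A topology_generated_by_topspace)
qed

lemma subbasis_Sp: "subbasis (Sp_top A) (tight_at A ` fst A)"
  unfolding subbasis_def by (auto intro: topology_generated_by_Basis simp: topology_generated_by_topspace)

lemma mem_Inter_Sp:
  "T \<in> Inter_in (Sp_top A) (tight_at A ` F) \<longleftrightarrow> T \<in> tight_sets A \<and> F \<subseteq> T"
  unfolding mem_Inter_in topspace_Sp by (auto simp: tight_at_def)

lemma mem_UN_tight_at: "T \<in> \<Union>(tight_at A ` G) \<longleftrightarrow> T \<in> tight_sets A \<and> T \<inter> G \<noteq> {}"
  by (auto simp: tight_at_def)

lemma tight_setsD:
  assumes "T \<in> tight_sets (S, R)"
  shows "T \<subseteq> S" "T \<noteq> {}"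
    "\<And>F G. \<lbrakk>F \<in> Fpow T; (F, G) \<in> R; G \<in> Fpow S\<rbrakk> \<Longrightarrow> T \<inter> G \<noteq> {}"
    "\<And>p. p \<in> T \<Longrightarrow> \<exists>F\<in>Fpow T. (F, {p}) \<in> R"
proof -
  show 1: "T \<subseteq> S" "T \<noteq> {}" using assms by (auto simp: tight_sets_def)
  show "T \<inter> G \<noteq> {}" if "F \<in> Fpow T" "(F, G) \<in> R" "G \<in> Fpow S" for F G
    using assms that by (auto simp: tight_sets_def)
  show "\<exists>F\<in>Fpow T. (F, {p}) \<in> R" if "p \<in> T" for p
  proof -
    have "{p} \<in> Fpow S" "T \<inter> {p} \<noteq> {}" using that 1(1) by (auto simp: Fpow_def)
    then show ?thesis using assms by (simp add: tight_sets_def)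
  qed
qed

text \<open>
  A subbasic cover \<open>C\<close> of \<open>q\<close> such that \<open>H\<close> is related to no finite part of \<open>C\<close> would be refuted by
  the tight set of \<open>exists_tight_set\<close>, a point of \<open>q\<close> outside the cover.  The hypothesis \<open>bd\<close> makes that tight
  set non-empty.
\<close>

theorem way_below_Sp:
  assumes cr: "cover_relation S R" and H: "H \<in> Fpow S" and bd: "(H, G0) \<in> R"
    and q: "\<And>T. \<lbrakk>T \<in> tight_sets (S, R); \<And>G. (H, G) \<in> R \<Longrightarrow> T \<inter> G \<noteq> {}\<rbrakk> \<Longrightarrow> T \<in> q"
  shows "way_below (Sp_top (S, R)) (Inter_in (Sp_top (S, R)) (tight_at (S, R) ` H)) q"
proof (rule Alexander_way_below[where U = "tight_at (S, R)" and I = S])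
  show "subbasis (Sp_top (S, R)) (tight_at (S, R) ` S)" using subbasis_Sp[of "(S, R)"] by simp
next
  fix C assume C: "C \<subseteq> S" "q \<subseteq> \<Union>(tight_at (S, R) ` C)"
  have "\<exists>D\<in>Fpow C. (H, D) \<in> R"
  proof (rule ccontr)
    assume "\<not> ?thesis"
    then obtain T where T: "tight (S, R) T" "T \<inter> C = {}" "\<And>G. (H, G) \<in> R \<Longrightarrow> T \<inter> G \<noteq> {}"
      using exists_tight_set[OF cr H C(1)] by metis
    then have "T \<in> tight_sets (S, R)" using T(3)[OF bd] by (auto simp: tight_sets_def)
    then have "T \<in> \<Union>(tight_at (S, R) ` C)" using q T(3) C(2) by blast
    then show False using T(2) unfolding mem_UN_tight_at by simp
  qed
  then obtain D where D: "D \<in> Fpow C" "(H, D) \<in> R" by auto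
  have "T \<in> \<Union>(tight_at (S, R) ` D)" if "T \<in> Inter_in (Sp_top (S, R)) (tight_at (S, R) ` H)" for T
  proof -
    have T: "T \<in> tight_sets (S, R)" "H \<subseteq> T" using that unfolding mem_Inter_Sp by auto
    have "H \<in> Fpow T" "D \<in> Fpow S" using T(2) H D(1) C(1) by (auto simp: Fpow_def)
    then show ?thesis using tight_setsD(3)[OF T(1) _ D(2)] T(1) unfolding mem_UN_tight_at by simp
  qed
  then show "\<exists>D\<in>Fpow C. Inter_in (Sp_top (S, R)) (tight_at (S, R) ` H) \<subseteq> \<Union>(tight_at (S, R) ` D)"
    using D(1) by (meson subsetI)
qed

lemma way_below_Inter_Sp:
  assumes cr: "cover_relation S R" and H: "H \<in> Fpow S" and F: "F \<in> Fpow S" "F \<noteq> {}" "\<And>f. f \<in> F \<Longrightarrow> (H, {f}) \<in> R"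
  shows "way_below (Sp_top (S, R)) (Inter_in (Sp_top (S, R)) (tight_at (S, R) ` H))
    (Inter_in (Sp_top (S, R)) (tight_at (S, R) ` F))"
proof -
  obtain f where "f \<in> F" using F(2) by auto
  then have "(H, {f}) \<in> R" by (rule F(3))
  then show ?thesis
  proof (rule way_below_Sp[OF cr H])
    fix T assume T: "T \<in> tight_sets (S, R)" "\<And>G. (H, G) \<in> R \<Longrightarrow> T \<inter> G \<noteq> {}"
    have "f \<in> T" if "f \<in> F" for f using T(2)[OF F(3)[OF that]] by simp
    then show "T \<in> Inter_in (Sp_top (S, R)) (tight_at (S, R) ` F)"
      using T(1) unfolding mem_Inter_Sp by auto
  qed
qed

lemma tight_set_interpolate:
  assumes cr: "cover_relation S R" and T: "T \<in> tight_sets (S, R)" and F: "F \<in> Fpow T"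
  obtains H where "H \<in> Fpow T" "\<And>f. f \<in> F \<Longrightarrow> (H, {f}) \<in> R"
proof -
  have FT: "F \<subseteq> T" "finite F" "T \<subseteq> S" using F tight_setsD(1)[OF T] by (auto simp: Fpow_def)
  have "\<forall>f\<in>F. \<exists>E. E \<in> Fpow T \<and> (E, {f}) \<in> R" using tight_setsD(4)[OF T] FT(1) by (meson subsetD)
  then obtain e where e: "\<And>f. f \<in> F \<Longrightarrow> e f \<in> Fpow T \<and> (e f, {f}) \<in> R" by metis
  have E: "(\<Union>f\<in>F. e f) \<in> Fpow T" by (rule Fpow_UN[OF FT(2)]) (use e in simp)
  have "((\<Union>f\<in>F. e f), {f}) \<in> R" if f: "f \<in> F" for f
  proof (rule cover_relation_mono[OF cr])
    show "(e f, {f}) \<in> R" using e[OF f] by simp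
    show "{f} \<in> Fpow S" using f FT by (auto simp: Fpow_def)
    show "(\<Union>f\<in>F. e f) \<in> Fpow S" using E FT(3) by (auto simp: Fpow_def)
  qed (use f in auto)
  then show thesis by (rule that[OF E])
qed

lemma Sp_nbhd:
  assumes cr: "cover_relation S R" and W: "openin (Sp_top (S, R)) W" "T \<in> W"
  obtains H F where "H \<in> Fpow S" "H \<subseteq> T" "T \<in> tight_sets (S, R)" "F \<in> Fpow S" "F \<noteq> {}" "\<And>f. f \<in> F \<Longrightarrow> (H, {f}) \<in> R"
    "Inter_in (Sp_top (S, R)) (tight_at (S, R) ` F) \<subseteq> W"
proof -
  have sb: "subbasis (Sp_top (S, R)) (tight_at (S, R) ` S)" using subbasis_Sp[of "(S, R)"] by simp
  obtain F where F: "F \<in> Fpow S" "F \<noteq> {}" "T \<in> Inter_in (Sp_top (S, R)) (tight_at (S, R) ` F)"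
    "Inter_in (Sp_top (S, R)) (tight_at (S, R) ` F) \<subseteq> W"
    using subbasis_nbhd[OF sb W] by metis
  have T: "T \<in> tight_sets (S, R)" "F \<subseteq> T" using F(3) unfolding mem_Inter_Sp by auto
  then have "F \<in> Fpow T" using F(1) by (auto simp: Fpow_def)
  then obtain H where H: "H \<in> Fpow T" "\<And>f. f \<in> F \<Longrightarrow> (H, {f}) \<in> R"
    using tight_set_interpolate[OF cr T(1)] by metis
  have "H \<in> Fpow S" "H \<subseteq> T" using H(1) tight_setsD(1)[OF T(1)] by (auto simp: Fpow_def)
  then show thesis using that T(1) F H(2) by metis
qed

lemma core_compact_Sp:
  assumes cr: "cover_relation S R"
  shows "core_compact (Sp_top (S, R))"
  unfolding core_compact_def
proof (intro allI impI)
  fix W T assume "openin (Sp_top (S, R)) W \<and> T \<in> W"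
  then obtain H F where H: "H \<in> Fpow S" "H \<subseteq> T" "T \<in> tight_sets (S, R)" and F: "F \<in> Fpow S" "F \<noteq> {}"
    "\<And>f. f \<in> F \<Longrightarrow> (H, {f}) \<in> R"
    "Inter_in (Sp_top (S, R)) (tight_at (S, R) ` F) \<subseteq> W"
    using Sp_nbhd[OF cr] by metis
  let ?q = "Inter_in (Sp_top (S, R)) (tight_at (S, R) ` H)"
  have "openin (Sp_top (S, R)) ?q"
    by (rule openin_Inter_in)
      (use H(1) subbasis_openin[OF subbasis_Sp[of "(S, R)"]] in \<open>auto simp: Fpow_def\<close>)
  moreover have "T \<in> ?q" using H(2,3) unfolding mem_Inter_Sp by simp
  moreover have "way_below (Sp_top (S, R)) ?q W"
    by (rule way_below_mono[OF way_below_Inter_Sp[OF cr H(1) F(1,2,3)] subset_refl F(4)])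
  ultimately show "\<exists>q. openin (Sp_top (S, R)) q \<and> T \<in> q \<and> way_below (Sp_top (S, R)) q W" by metis
qed

text \<open>
  The point is that \<open>p\<close> is arbitrary.  It is first covered by finitely many basic sets \<open>H\<close> and \<open>K\<close>
  witnessing \<open>p\<close> way below \<open>q\<close> and \<open>r\<close>; for basic sets, the elements covered by \<open>H \<union> K\<close> include
  those covered by \<open>H\<close> and by \<open>K\<close>, which is coherence at the level of the relation.
\<close>

lemma core_coherent_Sp:
  assumes cr: "cover_relation S R"
  shows "core_coherent (Sp_top (S, R))"
  unfolding core_coherent_def
proof (intro allI impI, elim conjE)
  fix p q r assume op: "openin (Sp_top (S, R)) q" "openin (Sp_top (S, R)) r"
    and wb: "way_below (Sp_top (S, R)) p q" "way_below (Sp_top (S, R)) p r"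
  let ?X = "Sp_top (S, R)" and ?b = "\<lambda>H. Inter_in (Sp_top (S, R)) (tight_at (S, R) ` H)"
  let ?N = "\<lambda>W. {H \<in> Fpow S. \<exists>F\<in>Fpow S. F \<noteq> {} \<and> (\<forall>f\<in>F. (H, {f}) \<in> R) \<and> ?b F \<subseteq> W}"
  have oH: "openin ?X (?b H)" if "H \<in> Fpow S" for H
    by (rule openin_Inter_in)
      (use that subbasis_openin[OF subbasis_Sp[of "(S, R)"]] in \<open>auto simp: Fpow_def\<close>)
  have fin: "\<exists>\<H>\<subseteq>?N W. finite \<H> \<and> p \<subseteq> \<Union>(?b ` \<H>)" if W: "openin ?X W" "way_below ?X p W" for W
  proof -
    have "W \<subseteq> \<Union>(?b ` ?N W)"
    proof
      fix T assume "T \<in> W"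
      then obtain H F where H: "H \<in> Fpow S" "H \<subseteq> T" "T \<in> tight_sets (S, R)" and F: "F \<in> Fpow S" "F \<noteq> {}"
        "\<And>f. f \<in> F \<Longrightarrow> (H, {f}) \<in> R" "?b F \<subseteq> W"
        using Sp_nbhd[OF cr W(1)] by metis
      have "H \<in> ?N W" using H(1) F by auto
      moreover have "T \<in> ?b H" using H(2,3) unfolding mem_Inter_Sp by simp
      ultimately show "T \<in> \<Union>(?b ` ?N W)" by (rule UN_I)
    qed
    then obtain \<V> where V: "finite \<V>" "\<V> \<subseteq> ?b ` ?N W" "p \<subseteq> \<Union>\<V>"
      by (rule way_belowD[OF W(2), rotated]) (use oH in auto)
    obtain \<H> where "\<H> \<subseteq> ?N W" "finite \<H>" "\<V> = ?b ` \<H>"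
      using finite_subset_image[OF V(1,2)] by (elim exE conjE)
    then show ?thesis using V(3) by (intro exI[of _ \<H>]) simp
  qed
  obtain \<H> where HH: "\<H> \<subseteq> ?N q" "finite \<H>" "p \<subseteq> \<Union>(?b ` \<H>)" using fin[OF op(1) wb(1)] by (elim exE conjE)
  obtain \<K> where KK: "\<K> \<subseteq> ?N r" "finite \<K>" "p \<subseteq> \<Union>(?b ` \<K>)" using fin[OF op(2) wb(2)] by (elim exE conjE)
  have "way_below ?X (\<Union>((\<lambda>(H, K). ?b (H \<union> K)) ` (\<H> \<times> \<K>))) (q \<inter> r)"
  proof (rule way_below_Union)
    show "finite ((\<lambda>(H, K). ?b (H \<union> K)) ` (\<H> \<times> \<K>))" using HH(2) KK(2) by simp
  next
    fix w assume "w \<in> (\<lambda>(H, K). ?b (H \<union> K)) ` (\<H> \<times> \<K>)"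
    then obtain H K where w: "H \<in> \<H>" "K \<in> \<K>" "w = ?b (H \<union> K)" by auto
    obtain F where F: "H \<in> Fpow S" "F \<in> Fpow S" "F \<noteq> {}" "\<forall>f\<in>F. (H, {f}) \<in> R" "?b F \<subseteq> q"
      using subsetD[OF HH(1) w(1)] by auto
    obtain E where E: "K \<in> Fpow S" "E \<in> Fpow S" "\<forall>f\<in>E. (K, {f}) \<in> R" "?b E \<subseteq> r"
      using subsetD[OF KK(1) w(2)] by auto
    have HK: "H \<union> K \<in> Fpow S" and FE: "F \<union> E \<in> Fpow S" using F(1,2) E(1,2) by (auto simp: Fpow_def)
    have "(H \<union> K, {f}) \<in> R" if f: "f \<in> F \<union> E" for f
    proof -
      have fS: "{f} \<in> Fpow S" using f FE by (auto simp: Fpow_def)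
      from f show ?thesis
      proof
        assume "f \<in> F" then show ?thesis
          by (intro cover_relation_mono[OF cr _ _ subset_refl HK fS, of H]) (use F(4) in auto)
      next
        assume "f \<in> E" then show ?thesis
          by (intro cover_relation_mono[OF cr _ _ subset_refl HK fS, of K]) (use E(3) in auto)
      qed
    qed
    then have "way_below ?X w (?b (F \<union> E))"
      unfolding w(3) using F(3) by (intro way_below_Inter_Sp[OF cr HK FE]) auto
    moreover have "?b (F \<union> E) \<subseteq> q \<inter> r" using F(5) E(4) unfolding Inter_in_Un by auto
    ultimately show "way_below ?X w (q \<inter> r)" by (rule way_below_mono[OF _ subset_refl])
  qed
  moreover have "p \<subseteq> \<Union>((\<lambda>(H, K). ?b (H \<union> K)) ` (\<H> \<times> \<K>))"
  proof
    fix x assume x: "x \<in> p"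
    obtain H K where "H \<in> \<H>" "x \<in> ?b H" "K \<in> \<K>" "x \<in> ?b K"
      using subsetD[OF HH(3) x] subsetD[OF KK(3) x] by auto
    then have "(H, K) \<in> \<H> \<times> \<K>" "x \<in> (\<lambda>(H, K). ?b (H \<union> K)) (H, K)" unfolding prod.case Inter_in_Un by auto
    then show "x \<in> \<Union>((\<lambda>(H, K). ?b (H \<union> K)) ` (\<H> \<times> \<K>))" by (rule UN_I)
  qed
  ultimately show "way_below ?X p (q \<inter> r)" by (rule way_below_mono[OF _ _ subset_refl])
qed



section \<open>Sobriety\<close>

lemma irreducible_closed_Int:
  assumes irr: "irreducible_closed X C" and UV: "openin X U" "openin X V" "U \<inter> C \<noteq> {}" "V \<inter> C \<noteq> {}"
  shows "U \<inter> V \<inter> C \<noteq> {}"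
proof
  assume e: "U \<inter> V \<inter> C = {}"
  have C: "closedin X C" using irr by (simp add: irreducible_closed_def)
  have "closedin X (C - U)" "closedin X (C - V)" using C UV by (auto intro: closedin_diff)
  moreover have "C = (C - U) \<union> (C - V)" using e by auto
  ultimately have "C = C - U \<or> C = C - V" using irr unfolding irreducible_closed_def by meson
  then show False using UV(3,4) by auto
qed

lemma irreducible_closed_Inter:
  assumes irr: "irreducible_closed X C" and F: "finite F"
    and U: "\<And>i. i \<in> F \<Longrightarrow> openin X (U i)" "\<And>i. i \<in> F \<Longrightarrow> U i \<inter> C \<noteq> {}"
  shows "Inter_in X (U ` F) \<inter> C \<noteq> {}"
  using F U
proof (induction rule: finite_induct)
  case empty
  have "C \<noteq> {}" "C \<subseteq> topspace X"
    using irr closedin_subset by (auto simp: irreducible_closed_def)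
  then show ?case by (auto simp: Inter_in_def)
next
  case (insert i F)
  have "openin X (Inter_in X (U ` F))" using insert by (intro openin_Inter_in) auto
  then have "U i \<inter> Inter_in X (U ` F) \<inter> C \<noteq> {}"
    using insert by (intro irreducible_closed_Int[OF irr]) auto
  moreover have "U i \<inter> Inter_in X (U ` F) = Inter_in X (U ` insert i F)"
    by (auto simp: Inter_in_def)
  ultimately show ?case by simp
qed

lemma irreducible_closedI:
  assumes C: "closedin X C" "C \<noteq> {}"
    and meet: "\<And>U V. \<lbrakk>openin X U; openin X V; U \<inter> C \<noteq> {}; V \<inter> C \<noteq> {}\<rbrakk> \<Longrightarrow> U \<inter> V \<inter> C \<noteq> {}"
  shows "irreducible_closed X C"
  unfolding irreducible_closed_def
proof (intro conjI allI impI C)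
  fix D E assume h: "closedin X D \<and> closedin X E \<and> C = D \<union> E"
  show "C = D \<or> C = E"
  proof (rule ccontr)
    assume n: "\<not> ?thesis"
    have Ct: "C \<subseteq> topspace X" using C(1) by (rule closedin_subset)
    have "(topspace X - D) \<inter> C \<noteq> {}" "(topspace X - E) \<inter> C \<noteq> {}" using n h Ct by auto
    then have "(topspace X - D) \<inter> (topspace X - E) \<inter> C \<noteq> {}" using h by (intro meet) auto
    then show False using h by auto
  qed
qed

lemma irreducible_closed_point:
  assumes "x \<in> topspace X"
  shows "irreducible_closed X (X closure_of {x})"
proof (rule irreducible_closedI)
  have x: "x \<in> X closure_of {x}" using assms by (simp add: in_closure_of)
  then show "X closure_of {x} \<noteq> {}" by auto
  fix U V assume h: "openin X U" "openin X V" "U \<inter> X closure_of {x} \<noteq> {}" "V \<inter> X closure_of {x} \<noteq> {}"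
  have "x \<in> U" "x \<in> V" using h by (auto simp: in_closure_of)
  then show "U \<inter> V \<inter> X closure_of {x} \<noteq> {}" using x by auto
qed simp

lemma subbasis_closure_of_point:
  assumes sb: "subbasis X (U ` I)" and xy: "x \<in> topspace X" "\<And>i. \<lbrakk>i \<in> I; y \<in> U i\<rbrakk> \<Longrightarrow> x \<in> U i"
    and y: "y \<in> topspace X"
  shows "y \<in> X closure_of {x}"
  unfolding in_closure_of
proof (intro conjI allI impI y, elim conjE)
  fix W assume W: "y \<in> W" "openin X W"
  obtain F where F: "F \<in> Fpow I" "y \<in> Inter_in X (U ` F)" "Inter_in X (U ` F) \<subseteq> W"
    using subbasis_nbhd[OF sb W(2,1)] by metis
  have "x \<in> Inter_in X (U ` F)"
    using F(2) xy Fpow_subset[OF F(1)] by (auto simp: mem_Inter_in)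
  then show "\<exists>z. z \<in> {x} \<and> z \<in> W" using F(3) by auto
qed

lemma SSub_T0:
  assumes X: "(U ` I, X) \<in> SSub" and xy: "x \<in> topspace X" "y \<in> topspace X"
    "\<And>i. i \<in> I \<Longrightarrow> x \<in> U i \<longleftrightarrow> y \<in> U i"
  shows "x = y"
proof -
  have sb: "subbasis X (U ` I)" and sob: "sober_space X" using X by (auto simp: SSub_iff)
  have "y \<in> X closure_of {x}" "x \<in> X closure_of {y}"
    using xy by (auto intro!: subbasis_closure_of_point[OF sb])
  then have "X closure_of {x} = X closure_of {y}"
    by (intro equalityI closure_of_minimal) auto
  then show ?thesis
    using sob irreducible_closed_point[OF xy(1)] xy unfolding sober_space_def by (metis (no_types))
qed

text \<open>
  The generic point of an irreducible closed set is its union: by irreducibility each finite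
  subset of the union is contained in a member, so tightness passes from the members to the union.
\<close>

lemma sober_space_Sp:
  assumes cr: "cover_relation S R"
  shows "sober_space (Sp_top (S, R))"
  unfolding sober_space_def
proof (intro allI impI)
  let ?X = "Sp_top (S, R)"
  have sb: "subbasis ?X (tight_at (S, R) ` S)" using subbasis_Sp[of "(S, R)"] by simp
  fix C assume irr: "irreducible_closed ?X C"
  have Cc: "closedin ?X C" "C \<noteq> {}" using irr by (auto simp: irreducible_closed_def)
  have Ct: "C \<subseteq> tight_sets (S, R)" using closedin_subset[OF Cc(1)] by (simp only: topspace_Sp)
  define T where "T = \<Union>C"
  have meet: "\<exists>T'\<in>C. F \<subseteq> T'" if F: "F \<in> Fpow T" for F
  proof -
    have "Inter_in ?X (tight_at (S, R) ` F) \<inter> C \<noteq> {}"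
    proof (rule irreducible_closed_Inter[OF irr Fpow_finite[OF F]])
      fix p assume "p \<in> F"
      then obtain T' where T': "T' \<in> C" "p \<in> T'" using Fpow_subset[OF F] by (auto simp: T_def)
      then have "T' \<in> tight_sets (S, R)" using Ct by auto
      moreover from this have "p \<in> S" using tight_setsD(1) T'(2) by blast
      ultimately show "openin ?X (tight_at (S, R) p)" "tight_at (S, R) p \<inter> C \<noteq> {}"
        using subbasis_openin[OF sb] T' by (auto simp: tight_at_def)
    qed
    then obtain T' where "T' \<in> Inter_in ?X (tight_at (S, R) ` F)" "T' \<in> C" by auto
    then show ?thesis unfolding mem_Inter_Sp by auto
  qed
  have TS: "T \<subseteq> S"
    unfolding T_def by (rule Union_least) (rule tight_setsD(1)[OF subsetD[OF Ct]])
  have "tight (S, R) T"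
    unfolding tight.simps
  proof (intro conjI ballI iffI TS)
    fix G assume G: "G \<in> Fpow S" "\<exists>F\<in>Fpow T. (F, G) \<in> R"
    then obtain F where F: "F \<in> Fpow T" "(F, G) \<in> R" by auto
    obtain T' where T': "T' \<in> C" "F \<subseteq> T'" using meet[OF F(1)] by auto
    have "F \<in> Fpow T'" using T'(2) Fpow_finite[OF F(1)] by (simp add: Fpow_def)
    then have "T' \<inter> G \<noteq> {}" using tight_setsD(3)[OF _ _ F(2) G(1)] Ct T'(1) by auto
    then show "T \<inter> G \<noteq> {}" using T'(1) by (auto simp: T_def)
  next
    fix G assume G: "G \<in> Fpow S" "T \<inter> G \<noteq> {}"
    then obtain g T' where g: "g \<in> G" "g \<in> T'" "T' \<in> C" by (auto simp: T_def)
    have T': "T' \<in> tight_sets (S, R)" using Ct g(3) by auto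
    obtain F where F: "F \<in> Fpow T'" "(F, {g}) \<in> R" using tight_setsD(4)[OF T' g(2)] by auto
    have "F \<in> Fpow S" using F(1) tight_setsD(1)[OF T'] by (auto simp: Fpow_def)
    then have "(F, G) \<in> R" using cover_relation_mono[OF cr F(2) subset_refl] g(1) G(1) by simp
    moreover have "F \<in> Fpow T" using F(1) g(3) by (auto simp: Fpow_def T_def)
    ultimately show "\<exists>F\<in>Fpow T. (F, G) \<in> R" by auto
  qed
  moreover have "T \<noteq> {}"
  proof -
    obtain T' where "T' \<in> C" using Cc(2) by auto
    then show ?thesis using tight_setsD(2)[of T' S R] Ct by (auto simp: T_def)
  qed
  ultimately have Tt: "T \<in> tight_sets (S, R)" by (simp add: tight_sets_def)
  have TC: "T \<in> C"
  proof (rule ccontr)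
    assume "T \<notin> C"
    then have "openin ?X (topspace ?X - C)" "T \<in> topspace ?X - C"
      using Cc(1) Tt unfolding topspace_Sp closedin_def by auto
    then obtain F where F: "F \<in> Fpow S" "T \<in> Inter_in ?X (tight_at (S, R) ` F)"
      "Inter_in ?X (tight_at (S, R) ` F) \<subseteq> topspace ?X - C"
      using subbasis_nbhd[OF sb] by metis
    have "F \<subseteq> T" using F(2) unfolding mem_Inter_Sp by simp
    then have "F \<in> Fpow T" using F(1) by (simp add: Fpow_def)
    then obtain T' where "T' \<in> C" "F \<subseteq> T'" using meet by auto
    moreover from this have "T' \<in> Inter_in ?X (tight_at (S, R) ` F)"
      unfolding mem_Inter_Sp using Ct by auto
    ultimately show False using F(3) by auto
  qed
  have cl: "C = ?X closure_of {T}"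
  proof
    show "?X closure_of {T} \<subseteq> C" by (rule closure_of_minimal[OF _ Cc(1)]) (use TC in simp)
    show "C \<subseteq> ?X closure_of {T}"
    proof
      fix T' assume T': "T' \<in> C"
      show "T' \<in> ?X closure_of {T}"
        by (rule subbasis_closure_of_point[OF sb])
          (use Tt T' Ct in \<open>auto simp only: topspace_Sp, auto simp: tight_at_def T_def\<close>)
    qed
  qed
  show "\<exists>!x. x \<in> topspace ?X \<and> C = ?X closure_of {x}"
  proof (rule ex1I)
    show "T \<in> topspace ?X \<and> C = ?X closure_of {T}" using Tt cl unfolding topspace_Sp by simp
  next
    fix T' assume T': "T' \<in> topspace ?X \<and> C = ?X closure_of {T'}"
    then have T't: "T' \<in> tight_sets (S, R)" unfolding topspace_Sp by simp
    have "T' \<in> C" using T' by (simp add: in_closure_of)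
    moreover have "T \<subseteq> T'"
    proof
      fix p assume p: "p \<in> T"
      then have "openin ?X (tight_at (S, R) p)" using subbasis_openin[OF sb] TS by auto
      moreover have "T \<in> tight_at (S, R) p" using p Tt by (simp add: tight_at_def)
      moreover have "T \<in> ?X closure_of {T'}" using TC T' by simp
      ultimately have "T' \<in> tight_at (S, R) p" unfolding in_closure_of by auto
      then show "p \<in> T'" by (simp add: tight_at_def)
    qed
    ultimately show "T' = T" by (auto simp: T_def)
  qed
qed

theorem Sp_SSub:
  assumes "A \<in> Cov"
  shows "(tight_at A ` fst A, Sp_top A) \<in> SSub"
proof -
  obtain S R where A: "A = (S, R)" by (cases A)
  then have cr: "cover_relation S R" using assms by (simp add: Cov_def)
  show ?thesis
    unfolding SSub_iff
    using core_compact_Sp[OF cr] core_coherent_Sp[OF cr] sober_space_Sp[OF cr] subbasis_Sp[of A]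
    by (simp add: A)
qed


section \<open>Cover relations are spatial\<close>

text \<open>
  Containment of the open sets yields only \<open>Vdash\<close>: a set \<open>K\<close> covering each element of \<open>F\<close> but not
  \<open>G\<close> would produce a tight set that contains \<open>F\<close> and avoids \<open>G\<close>.
\<close>

lemma Vdash_Sp:
  assumes cr: "cover_relation S R" and FG: "F \<in> Fpow S" "G \<in> Fpow S"
    and sub: "Inter_in (Sp_top (S, R)) (tight_at (S, R) ` F) \<subseteq> \<Union>(tight_at (S, R) ` G)"
  shows "(F, G) \<in> Vdash S R"
proof -
  have "(K, G) \<in> R" if K: "K \<in> bounded_sets S R" "\<forall>f\<in>F. (K, {f}) \<in> R" for K
  proof (rule ccontr)
    assume no: "(K, G) \<notin> R"
    obtain G0 where KS: "K \<in> Fpow S" "(K, G0) \<in> R" using K(1) by (auto simp: bounded_sets_def)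
    have "(K, D) \<notin> R" if "D \<in> Fpow G" for D
      using cover_relation_mono[OF cr _ subset_refl Fpow_subset[OF that] KS(1) FG(2)] no by auto
    then obtain T where T: "tight (S, R) T" "T \<inter> G = {}" "\<And>G. (K, G) \<in> R \<Longrightarrow> T \<inter> G \<noteq> {}"
      using exists_tight_set[OF cr KS(1) Fpow_subset[OF FG(2)]] by metis
    have "T \<in> tight_sets (S, R)" using T(1) T(3)[OF KS(2)] by (auto simp: tight_sets_def)
    moreover have "f \<in> T" if "f \<in> F" for f using T(3)[of "{f}"] K(2) that by simp
    ultimately have "T \<in> Inter_in (Sp_top (S, R)) (tight_at (S, R) ` F)"
      unfolding mem_Inter_Sp by auto
    then have "T \<in> \<Union>(tight_at (S, R) ` G)" using sub by auto
    then show False using T(2) unfolding mem_UN_tight_at by simp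
  qed
  then show ?thesis using FG by (simp add: Vdash_def)
qed

text \<open>
  Cutting on all elements of \<open>\<Union>\<F>\<close>: the claim is proved for all finite \<open>V \<supseteq> F\<close>, by induction on the
  number of elements of \<open>\<Union>\<F>\<close> outside \<open>V\<close>.  A set \<open>V\<close> meeting every member of \<open>\<F>\<close> includes a
  member of \<open>\<G>\<close>; otherwise it misses some \<open>F' \<in> \<F>\<close>, on which the axiom of cover relations permits a cut.
\<close>

lemma cover_relation_bowtie:
  assumes cr: "cover_relation S R" and FG: "F \<in> Fpow S" "G \<in> Fpow S"
    and c: "\<F> \<in> Fpow (Fpow S)" "bowtie S \<F> \<G>"
    and F: "\<And>F'. F' \<in> \<F> \<Longrightarrow> (F, F') \<in> Vdash S R" and G: "\<And>G'. G' \<in> \<G> \<Longrightarrow> (G', G) \<in> R"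
  shows "(F, G) \<in> R"
proof -
  have fin: "finite (\<Union>\<F>)" using c(1) by (auto simp: Fpow_def)
  have "(V, G) \<in> R" if "F \<subseteq> V" "V \<in> Fpow S" for V
    using that
  proof (induction "card (\<Union>\<F> - V)" arbitrary: V rule: less_induct)
    case less
    show ?case
    proof (cases "\<forall>F'\<in>\<F>. V \<inter> F' \<noteq> {}")
      case True
      then obtain G' where "G' \<in> \<G>" "G' \<subseteq> V" using bowtie_subset[OF c(2,1)] by metis
      then show ?thesis using cover_relation_mono[OF cr G _ subset_refl less.prems(2) FG(2)] by simp
    next
      case False
      then obtain F' where F': "F' \<in> \<F>" "V \<inter> F' = {}" by auto
      have F'S: "F' \<in> Fpow S" by (rule Fpow_Fpow_mem[OF c(1) F'(1)])
      have "(V, F') \<in> Vdash S R"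
        using F[OF F'(1)] less.prems F'S by (auto simp: Vdash_def)
      moreover have "({h} \<union> V, G) \<in> R" if h: "h \<in> F'" for h
      proof (rule less.hyps)
        have "\<Union>\<F> - ({h} \<union> V) \<subset> \<Union>\<F> - V" using h F' by auto
        then show "card (\<Union>\<F> - ({h} \<union> V)) < card (\<Union>\<F> - V)"
          using fin by (intro psubset_card_mono) auto
        show "F \<subseteq> {h} \<union> V" using less.prems(1) by auto
        show "{h} \<union> V \<in> Fpow S" using less.prems(2) F'S h by (auto simp: Fpow_def)
      qed
      ultimately show ?thesis
        using cr less.prems(2) FG(2) F'S unfolding cover_relation_def by meson
    qed
  qed
  then show ?thesis using FG(1) by simp
qed

text \<open>
  Related sets are way below each other by \<open>way_below_Sp\<close>.  Conversely, interpolating \<open>\<Inter>F\<close> way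
  below \<open>\<Union>G\<close> by sets covering single elements of \<open>G\<close> recovers the relation up to \<open>Vdash\<close>, and \<open>cover_relation_bowtie\<close> removes the difference.
\<close>

theorem cover_relation_spatial:
  assumes cr: "cover_relation S R"
  shows "induced_rel (Sp_top (S, R)) S (tight_at (S, R)) S (tight_at (S, R)) (id_on_space (Sp_top (S, R))) = R"
    (is "?i = R")
proof (intro equalityI subrelI)
  let ?X = "Sp_top (S, R)" and ?t = "tight_at (S, R)"
  have sb: "subbasis ?X (?t ` S)" using subbasis_Sp[of "(S, R)"] by simp
  note iff = induced_rel_id_iff[OF sb]
  {
    fix F G assume FG: "(F, G) \<in> R"
    then have S: "F \<in> Fpow S" "G \<in> Fpow S" using cover_relation_subset[OF cr] by auto
    have "way_below ?X (Inter_in ?X (?t ` F)) (\<Union>(?t ` G))"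
    proof (rule way_below_Sp[OF cr S(1) FG])
      fix T assume "T \<in> tight_sets (S, R)" "\<And>G. (F, G) \<in> R \<Longrightarrow> T \<inter> G \<noteq> {}"
      then show "T \<in> \<Union>(?t ` G)" using FG unfolding mem_UN_tight_at by simp
    qed
    then show "(F, G) \<in> ?i" using S unfolding iff by simp
  next
    fix F G assume "(F, G) \<in> ?i"
    then have FG: "F \<in> Fpow S" "G \<in> Fpow S" and wb: "way_below ?X (Inter_in ?X (?t ` F)) (\<Union>(?t ` G))"
      unfolding iff by auto
    let ?H = "{H \<in> Fpow S. H \<noteq> {} \<and> (\<exists>g\<in>G. (H, {g}) \<in> R)}"
    have id: "id_on_space ?X \<in> SSub_hom (?t ` S, ?X) (?t ` S, ?X)" by (rule SSub_hom_id)
    have op: "\<And>p. p \<in> S \<Longrightarrow> openin ?X (?t p)" using subbasis_openin[OF sb] by simp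
    have H: "?H \<subseteq> Fpow S" "{} \<notin> ?H" by auto
    have vid: "partial_vimage (id_on_space ?X) (Inter_in ?X V) = Inter_in ?X V" for V
      by (rule partial_vimage_id[OF Inter_in_subset])
    have cov: "\<Union>(?t ` G) \<subseteq> (\<Union>H\<in>?H. partial_vimage (id_on_space ?X) (Inter_in ?X (?t ` H)))"
    proof
      fix T assume "T \<in> \<Union>(?t ` G)"
      then obtain g where T: "T \<in> tight_sets (S, R)" "g \<in> T" "g \<in> G" unfolding mem_UN_tight_at by auto
      obtain E where E: "E \<in> Fpow T" "(E, {g}) \<in> R" using tight_setsD(4)[OF T(1,2)] by auto
      have gS: "{g} \<in> Fpow S" and ES: "insert g E \<in> Fpow S"
        using E(1) T(2) tight_setsD(1)[OF T(1)] by (auto simp: Fpow_def)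
      have "(insert g E, {g}) \<in> R" by (rule cover_relation_mono[OF cr E(2) _ subset_refl ES gS]) auto
      then have "insert g E \<in> ?H" using ES T(3) by auto
      moreover have "T \<in> partial_vimage (id_on_space ?X) (Inter_in ?X (?t ` insert g E))"
        unfolding vid mem_Inter_Sp using T(1,2) E(1) by (auto simp: Fpow_def)
      ultimately show "T \<in> (\<Union>H\<in>?H. partial_vimage (id_on_space ?X) (Inter_in ?X (?t ` H)))"
        by (rule UN_I)
    qed
    obtain \<F> \<G> where c: "\<F> \<in> Fpow (Fpow S)" "\<G> \<in> Fpow (Fpow S)" "\<F> \<noteq> {}" "\<G> \<subseteq> ?H" "bowtie S \<F> \<G>"
      and cF: "\<And>F'. F' \<in> \<F> \<Longrightarrow> way_below ?X (Inter_in ?X (?t ` F)) (partial_vimage (id_on_space ?X) (\<Union>(?t ` F')))"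
      by (rule cut_of_way_below[OF core_compact_Sp[OF cr] id op wb H cov]) auto
    show "(F, G) \<in> R"
    proof (rule cover_relation_bowtie[OF cr FG c(1,5)])
      fix F' assume F': "F' \<in> \<F>"
      have F'S: "F' \<in> Fpow S" by (rule Fpow_Fpow_mem[OF c(1) F'])
      have o: "openin ?X (\<Union>(?t ` F'))" by (rule openin_UN_subbasis[OF sb F'S])
      have "way_below ?X (Inter_in ?X (?t ` F)) (\<Union>(?t ` F'))"
        using cF[OF F'] partial_vimage_id[OF openin_subset[OF o]] by simp
      then show "(F, F') \<in> Vdash S R" by (intro Vdash_Sp[OF cr FG(1) F'S] way_below_subset[OF _ o])
    next
      fix G' assume "G' \<in> \<G>"
      then have "G' \<in> ?H" using c(4) by (rule subsetD[rotated])
      then obtain g where g: "G' \<in> Fpow S" "g \<in> G" "(G', {g}) \<in> R" by auto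
      then show "(G', G) \<in> R" using cover_relation_mono[OF cr g(3) subset_refl _ g(1) FG(2)] by simp
    qed
  }
qed

lemma induced_cov_Sp:
  assumes "A \<in> Cov"
  shows "induced_cov (Sp_top A) (fst A) (tight_at A) = A"
proof -
  obtain S R where "A = (S, R)" by (cases A)
  then show ?thesis using assms cover_relation_spatial[of S R] by (simp add: induced_cov_def Cov_def)
qed


section \<open>Morphisms of cover relations are spatial\<close>

lemma Cov_homD:
  assumes "A \<in> Cov_hom (R, V) (S, W)"
  shows "cut_comp_ne (Fpow S) R (Fpow R) A V = A"
    "cut_comp_ne (Fpow S) S (Fpow R) W (one_ex R A) = A"
  using assms by auto

lemma Cov_hom_mono_left:
  assumes f: "f \<in> Cov_hom (R, V) (S, W)" and W: "cover_relation S W"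
    and FG: "(F, G) \<in> f" "F \<subseteq> F'" "F' \<in> Fpow S"
  shows "(F', G) \<in> f"
proof -
  have "(F, G) \<in> cut_comp_ne (Fpow S) S (Fpow R) W (one_ex R f)"
    using FG(1) Cov_homD(2)[OF f] by simp
  then obtain \<F> \<G> where c: "G \<in> Fpow R" "\<F> \<in> Fpow (Fpow S)" "\<G> \<in> Fpow (Fpow S)" "\<F> \<noteq> {}"
    "bowtie S \<F> \<G>" and F: "\<And>E. E \<in> \<F> \<Longrightarrow> (F, E) \<in> W" and G: "\<And>E. E \<in> \<G> \<Longrightarrow> (E, G) \<in> one_ex R f"
    by (rule cut_comp_neE) metis
  have "(F', E) \<in> W" if "E \<in> \<F>" for E
    using cover_relation_mono[OF W F[OF that] FG(2) subset_refl FG(3)] Fpow_Fpow_mem[OF c(2) that] by simp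
  then have "(F', G) \<in> cut_comp_ne (Fpow S) S (Fpow R) W (one_ex R f)"
    by (rule cut_comp_neI[OF FG(3) c _ G])
  then show ?thesis using Cov_homD(2)[OF f] by simp
qed

text \<open>
  A tight set meets every set covered by a finite part of it, so it includes one of the finite sets
  through which the second equation of a morphism factors \<open>(F, G) \<in> f\<close>.
\<close>

lemma Sp_image_meets:
  assumes f: "f \<in> Cov_hom (R, V) (S, W)" and T: "T \<in> tight_sets (S, W)"
    and F: "F \<in> Fpow T" "(F, G) \<in> f"
  shows "Sp_image (R, V) f T \<inter> G \<noteq> {}"
proof -
  have "(F, G) \<in> cut_comp_ne (Fpow S) S (Fpow R) W (one_ex R f)"
    using F(2) Cov_homD(2)[OF f] by simp
  then obtain \<F> \<G> where c: "G \<in> Fpow R" "\<F> \<in> Fpow (Fpow S)" "\<G> \<in> Fpow (Fpow S)"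
    "bowtie S \<F> \<G>" and cF: "\<And>E. E \<in> \<F> \<Longrightarrow> (F, E) \<in> W" and cG: "\<And>E. E \<in> \<G> \<Longrightarrow> (E, G) \<in> one_ex R f"
    by (rule cut_comp_neE) metis
  have "T \<inter> E \<noteq> {}" if "E \<in> \<F>" for E
    by (rule tight_setsD(3)[OF T F(1) cF[OF that] Fpow_Fpow_mem[OF c(2) that]])
  then obtain E where E: "E \<in> \<G>" "E \<subseteq> T" using bowtie_subset[OF c(4,2)] by metis
  obtain g where g: "g \<in> G" "(E, {g}) \<in> f" using cG[OF E(1)] by (auto simp: one_ex_def)
  have "E \<in> Fpow T" using E(2) Fpow_finite[OF Fpow_Fpow_mem[OF c(3) E(1)]] by (simp add: Fpow_def)
  then have "g \<in> Sp_image (R, V) f T"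
    using g Fpow_subset[OF c(1)] by (auto simp: Sp_image_def)
  then show ?thesis using g(1) by auto
qed

text \<open>
  Suppose that a finite set \<open>E\<close> of elements of the image is related to \<open>G\<close> by \<open>V\<close>.  Collecting witnesses
  gives a finite part of \<open>T\<close> that \<open>f\<close> relates to each \<open>{e}\<close>, hence, by the equation for composition with
  \<open>V\<close>, to \<open>G\<close>, and then the image meets \<open>G\<close> by \<open>Sp_image_meets\<close>.  The same equation, read as a
  factorization of \<open>(F, {g}) \<in> f\<close>, yields a finite part of the image related to \<open>{g}\<close>.
\<close>

lemma Sp_image_tight:
  assumes f: "f \<in> Cov_hom (R, V) (S, W)" and RV: "cover_relation R V" and SW: "cover_relation S W"
    and T: "T \<in> tight_sets (S, W)" and ne: "Sp_image (R, V) f T \<noteq> {}"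
  shows "Sp_image (R, V) f T \<in> tight_sets (R, V)"
proof -
  let ?T = "Sp_image (R, V) f T"
  have TS: "T \<subseteq> S" by (rule tight_setsD(1)[OF T])
  have TR: "?T \<subseteq> R" by (auto simp: Sp_image_def)
  \<comment> \<open>Cut-composition of morphisms needs a non-empty first family, here the singletons of \<open>E\<close>;
    the case \<open>E = {}\<close> is reduced to this one by adding an element of the image.\<close>
  have nonempty_case: "?T \<inter> G \<noteq> {}" if E: "E \<in> Fpow ?T" "E \<noteq> {}" and EG: "(E, G) \<in> V" for E G
  proof -
    have G: "G \<in> Fpow R" using EG cover_relation_subset[OF RV] by auto
    have ER: "E \<in> Fpow R" using E(1) TR by (auto simp: Fpow_def)
    have "\<forall>e\<in>E. \<exists>F. F \<in> Fpow T \<and> (F, {e}) \<in> f" using Fpow_subset[OF E(1)] by (auto simp: Sp_image_def)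
    then obtain h where h: "\<And>e. e \<in> E \<Longrightarrow> h e \<in> Fpow T \<and> (h e, {e}) \<in> f" by metis
    have H: "(\<Union>e\<in>E. h e) \<in> Fpow T" by (rule Fpow_UN[OF Fpow_finite[OF E(1)]]) (use h in simp)
    then have HS: "(\<Union>e\<in>E. h e) \<in> Fpow S" using TS by (auto simp: Fpow_def)
    have "((\<Union>e\<in>E. h e), G) \<in> cut_comp_ne (Fpow S) R (Fpow R) f V"
    proof (rule cut_comp_neI[OF HS G, of "(\<lambda>e. {e}) ` E" _ "{E}"])
      show "(\<lambda>e. {e}) ` E \<in> Fpow (Fpow R)" "{E} \<in> Fpow (Fpow R)" using ER by (auto simp: Fpow_def)
      show "(\<lambda>e. {e}) ` E \<noteq> {}" using E(2) by simp
      show "bowtie R ((\<lambda>e. {e}) ` E) {E}" by (auto simp: bowtie_def transversals_def)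
      show "(E', G) \<in> V" if "E' \<in> {E}" for E' using that EG by simp
      show "((\<Union>e\<in>E. h e), E') \<in> f" if E': "E' \<in> (\<lambda>e. {e}) ` E" for E'
      proof -
        obtain e where e: "e \<in> E" "E' = {e}" using E' by auto
        have "(h e, E') \<in> f" using h[OF e(1)] e(2) by simp
        then show ?thesis by (rule Cov_hom_mono_left[OF f SW _ _ HS]) (use e(1) in auto)
      qed
    qed
    then have "((\<Union>e\<in>E. h e), G) \<in> f" using Cov_homD(1)[OF f] by simp
    then show ?thesis by (rule Sp_image_meets[OF f T H])
  qed
  have "tight (R, V) ?T"
    unfolding tight.simps
  proof (intro conjI ballI iffI TR)
    fix G assume G: "G \<in> Fpow R" "\<exists>E\<in>Fpow ?T. (E, G) \<in> V"
    then obtain E where E: "E \<in> Fpow ?T" "(E, G) \<in> V" by auto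
    obtain e where e: "e \<in> ?T" using ne by auto
    have e1: "insert e E \<in> Fpow ?T" and e2: "insert e E \<in> Fpow R"
      using E(1) e TR by (auto simp: Fpow_def)
    have "(insert e E, G) \<in> V" by (rule cover_relation_mono[OF RV E(2) _ subset_refl e2 G(1)]) auto
    then show "?T \<inter> G \<noteq> {}" by (intro nonempty_case[OF e1]) auto
  next
    fix G assume G: "G \<in> Fpow R" "?T \<inter> G \<noteq> {}"
    then obtain g where g: "g \<in> ?T" "g \<in> G" by auto
    obtain F where F: "F \<in> Fpow T" "(F, {g}) \<in> f" using g(1) by (auto simp: Sp_image_def)
    have "(F, {g}) \<in> cut_comp_ne (Fpow S) R (Fpow R) f V" using F(2) Cov_homD(1)[OF f] by simp
    then obtain \<F> \<G> where c: "\<F> \<in> Fpow (Fpow R)" "\<G> \<in> Fpow (Fpow R)" "bowtie R \<F> \<G>"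
      and cF: "\<And>E. E \<in> \<F> \<Longrightarrow> (F, E) \<in> f" and cG: "\<And>E. E \<in> \<G> \<Longrightarrow> (E, {g}) \<in> V"
      by (rule cut_comp_neE) metis
    obtain E where E: "E \<in> \<G>" "E \<subseteq> ?T"
      using bowtie_subset[OF c(3,1) Sp_image_meets[OF f T F(1) cF]] by metis
    have ER: "E \<in> Fpow R" by (rule Fpow_Fpow_mem[OF c(2) E(1)])
    then have "E \<in> Fpow ?T" using E(2) by (simp add: Fpow_def)
    moreover have "(E, G) \<in> V" using cover_relation_mono[OF RV cG[OF E(1)] subset_refl _ ER G(1)] g(2) by simp
    ultimately show "\<exists>E\<in>Fpow ?T. (E, G) \<in> V" by auto
  qed
  then show ?thesis using ne by (simp add: tight_sets_def)
qed

lemma Sp_mor_eq_Some: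
  "Sp_mor A B f T = Some T' \<longleftrightarrow> T \<in> tight_sets B \<and> T' = Sp_image A f T \<and> T' \<noteq> {}"
  by (auto simp: Sp_mor_def)

lemma Sp_mor_vimage:
  assumes f: "f \<in> Cov_hom (R, V) (S, W)" and RV: "cover_relation R V" and SW: "cover_relation S W"
  shows "T \<in> partial_vimage (Sp_mor (R, V) (S, W) f) (tight_at (R, V) r) \<longleftrightarrow>
    T \<in> tight_sets (S, W) \<and> r \<in> Sp_image (R, V) f T"
proof
  assume "T \<in> partial_vimage (Sp_mor (R, V) (S, W) f) (tight_at (R, V) r)"
  then show "T \<in> tight_sets (S, W) \<and> r \<in> Sp_image (R, V) f T"
    by (auto simp: partial_vimage_def Sp_mor_eq_Some tight_at_def)
next
  assume h: "T \<in> tight_sets (S, W) \<and> r \<in> Sp_image (R, V) f T"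
  then have ne: "Sp_image (R, V) f T \<noteq> {}" by auto
  then have "Sp_image (R, V) f T \<in> tight_at (R, V) r"
    using h Sp_image_tight[OF f RV SW] by (simp add: tight_at_def)
  then show "T \<in> partial_vimage (Sp_mor (R, V) (S, W) f) (tight_at (R, V) r)"
    using h ne by (auto simp: partial_vimage_def Sp_mor_eq_Some)
qed

theorem Sp_mor_SSub_hom:
  assumes A: "A \<in> Cov" and B: "B \<in> Cov" and f: "f \<in> Cov_hom A B"
  shows "Sp_mor A B f \<in> SSub_hom (S', Sp_top B) (R', Sp_top A)"
proof -
  obtain R V S W where AB: "A = (R, V)" "B = (S, W)" by (cases A, cases B)
  have RV: "cover_relation R V" and SW: "cover_relation S W" using A B by (auto simp: AB Cov_def)
  note f = f[unfolded AB]
  have sbS: "subbasis (Sp_top (S, W)) (tight_at (S, W) ` S)" using subbasis_Sp[of "(S, W)"] by simp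
  show ?thesis
  proof (rule SSub_homI[OF subbasis_Sp])
    fix T T' assume "Sp_mor A B f T = Some T'"
    then show "T' \<in> topspace (Sp_top A)"
      using Sp_image_tight[OF f RV SW] unfolding topspace_Sp AB Sp_mor_eq_Some by metis
  next
    fix r assume "r \<in> fst A"
    then have r: "r \<in> R" by (simp add: AB)
    let ?P = "partial_vimage (Sp_mor (R, V) (S, W) f) (tight_at (R, V) r)"
    have "?P = \<Union>((\<lambda>F. Inter_in (Sp_top (S, W)) (tight_at (S, W) ` F)) ` {F \<in> Fpow S. (F, {r}) \<in> f})"
      (is "_ = ?u")
    proof (intro equalityI subsetI)
      fix T assume "T \<in> ?P"
      then have T: "T \<in> tight_sets (S, W)" "r \<in> Sp_image (R, V) f T" unfolding Sp_mor_vimage[OF f RV SW] by auto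
      then obtain F where F: "F \<in> Fpow T" "(F, {r}) \<in> f" by (auto simp: Sp_image_def)
      have "F \<in> {F \<in> Fpow S. (F, {r}) \<in> f}" using F tight_setsD(1)[OF T(1)] by (auto simp: Fpow_def)
      moreover have "T \<in> Inter_in (Sp_top (S, W)) (tight_at (S, W) ` F)"
        using T(1) Fpow_subset[OF F(1)] unfolding mem_Inter_Sp by simp
      ultimately show "T \<in> ?u" by (rule UN_I)
    next
      fix T assume "T \<in> ?u"
      then obtain F where F: "F \<in> Fpow S" "(F, {r}) \<in> f"
        and T: "T \<in> Inter_in (Sp_top (S, W)) (tight_at (S, W) ` F)" by auto
      have "F \<in> Fpow T" using F(1) T unfolding mem_Inter_Sp by (simp add: Fpow_def)
      then show "T \<in> ?P"
        using F(2) r T unfolding Sp_mor_vimage[OF f RV SW] mem_Inter_Sp by (auto simp: Sp_image_def)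
    qed
    moreover have "openin (Sp_top (S, W)) ?u"
    proof (rule openin_Union)
      fix P assume "P \<in> (\<lambda>F. Inter_in (Sp_top (S, W)) (tight_at (S, W) ` F)) ` {F \<in> Fpow S. (F, {r}) \<in> f}"
      then obtain F where F: "F \<in> Fpow S" "P = Inter_in (Sp_top (S, W)) (tight_at (S, W) ` F)" by auto
      show "openin (Sp_top (S, W)) P"
        unfolding F(2)
        by (rule openin_Inter_in[OF subbasis_openin[OF sbS]]) (use F(1) in \<open>auto simp: Fpow_def\<close>)
    qed
    ultimately show "openin (Sp_top B) (partial_vimage (Sp_mor A B f) (tight_at A r))"
      unfolding AB by simp
  qed
qed

abbreviation spatial_rel :: "'r cov \<Rightarrow> 's cov \<Rightarrow> ('s set \<rightharpoonup> 'r set) \<Rightarrow> ('s set \<times> 'r set) set" where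
  "spatial_rel A B \<phi> \<equiv> induced_rel (Sp_top B) (fst B) (tight_at B) (fst A) (tight_at A) \<phi>"

text \<open>
  Both inclusions compare \<open>f\<close> with its factorization through the cover relation of the domain
  of the map, which is spatial: the preimage of \<open>\<Union>G\<close> is covered by the basic sets of the
  finite \<open>H\<close> that \<open>f\<close> relates to \<open>{g}\<close> for some \<open>g \<in> G\<close>.
\<close>

theorem Cov_hom_spatial:
  assumes A: "A \<in> Cov" and B: "B \<in> Cov" and f: "f \<in> Cov_hom A B"
  shows "spatial_rel A B (Sp_mor A B f) = f"
proof -
  obtain R V S W where AB: "A = (R, V)" "B = (S, W)" by (cases A, cases B)
  have RV: "cover_relation R V" and SW: "cover_relation S W" using A B by (auto simp: AB Cov_def)
  note f = f[unfolded AB]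
  let ?X = "Sp_top (S, W)" and ?t = "tight_at (S, W)" and ?\<phi> = "Sp_mor (R, V) (S, W) f"
  have sb: "subbasis ?X (?t ` S)" using subbasis_Sp[of "(S, W)"] by simp
  have op: "\<And>p. p \<in> S \<Longrightarrow> openin ?X (?t p)" using subbasis_openin[OF sb] by simp
  have id: "id_on_space ?X \<in> SSub_hom (?t ` S, ?X) (?t ` S, ?X)" by (rule SSub_hom_id)
  have vid: "partial_vimage (id_on_space ?X) (Inter_in ?X V) = Inter_in ?X V" for V
    by (rule partial_vimage_id[OF Inter_in_subset])
  have W: "(F, G) \<in> W \<longleftrightarrow> F \<in> Fpow S \<and> G \<in> Fpow S \<and>
    way_below ?X (Inter_in ?X (?t ` F)) (partial_vimage (id_on_space ?X) (\<Union>(?t ` G)))" for F G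
    using cover_relation_spatial[OF SW] by (metis induced_rel_iff)
  have mem: "T \<in> partial_vimage ?\<phi> (\<Union>(tight_at (R, V) ` G)) \<longleftrightarrow>
      T \<in> tight_sets (S, W) \<and> (\<exists>g\<in>G. g \<in> Sp_image (R, V) f T)" for T G
    unfolding partial_vimage_Union using Sp_mor_vimage[OF f RV SW] by auto
  have "spatial_rel (R, V) (S, W) ?\<phi> = f"
  proof (intro equalityI subrelI)
    fix F G assume FGf: "(F, G) \<in> f"
    then have "(F, G) \<in> cut_comp_ne (Fpow S) S (Fpow R) W (one_ex R f)" using Cov_homD(2)[OF f] by simp
    then obtain \<F> \<G> where FG: "F \<in> Fpow S" "G \<in> Fpow R" "\<F> \<in> Fpow (Fpow S)" "\<F> \<noteq> {}" "bowtie S \<F> \<G>"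
      and \<G>: "\<G> \<in> Fpow (Fpow S)"
      and cF: "\<And>E. E \<in> \<F> \<Longrightarrow> (F, E) \<in> W" and cG: "\<And>E. E \<in> \<G> \<Longrightarrow> (E, G) \<in> one_ex R f"
      by (rule cut_comp_neE) metis
    have "way_below ?X (Inter_in ?X (?t ` F)) (partial_vimage ?\<phi> (\<Union>(tight_at (R, V) ` G)))"
    proof (rule way_below_of_cut[OF core_coherent_Sp[OF SW] id op Inter_in_subset FG(3,4,5)])
      fix E assume "E \<in> \<F>"
      then show "way_below ?X (Inter_in ?X (?t ` F)) (partial_vimage (id_on_space ?X) (\<Union>(?t ` E)))"
        using cF W by metis
    next
      fix E assume E: "E \<in> \<G>"
      then obtain g where g: "g \<in> G" "(E, {g}) \<in> f" using cG by (auto simp: one_ex_def)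
      show "partial_vimage (id_on_space ?X) (Inter_in ?X (?t ` E)) \<subseteq>
          partial_vimage ?\<phi> (\<Union>(tight_at (R, V) ` G))"
        unfolding vid
      proof
        fix T assume "T \<in> Inter_in ?X (?t ` E)"
        then have T: "T \<in> tight_sets (S, W)" "E \<subseteq> T" unfolding mem_Inter_Sp by auto
        have "E \<in> Fpow T" using T(2) Fpow_finite[OF Fpow_Fpow_mem[OF \<G> E]] by (simp add: Fpow_def)
        then have "g \<in> Sp_image (R, V) f T" using g Fpow_subset[OF FG(2)] by (auto simp: Sp_image_def)
        then show "T \<in> partial_vimage ?\<phi> (\<Union>(tight_at (R, V) ` G))"
          unfolding mem using T(1) g(1) by auto
      qed
    qed
    then show "(F, G) \<in> spatial_rel (R, V) (S, W) ?\<phi>"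
      using FG(1,2) unfolding induced_rel_iff by simp
  next
    fix F G assume "(F, G) \<in> spatial_rel (R, V) (S, W) ?\<phi>"
    then have FG: "F \<in> Fpow S" "G \<in> Fpow R"
      and wb: "way_below ?X (Inter_in ?X (?t ` F)) (partial_vimage ?\<phi> (\<Union>(tight_at (R, V) ` G)))"
      unfolding induced_rel_iff by auto
    let ?H = "{H \<in> Fpow S. H \<noteq> {} \<and> (\<exists>g\<in>G. (H, {g}) \<in> f)}"
    have H: "?H \<subseteq> Fpow S" "{} \<notin> ?H" by auto
    have cov: "partial_vimage ?\<phi> (\<Union>(tight_at (R, V) ` G)) \<subseteq>
        (\<Union>H\<in>?H. partial_vimage (id_on_space ?X) (Inter_in ?X (?t ` H)))"
    proof
      fix T assume "T \<in> partial_vimage ?\<phi> (\<Union>(tight_at (R, V) ` G))"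
      then obtain g where T: "T \<in> tight_sets (S, W)" and g: "g \<in> G" "g \<in> Sp_image (R, V) f T"
        unfolding mem by auto
      obtain E where E: "E \<in> Fpow T" "(E, {g}) \<in> f" using g(2) by (auto simp: Sp_image_def)
      \<comment> \<open>Adding \<open>e\<close> makes the chosen set non-empty, as \<open>cut_of_way_below\<close> requires.\<close>
      obtain e where e: "e \<in> T" using tight_setsD(2)[OF T] by auto
      have ES: "insert e E \<in> Fpow S" using e E(1) tight_setsD(1)[OF T] by (auto simp: Fpow_def)
      have "(insert e E, {g}) \<in> f" by (rule Cov_hom_mono_left[OF f SW E(2) _ ES]) auto
      then have "insert e E \<in> ?H" using ES g(1) by auto
      moreover have "T \<in> partial_vimage (id_on_space ?X) (Inter_in ?X (?t ` insert e E))"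
        unfolding vid mem_Inter_Sp using T e E(1) by (auto simp: Fpow_def)
      ultimately show "T \<in> (\<Union>H\<in>?H. partial_vimage (id_on_space ?X) (Inter_in ?X (?t ` H)))"
        by (rule UN_I)
    qed
    obtain \<F> \<G> where c: "\<F> \<in> Fpow (Fpow S)" "\<G> \<in> Fpow (Fpow S)" "\<F> \<noteq> {}" "\<G> \<subseteq> ?H" "bowtie S \<F> \<G>"
      and cF: "\<And>E. E \<in> \<F> \<Longrightarrow> way_below ?X (Inter_in ?X (?t ` F)) (partial_vimage (id_on_space ?X) (\<Union>(?t ` E)))"
      by (rule cut_of_way_below[OF core_compact_Sp[OF SW] id op wb H cov]) auto
    have "(F, G) \<in> cut_comp_ne (Fpow S) S (Fpow R) W (one_ex R f)"
    proof (rule cut_comp_neI[OF FG c(1,2,3,5)])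
      fix E assume "E \<in> \<F>"
      then show "(F, E) \<in> W" using cF FG(1) Fpow_Fpow_mem[OF c(1)] W by metis
    next
      fix E assume "E \<in> \<G>"
      then have "E \<in> ?H" using c(4) by (rule subsetD[rotated])
      then show "(E, G) \<in> one_ex R f" using FG(2) by (auto simp: one_ex_def)
    qed
    then show "(F, G) \<in> f" using Cov_homD(2)[OF f] by simp
  qed
  then show ?thesis by (simp add: AB)
qed



section \<open>Points as tight sets\<close>

text \<open>
  A point lies in an open set iff it has a basic neighbourhood way below that set.  So on the index sets
  of points, \<open>Sp_image\<close> computes the map that induces the relation; naturality of \<open>lam\<close> and faithfulness
  of \<open>Sp_mor\<close> are both instances.
\<close>

lemma Sp_image_point:
  assumes X: "(U ` I, X) \<in> SSub" and Y: "subbasis Y (W ` J)" and \<phi>: "\<phi> \<in> SSub_hom (S, X) (R, Y)"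
    and x: "x \<in> topspace X"
  shows "Sp_image (J, V) (induced_rel X I U J W \<phi>) {i \<in> I. x \<in> U i} = {j \<in> J. x \<in> partial_vimage \<phi> (W j)}"
proof (intro equalityI subsetI)
  fix j assume "j \<in> Sp_image (J, V) (induced_rel X I U J W \<phi>) {i \<in> I. x \<in> U i}"
  then obtain F where F: "j \<in> J" "F \<in> Fpow {i \<in> I. x \<in> U i}" "(F, {j}) \<in> induced_rel X I U J W \<phi>"
    by (auto simp: Sp_image_def)
  have "way_below X (Inter_in X (U ` F)) (partial_vimage \<phi> (W j))"
    using F(3) by (simp add: induced_rel_iff)
  then have "Inter_in X (U ` F) \<subseteq> partial_vimage \<phi> (W j)"
    by (rule way_below_subset) (rule openin_partial_vimage[OF \<phi> subbasis_openin[OF Y F(1)]])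
  moreover have "x \<in> Inter_in X (U ` F)" using x Fpow_subset[OF F(2)] by (auto simp: mem_Inter_in)
  ultimately show "j \<in> {j \<in> J. x \<in> partial_vimage \<phi> (W j)}" using F(1) by auto
next
  fix j assume "j \<in> {j \<in> J. x \<in> partial_vimage \<phi> (W j)}"
  then have j: "j \<in> J" "x \<in> partial_vimage \<phi> (W j)" by auto
  obtain F where F: "F \<in> Fpow I" "x \<in> Inter_in X (U ` F)"
    "way_below X (Inter_in X (U ` F)) (partial_vimage \<phi> (W j))"
    using way_below_nbhd[OF X openin_partial_vimage[OF \<phi> subbasis_openin[OF Y j(1)]] j(2)] by metis
  have "F \<in> Fpow {i \<in> I. x \<in> U i}" using F(1,2) by (auto simp: Fpow_def mem_Inter_in)
  moreover have "(F, {j}) \<in> induced_rel X I U J W \<phi>"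
    using F j(1) by (simp add: induced_rel_iff Fpow_def)
  ultimately show "j \<in> Sp_image (J, V) (induced_rel X I U J W \<phi>) {i \<in> I. x \<in> U i}"
    using j(1) by (auto simp: Sp_image_def)
qed

lemma point_tight:
  assumes X: "(U ` I, X) \<in> SSub" and x: "x \<in> topspace X"
  shows "{i \<in> I. x \<in> U i} \<in> tight_sets (induced_cov X I U)"
proof -
  let ?T = "{i \<in> I. x \<in> U i}"
  have sb: "subbasis X (U ` I)" using X by (simp add: SSub_iff)
  note iff = induced_rel_id_iff[OF sb]
  have "?T \<noteq> {}" using subbasis_cover[OF sb x] by auto
  moreover have "tight (induced_cov X I U) ?T"
    unfolding induced_cov_def tight.simps
  proof (intro conjI ballI iffI)
    fix G assume G: "G \<in> Fpow I" "\<exists>F\<in>Fpow ?T. (F, G) \<in> induced_rel X I U I U (id_on_space X)"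
    then obtain F where F: "F \<in> Fpow ?T" "way_below X (Inter_in X (U ` F)) (\<Union>(U ` G))"
      unfolding iff by auto
    have "x \<in> Inter_in X (U ` F)" using x Fpow_subset[OF F(1)] by (auto simp: mem_Inter_in)
    then have "x \<in> \<Union>(U ` G)" using way_below_subset[OF F(2) openin_UN_subbasis[OF sb G(1)]] by auto
    then show "?T \<inter> G \<noteq> {}" using Fpow_subset[OF G(1)] by auto
  next
    fix G assume G: "G \<in> Fpow I" "?T \<inter> G \<noteq> {}"
    then have "x \<in> \<Union>(U ` G)" by auto
    then obtain F where F: "F \<in> Fpow I" "x \<in> Inter_in X (U ` F)" "way_below X (Inter_in X (U ` F)) (\<Union>(U ` G))"
      using way_below_nbhd[OF X openin_UN_subbasis[OF sb G(1)]] by metis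
    have "F \<in> Fpow ?T" using F(1,2) by (auto simp: Fpow_def mem_Inter_in)
    moreover have "(F, G) \<in> induced_rel X I U I U (id_on_space X)" unfolding iff using F G(1) by simp
    ultimately show "\<exists>F\<in>Fpow ?T. (F, G) \<in> induced_rel X I U I U (id_on_space X)" by auto
  qed auto
  ultimately show ?thesis by (simp add: tight_sets_def)
qed

text \<open>
  The point \<open>x\<close> is the generic point of the closed set \<open>C\<close> of all points outside every \<open>U i\<close> with
  \<open>i \<notin> T\<close>.  Irreducibility of \<open>C\<close> amounts to \<open>C\<close> meeting \<open>\<Inter>F\<close> for every finite \<open>F \<subseteq> T\<close>.  If it did not,
  a finite \<open>H \<subseteq> T\<close> with \<open>\<Inter>H\<close> way below \<open>\<Inter>F\<close> would cover finitely many indices outside \<open>T\<close>,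
  contrary to tightness.
\<close>

theorem tight_point:
  assumes X: "(U ` I, X) \<in> SSub" and T: "T \<in> tight_sets (induced_cov X I U)"
  obtains x where "x \<in> topspace X" "T = {i \<in> I. x \<in> U i}"
proof -
  let ?R = "induced_rel X I U I U (id_on_space X)"
  have sb: "subbasis X (U ` I)" and cc: "core_compact X" and co: "core_coherent X" and sob: "sober_space X"
    using X by (auto simp: SSub_iff)
  note iff = induced_rel_id_iff[OF sb]
  have cr: "cover_relation I ?R" using induced_cov_Cov[OF X] by (simp add: induced_cov_def Cov_def)
  have T: "T \<in> tight_sets (I, ?R)" using T by (simp add: induced_cov_def)
  have TI: "T \<subseteq> I" by (rule tight_setsD(1)[OF T])
  have op: "\<And>i. i \<in> I \<Longrightarrow> openin X (U i)" using subbasis_openin[OF sb] by simp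
  define C where "C = topspace X - \<Union>(U ` (I - T))"
  have meet: "Inter_in X (U ` F) \<inter> C \<noteq> {}" if F: "F \<in> Fpow T" for F
  proof
    assume e: "Inter_in X (U ` F) \<inter> C = {}"
    \<comment> \<open>Core coherence applies to non-empty intersections only.\<close>
    obtain t where t: "t \<in> T" using tight_setsD(2)[OF T] by auto
    let ?F = "insert t F"
    have F': "?F \<in> Fpow T" using F t by (auto simp: Fpow_def)
    obtain H where H: "H \<in> Fpow T" "\<And>f. f \<in> ?F \<Longrightarrow> (H, {f}) \<in> ?R"
      using tight_set_interpolate[OF cr T F'] by metis
    have HI: "H \<in> Fpow I" using H(1) TI by (auto simp: Fpow_def)
    have "way_below X (Inter_in X (U ` H)) (\<Inter>(U ` ?F))"
    proof (rule way_below_Inter[OF co _ _ Inter_in_subset])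
      show "finite (U ` ?F)" "U ` ?F \<noteq> {}" using Fpow_finite[OF F'] by auto
      fix q assume "q \<in> U ` ?F"
      then obtain f where f: "f \<in> ?F" "q = U f" by auto
      then have "f \<in> I" using Fpow_subset[OF F'] TI by auto
      then show "openin X q" using op f(2) by simp
      show "way_below X (Inter_in X (U ` H)) q" using H(2)[OF f(1)] unfolding iff f(2) by simp
    qed
    moreover have "\<Inter>(U ` ?F) \<subseteq> \<Union>(U ` (I - T))"
    proof
      fix x assume x: "x \<in> \<Inter>(U ` ?F)"
      have "x \<in> topspace X" using x openin_subset[OF op[of t]] t TI by auto
      then have "x \<in> Inter_in X (U ` F)" using x by (simp add: Inter_in_def)
      then have "x \<notin> C" using e by auto
      then show "x \<in> \<Union>(U ` (I - T))" using \<open>x \<in> topspace X\<close> by (simp add: C_def)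
    qed
    ultimately have "\<exists>\<V>\<subseteq>U ` (I - T). finite \<V> \<and> way_below X (Inter_in X (U ` H)) (\<Union>\<V>)"
      by (intro way_below_finite_subcover[OF cc]) (use op in auto)
    then obtain \<V> where V: "finite \<V>" "\<V> \<subseteq> U ` (I - T)" "way_below X (Inter_in X (U ` H)) (\<Union>\<V>)"
      by auto
    obtain D where D: "D \<subseteq> I - T" "finite D" "\<V> = U ` D"
      using finite_subset_image[OF V(1,2)] by (elim exE conjE)
    have DI: "D \<in> Fpow I" using D(1,2) by (auto simp: Fpow_def)
    have "(H, D) \<in> ?R" unfolding iff using HI DI V(3) D(3) by simp
    then have "T \<inter> D \<noteq> {}" using tight_setsD(3)[OF T H(1) _ DI] by simp
    then show False using D(1) by auto
  qed
  have sub: "F \<subseteq> T" if "F \<in> Fpow I" "x \<in> Inter_in X (U ` F)" "x \<in> C" for F x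
    using that by (auto simp: C_def mem_Inter_in Fpow_def)
  have "irreducible_closed X C"
  proof (rule irreducible_closedI)
    have "openin X (\<Union>(U ` (I - T)))" using op by auto
    then show "closedin X C" unfolding C_def by (simp add: closedin_diff)
    show "C \<noteq> {}" using meet[of "{}"] by (auto simp: Fpow_def)
  next
    fix A B assume AB: "openin X A" "openin X B" "A \<inter> C \<noteq> {}" "B \<inter> C \<noteq> {}"
    obtain a b where ab: "a \<in> A" "a \<in> C" "b \<in> B" "b \<in> C" using AB(3,4) by auto
    obtain F where F: "F \<in> Fpow I" "a \<in> Inter_in X (U ` F)" "Inter_in X (U ` F) \<subseteq> A"
      using subbasis_nbhd[OF sb AB(1) ab(1)] by metis
    obtain E where E: "E \<in> Fpow I" "b \<in> Inter_in X (U ` E)" "Inter_in X (U ` E) \<subseteq> B"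
      using subbasis_nbhd[OF sb AB(2) ab(3)] by metis
    have "F \<union> E \<in> Fpow T"
      using sub[OF F(1,2) ab(2)] sub[OF E(1,2) ab(4)] F(1) E(1) by (auto simp: Fpow_def)
    then have "Inter_in X (U ` F) \<inter> Inter_in X (U ` E) \<inter> C \<noteq> {}" using meet unfolding Inter_in_Un[symmetric] by simp
    then show "A \<inter> B \<inter> C \<noteq> {}" using F(3) E(3) by auto
  qed
  then obtain x where x: "x \<in> topspace X" "C = X closure_of {x}"
    using sob unfolding sober_space_def by metis
  have xC: "x \<in> C" using x by (simp add: in_closure_of)
  have "T = {i \<in> I. x \<in> U i}"
  proof (intro equalityI subsetI)
    fix i assume i: "i \<in> T"
    then have "Inter_in X (U ` {i}) \<inter> C \<noteq> {}" by (intro meet) (simp add: Fpow_def)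
    then obtain y where "y \<in> U i" "y \<in> X closure_of {x}" using x(2) by (auto simp: Inter_in_def)
    then have "x \<in> U i" using op[of i] i TI by (auto simp: in_closure_of)
    then show "i \<in> {i \<in> I. x \<in> U i}" using i TI by auto
  next
    fix i assume "i \<in> {i \<in> I. x \<in> U i}"
    then show "i \<in> T" using xC by (auto simp: C_def)
  qed
  then show thesis by (rule that[OF x(1)])
qed


section \<open>The functors and the transformations\<close>

lemma SSub_image_id: "(S, X) \<in> SSub \<Longrightarrow> ((\<lambda>p. p) ` S, X) \<in> SSub"
  by simp

lemma Ab_eq:
  assumes "(S, X) \<in> SSub"
  shows "Ab (S, X) = induced_cov X S (\<lambda>p. p)"
proof -
  have "subbasis X ((\<lambda>p. p) ` S)" using assms by (simp add: SSub_iff)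
  from induced_rel_id_iff[OF this] show ?thesis by (auto simp: induced_cov_def)
qed

lemma Ab_mor_eq: "Ab_mor (S, X) (R, Y) \<phi> = induced_rel X S (\<lambda>p. p) R (\<lambda>p. p) \<phi>"
  by (simp add: induced_rel_def partial_vimage_def)

lemma Ab_mor_Sp:
  "Ab_mor (S, X) (Sp A) \<phi> = induced_rel X S (\<lambda>p. p) (tight_at A ` fst A) (\<lambda>p. p) \<phi>"
  "Ab_mor (Sp B) (Sp A) \<psi> =
    induced_rel (Sp_top B) (tight_at B ` fst B) (\<lambda>p. p) (tight_at A ` fst A) (\<lambda>p. p) \<psi>"
  by (simp_all only: Sp_eq Ab_mor_eq)

lemma Ab_Sp: "A \<in> Cov \<Longrightarrow> Ab (Sp A) = induced_cov (Sp_top A) (tight_at A ` fst A) (\<lambda>p. p)"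
  using Ab_eq[OF Sp_SSub] by (simp add: Sp_eq)

lemma Cov_comp_induced:
  assumes "(U ` I, X) \<in> SSub" "(W ` J, Y) \<in> SSub" "(Q ` K, Z) \<in> SSub"
    and "\<phi> \<in> SSub_hom (S, X) (R, Y)" "\<psi> \<in> SSub_hom (R', Y) (P, Z)"
  shows "Cov_comp (induced_cov Z K Q) (induced_cov Y J W) (induced_cov X I U)
      (induced_rel X I U J W \<phi>) (induced_rel Y J W K Q \<psi>) = induced_rel X I U K Q (\<psi> \<circ>\<^sub>m \<phi>)"
  using induced_rel_comp[OF assms] by (simp add: Cov_comp_def induced_cov_def)

lemma SSub_hom_Sp: "SSub_hom (Sp B) (Sp A) = SSub_hom (tight_at B ` fst B, Sp_top B) (tight_at A ` fst A, Sp_top A)"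
  by (simp only: Sp_eq)

lemma spatial_rel_hom:
  assumes "A \<in> Cov" "B \<in> Cov" "\<phi> \<in> SSub_hom (Sp B) (Sp A)"
  shows "spatial_rel A B \<phi> \<in> Cov_hom A B"
  using induced_rel_Cov_hom[OF Sp_SSub[OF assms(2)] Sp_SSub[OF assms(1)] assms(3)[unfolded SSub_hom_Sp]]
  by (simp only: induced_cov_Sp assms)

lemma spatial_rel_comp:
  assumes "A \<in> Cov" "B \<in> Cov" "C \<in> Cov" "\<phi> \<in> SSub_hom (Sp B) (Sp A)" "\<psi> \<in> SSub_hom (Sp C) (Sp B)"
  shows "Cov_comp A B C (spatial_rel B C \<psi>) (spatial_rel A B \<phi>) = spatial_rel A C (\<phi> \<circ>\<^sub>m \<psi>)"
  using Cov_comp_induced[OF Sp_SSub[OF assms(3)] Sp_SSub[OF assms(2)] Sp_SSub[OF assms(1)]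
      assms(5,4)[unfolded SSub_hom_Sp]]
  by (simp only: induced_cov_Sp assms)

lemma Sp_mor_hom:
  assumes "A \<in> Cov" "B \<in> Cov" "f \<in> Cov_hom A B"
  shows "Sp_mor A B f \<in> SSub_hom (Sp B) (Sp A)"
  unfolding SSub_hom_Sp by (rule Sp_mor_SSub_hom[OF assms])

lemma Cov_id_spatial: "A \<in> Cov \<Longrightarrow> spatial_rel A A (id_on_space (Sp_top A)) = Cov_id A"
  using induced_cov_Sp[of A] by (metis Cov_id_def induced_cov_def snd_conv)

lemma tight_at_point:
  assumes "T \<in> tight_sets A"
  shows "{p \<in> fst A. T \<in> tight_at A p} = T"
proof -
  obtain S R where A: "A = (S, R)" by (cases A)
  then show ?thesis using assms tight_setsD(1)[of T S R] by (auto simp: tight_at_def)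
qed

text \<open>
  With \<open>Cov_hom_spatial\<close> this makes \<open>Sp_mor\<close> and \<open>spatial_rel\<close> mutually inverse, so that equations between
  morphisms of cover relations can be checked on partial maps.
\<close>

lemma Sp_mor_spatial:
  assumes A: "A \<in> Cov" and B: "B \<in> Cov" and \<phi>: "\<phi> \<in> SSub_hom (Sp B) (Sp A)"
  shows "Sp_mor A B (spatial_rel A B \<phi>) = \<phi>"
proof
  fix T
  note \<phi>' = \<phi>[unfolded SSub_hom_Sp]
  show "Sp_mor A B (spatial_rel A B \<phi>) T = \<phi> T"
  proof (cases "T \<in> tight_sets B")
    case False
    then have "\<phi> T = None"
      using SSub_hom_topspace(1)[OF \<phi>', of T] unfolding topspace_Sp by (cases "\<phi> T") auto
    then show ?thesis using False by (simp add: Sp_mor_def)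
  next
    case True
    have "Sp_image (fst A, snd A) (spatial_rel A B \<phi>) {p \<in> fst B. T \<in> tight_at B p} =
        {r \<in> fst A. T \<in> partial_vimage \<phi> (tight_at A r)}"
      by (rule Sp_image_point[OF Sp_SSub[OF B] subbasis_Sp \<phi>']) (use True in \<open>simp only: topspace_Sp\<close>)
    then have im: "Sp_image A (spatial_rel A B \<phi>) T = {r \<in> fst A. T \<in> partial_vimage \<phi> (tight_at A r)}"
      using tight_at_point[OF True] by simp
    show ?thesis
    proof (cases "\<phi> T")
      case None
      then show ?thesis using im by (simp add: Sp_mor_def partial_vimage_def)
    next
      case (Some T')
      have T': "T' \<in> tight_sets A" using SSub_hom_topspace(2)[OF \<phi>' Some] unfolding topspace_Sp .
      have "Sp_image A (spatial_rel A B \<phi>) T = {r \<in> fst A. T' \<in> tight_at A r}"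
        unfolding im using Some by (simp add: partial_vimage_def)
      then have "Sp_image A (spatial_rel A B \<phi>) T = T'" using tight_at_point[OF T'] by simp
      moreover have "T' \<noteq> {}" using T' by (simp add: tight_sets_def)
      ultimately show ?thesis using True Some by (simp add: Sp_mor_def)
    qed
  qed
qed

lemma SSub_comp_hom:
  assumes "f \<in> SSub_hom A B" "g \<in> SSub_hom B C" "C \<in> SSub"
  shows "g \<circ>\<^sub>m f \<in> SSub_hom A C"
proof -
  obtain S X R Y Q Z where ABC: "A = (S, X)" "B = (R, Y)" "C = (Q, Z)" by (metis surj_pair)
  have "subbasis Z ((\<lambda>p. p) ` Q)" using assms(3) by (simp add: ABC SSub_iff)
  from SSub_hom_comp[OF assms(1,2)[unfolded ABC] this] show ?thesis unfolding ABC .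
qed

lemma Sp_in_SSub: "A \<in> Cov \<Longrightarrow> Sp A \<in> SSub"
  using Sp_SSub by (simp only: Sp_eq)

lemma SSub_id_eq: "SSub_id (S, X) = id_on_space X" "SSub_id (Sp A) = id_on_space (Sp_top A)"
  by (simp_all add: SSub_id_def Sp_def)

subsection \<open>Category laws for cover relations\<close>

lemma Cov_id_hom: "A \<in> Cov \<Longrightarrow> Cov_id A \<in> Cov_hom A A"
  using spatial_rel_hom[of A A "id_on_space (Sp_top A)"] SSub_hom_id
  unfolding SSub_hom_Sp by (metis Cov_id_spatial)

lemma Cov_comp_eq:
  assumes "A \<in> Cov" "B \<in> Cov" "C \<in> Cov" "f \<in> Cov_hom A B" "g \<in> Cov_hom B C"
  shows "Cov_comp A B C g f = spatial_rel A C (Sp_mor A B f \<circ>\<^sub>m Sp_mor B C g)"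
  using spatial_rel_comp[OF assms(1-3) Sp_mor_hom[OF assms(1,2,4)] Sp_mor_hom[OF assms(2,3,5)]]
  by (simp only: Cov_hom_spatial assms)

lemma Sp_mor_comp_hom:
  assumes "A \<in> Cov" "B \<in> Cov" "C \<in> Cov" "f \<in> Cov_hom A B" "g \<in> Cov_hom B C"
  shows "Sp_mor A B f \<circ>\<^sub>m Sp_mor B C g \<in> SSub_hom (Sp C) (Sp A)"
  by (rule SSub_comp_hom[OF Sp_mor_hom[OF assms(2,3,5)] Sp_mor_hom[OF assms(1,2,4)] Sp_in_SSub[OF assms(1)]])

lemma Cov_comp_hom:
  assumes "A \<in> Cov" "B \<in> Cov" "C \<in> Cov" "f \<in> Cov_hom A B" "g \<in> Cov_hom B C"
  shows "Cov_comp A B C g f \<in> Cov_hom A C"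
  unfolding Cov_comp_eq[OF assms] by (rule spatial_rel_hom[OF assms(1,3) Sp_mor_comp_hom[OF assms]])

lemma Sp_mor_comp:
  assumes "A \<in> Cov" "B \<in> Cov" "C \<in> Cov" "f \<in> Cov_hom A B" "g \<in> Cov_hom B C"
  shows "Sp_mor A C (Cov_comp A B C g f) = Sp_mor A B f \<circ>\<^sub>m Sp_mor B C g"
  unfolding Cov_comp_eq[OF assms] by (rule Sp_mor_spatial[OF assms(1,3) Sp_mor_comp_hom[OF assms]])

lemma Sp_mor_id:
  assumes "A \<in> Cov"
  shows "Sp_mor A A (Cov_id A) = SSub_id (Sp A)"
  unfolding SSub_id_eq Cov_id_spatial[OF assms, symmetric]
  by (rule Sp_mor_spatial[OF assms assms]) (unfold SSub_hom_Sp, rule SSub_hom_id)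

lemma Cov_comp_id:
  assumes "A \<in> Cov" "B \<in> Cov" "f \<in> Cov_hom A B"
  shows "Cov_comp A A B f (Cov_id A) = f" "Cov_comp A B B (Cov_id B) f = f"
proof -
  note h = Sp_mor_hom[OF assms, unfolded SSub_hom_Sp]
  show "Cov_comp A A B f (Cov_id A) = f"
    using Cov_comp_eq[OF assms(1,1,2) Cov_id_hom[OF assms(1)] assms(3)]
    unfolding Sp_mor_id[OF assms(1)] SSub_id_eq id_map_comp(2)[OF h] Cov_hom_spatial[OF assms] .
  show "Cov_comp A B B (Cov_id B) f = f"
    using Cov_comp_eq[OF assms(1,2,2,3) Cov_id_hom[OF assms(2)]]
    unfolding Sp_mor_id[OF assms(2)] SSub_id_eq id_map_comp(1)[OF h] Cov_hom_spatial[OF assms] .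
qed

lemma map_comp_assoc: "(h \<circ>\<^sub>m g) \<circ>\<^sub>m f = h \<circ>\<^sub>m (g \<circ>\<^sub>m f)"
  by (auto simp: map_comp_def fun_eq_iff split: option.splits)

lemma Cov_comp_assoc:
  assumes "A \<in> Cov" "B \<in> Cov" "C \<in> Cov" "D \<in> Cov"
    and "f \<in> Cov_hom A B" "g \<in> Cov_hom B C" "h \<in> Cov_hom C D"
  shows "Cov_comp A B D (Cov_comp B C D h g) f = Cov_comp A C D h (Cov_comp A B C g f)"
  unfolding Cov_comp_eq[OF assms(1,2,4,5) Cov_comp_hom[OF assms(2,3,4,6,7)]]
    Cov_comp_eq[OF assms(1,3,4) Cov_comp_hom[OF assms(1,2,3,5,6)] assms(7)]
    Sp_mor_comp[OF assms(2,3,4,6,7)] Sp_mor_comp[OF assms(1,2,3,5,6)] map_comp_assoc ..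

subsection \<open>Category laws for subbases\<close>

lemma SSub_id_hom: "SSub_id A \<in> SSub_hom A A"
proof -
  obtain S X where "A = (S, X)" by (cases A)
  then show ?thesis using SSub_hom_id[of X S S] by (simp only: SSub_id_eq)
qed

lemma SSub_comp_id:
  assumes "f \<in> SSub_hom A B"
  shows "f \<circ>\<^sub>m SSub_id A = f" "SSub_id B \<circ>\<^sub>m f = f"
proof -
  obtain S X R Y where AB: "A = (S, X)" "B = (R, Y)" by (metis surj_pair)
  show "f \<circ>\<^sub>m SSub_id A = f" "SSub_id B \<circ>\<^sub>m f = f"
    using id_map_comp assms unfolding AB SSub_id_eq by metis+
qed

subsection \<open>Functoriality of \<open>Ab\<close>\<close>

lemma Ab_in_Cov:
  assumes "A \<in> SSub"
  shows "Ab A \<in> Cov"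
proof -
  obtain S X where A: "A = (S, X)" by (cases A)
  have "((\<lambda>p. p) ` S, X) \<in> SSub" using assms by (simp add: A)
  from induced_cov_Cov[OF this] show ?thesis unfolding A Ab_eq[OF assms[unfolded A]] .
qed

lemma Ab_mor_hom:
  assumes "A \<in> SSub" "B \<in> SSub" "\<phi> \<in> SSub_hom A B"
  shows "Ab_mor A B \<phi> \<in> Cov_hom (Ab B) (Ab A)"
proof -
  obtain S X R Y where AB: "A = (S, X)" "B = (R, Y)" by (metis surj_pair)
  note X = assms(1)[unfolded AB] and Y = assms(2)[unfolded AB]
  show ?thesis
    using induced_rel_Cov_hom[OF SSub_image_id[OF X] SSub_image_id[OF Y] assms(3)[unfolded AB]]
    unfolding AB Ab_mor_eq Ab_eq[OF X] Ab_eq[OF Y] .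
qed

lemma Ab_mor_id:
  assumes "A \<in> SSub"
  shows "Ab_mor A A (SSub_id A) = Cov_id (Ab A)"
proof -
  obtain S X where A: "A = (S, X)" by (cases A)
  note X = assms(1)[unfolded A]
  show ?thesis unfolding A Ab_mor_eq Ab_eq[OF X] SSub_id_eq by (simp add: Cov_id_def induced_cov_def)
qed

lemma Ab_mor_comp:
  assumes "A \<in> SSub" "B \<in> SSub" "C \<in> SSub" "\<phi> \<in> SSub_hom A B" "\<psi> \<in> SSub_hom B C"
  shows "Ab_mor A C (\<psi> \<circ>\<^sub>m \<phi>) = Cov_comp (Ab C) (Ab B) (Ab A) (Ab_mor A B \<phi>) (Ab_mor B C \<psi>)"
proof -
  obtain S X R Y Q Z where ABC: "A = (S, X)" "B = (R, Y)" "C = (Q, Z)" by (metis surj_pair)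
  note X = assms(1)[unfolded ABC] and Y = assms(2)[unfolded ABC] and Z = assms(3)[unfolded ABC]
  show ?thesis
    using Cov_comp_induced[OF SSub_image_id[OF X] SSub_image_id[OF Y] SSub_image_id[OF Z] assms(4,5)[unfolded ABC]]
    unfolding ABC Ab_mor_eq Ab_eq[OF X] Ab_eq[OF Y] Ab_eq[OF Z] by (rule sym)
qed

subsection \<open>The transformation \<open>lam\<close>\<close>

lemma lam_vimage:
  assumes X: "(S, X) \<in> SSub" and p: "p \<in> S"
  shows "partial_vimage (lam (S, X)) (tight_at (Ab (S, X)) p) = p"
proof -
  have "p \<subseteq> topspace X" using X p by (auto simp: SSub_iff subbasis_def dest: openin_subset)
  moreover have "{p \<in> S. x \<in> p} \<in> tight_sets (Ab (S, X))" if "x \<in> topspace X" for x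
    using point_tight[OF SSub_image_id[OF X] that] unfolding Ab_eq[OF X] .
  ultimately show ?thesis using p by (auto simp: partial_vimage_def tight_at_def simp del: Ab.simps)
qed

lemma lam_SSub_hom:
  assumes X: "(S, X) \<in> SSub"
  shows "lam (S, X) \<in> SSub_hom (S', X) (R', Sp_top (Ab (S, X)))"
proof (rule SSub_homI[OF subbasis_Sp])
  fix x T assume "lam (S, X) x = Some T"
  then have "x \<in> topspace X" "T = {p \<in> S. x \<in> p}" by (auto split: if_splits)
  then show "T \<in> topspace (Sp_top (Ab (S, X)))"
    using point_tight[OF SSub_image_id[OF X]] unfolding topspace_Sp Ab_eq[OF X] by simp
next
  fix p assume "p \<in> fst (Ab (S, X))"
  then have p: "p \<in> S" by simp
  show "openin X (partial_vimage (lam (S, X)) (tight_at (Ab (S, X)) p))"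
    unfolding lam_vimage[OF X p] using X p by (auto simp: SSub_iff subbasis_def)
qed

text \<open>
  Injectivity is the \<open>T\<^sub>0\<close> property and surjectivity is \<open>tight_point\<close>; the inverse is continuous because
  \<open>lam\<close> maps each subbasic set \<open>p\<close> onto \<open>tight_at (Ab A) p\<close>.
\<close>

theorem lam_iso:
  assumes "A \<in> SSub"
  shows "SSub_iso A (Sp (Ab A)) (lam A)"
proof -
  obtain S X where A: "A = (S, X)" by (cases A)
  note X = assms[unfolded A]
  let ?K = "Ab (S, X)"
  define g where "g T = (SOME x. x \<in> topspace X \<and> T = {p \<in> S. x \<in> p})" for T
  define \<psi> where "\<psi> T = (if T \<in> tight_sets ?K then Some (g T) else None)" for T
  have g: "g T \<in> topspace X" "{p \<in> S. g T \<in> p} = T" if T: "T \<in> tight_sets ?K" for T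
  proof -
    have "\<exists>x. x \<in> topspace X \<and> T = {p \<in> S. x \<in> p}"
      using tight_point[OF SSub_image_id[OF X] T[unfolded Ab_eq[OF X]]] by metis
    then have gT: "g T \<in> topspace X \<and> T = {p \<in> S. g T \<in> p}" unfolding g_def by (rule someI_ex)
    show "g T \<in> topspace X" by (rule conjunct1[OF gT])
    show "{p \<in> S. g T \<in> p} = T" by (rule conjunct2[OF gT, symmetric])
  qed
  have t: "{p \<in> S. x \<in> p} \<in> tight_sets ?K" if "x \<in> topspace X" for x
    using point_tight[OF SSub_image_id[OF X] that] unfolding Ab_eq[OF X] .
  have gx: "g {p \<in> S. x \<in> p} = x" if x: "x \<in> topspace X" for x
  proof (rule SSub_T0[OF SSub_image_id[OF X] g(1)[OF t[OF x]] x])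
    fix p assume "p \<in> S"
    then show "g {p \<in> S. x \<in> p} \<in> p \<longleftrightarrow> x \<in> p" using g(2)[OF t[OF x]] by auto
  qed
  have "\<psi> \<in> SSub_hom (Sp ?K) (S, X)"
    unfolding Sp_eq
  proof (rule SSub_homI[where W = "\<lambda>p. p" and J = S])
    show "subbasis X ((\<lambda>p. p) ` S)" using X by (simp add: SSub_iff)
    fix T x assume "\<psi> T = Some x"
    then show "x \<in> topspace X" using g(1) by (auto simp: \<psi>_def simp del: Ab.simps split: if_splits)
  next
    fix p assume p: "p \<in> S"
    have "g T \<in> p \<longleftrightarrow> p \<in> T" if "T \<in> tight_sets ?K" for T using g(2)[OF that] p by auto
    then have "partial_vimage \<psi> p = tight_at ?K p"
      by (auto simp: partial_vimage_def \<psi>_def tight_at_def simp del: Ab.simps)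
    then show "openin (Sp_top ?K) (partial_vimage \<psi> p)"
      using subbasis_openin[OF subbasis_Sp[of ?K], of p] p by simp
  qed
  moreover have "\<psi> \<circ>\<^sub>m lam (S, X) = SSub_id (S, X)"
  proof
    fix x show "(\<psi> \<circ>\<^sub>m lam (S, X)) x = SSub_id (S, X) x"
      using t[of x] gx[of x] by (auto simp: \<psi>_def SSub_id_def restrict_map_def simp del: Ab.simps)
  qed
  moreover have "lam (S, X) \<circ>\<^sub>m \<psi> = SSub_id (Sp ?K)"
    unfolding SSub_id_eq
  proof
    fix T
    have "T \<in> topspace (Sp_top ?K) \<longleftrightarrow> T \<in> tight_sets ?K" by (simp only: topspace_Sp)
    then show "(lam (S, X) \<circ>\<^sub>m \<psi>) T = id_on_space (Sp_top ?K) T"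
      using g[of T] by (cases "T \<in> tight_sets ?K") (simp_all add: \<psi>_def restrict_map_def del: Ab.simps topology_generated_by_topspace)
  qed
  moreover have "lam (S, X) \<in> SSub_hom (S, X) (Sp ?K)" unfolding Sp_eq by (rule lam_SSub_hom[OF X])
  ultimately show ?thesis unfolding SSub_iso_def A by (intro conjI bexI)
qed

theorem lam_natural:
  assumes "A \<in> SSub" "B \<in> SSub" "\<phi> \<in> SSub_hom A B"
  shows "Sp_mor (Ab B) (Ab A) (Ab_mor A B \<phi>) \<circ>\<^sub>m lam A = lam B \<circ>\<^sub>m \<phi>"
proof -
  obtain S X R Y where AB: "A = (S, X)" "B = (R, Y)" by (metis surj_pair)
  note X = assms(1)[unfolded AB] and Y = assms(2)[unfolded AB] and \<phi> = assms(3)[unfolded AB]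
  have sb: "subbasis Y ((\<lambda>p. p) ` R)" using Y by (simp add: SSub_iff)
  show ?thesis
    unfolding AB
  proof
    fix x
    show "(Sp_mor (Ab (R, Y)) (Ab (S, X)) (Ab_mor (S, X) (R, Y) \<phi>) \<circ>\<^sub>m lam (S, X)) x = (lam (R, Y) \<circ>\<^sub>m \<phi>) x"
    proof (cases "x \<in> topspace X")
      case False
      then have "\<phi> x = None" using SSub_hom_topspace(1)[OF \<phi>, of x] by (cases "\<phi> x") auto
      then show ?thesis using False by simp
    next
      case True
      have t: "{p \<in> S. x \<in> p} \<in> tight_sets (Ab (S, X))"
        using point_tight[OF SSub_image_id[OF X] True] unfolding Ab_eq[OF X] .
      have im: "Sp_image (Ab (R, Y)) (Ab_mor (S, X) (R, Y) \<phi>) {p \<in> S. x \<in> p} =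
          {r \<in> R. x \<in> partial_vimage \<phi> r}"
        unfolding Ab_mor_eq Ab_eq[OF Y] induced_cov_def
        by (rule Sp_image_point[OF SSub_image_id[OF X] sb \<phi> True])
      show ?thesis
      proof (cases "\<phi> x")
        case None
        then show ?thesis
          using True im by (simp add: Sp_mor_def partial_vimage_def del: Ab.simps Ab_mor.simps)
      next
        case (Some y)
        have y: "y \<in> topspace Y" by (rule SSub_hom_topspace(2)[OF \<phi> Some])
        then have "{r \<in> R. y \<in> r} \<noteq> {}" using subbasis_cover[OF sb] by blast
        then show ?thesis
          using True Some im t y by (simp add: Sp_mor_def partial_vimage_def del: Ab.simps Ab_mor.simps)
      qed
    qed
  qed
qed

subsection \<open>The transformation \<open>btl\<close>\<close>

lemma Fpow_image: "F \<in> Fpow S \<Longrightarrow> t ` F \<in> Fpow (t ` S)"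
  by (auto simp: Fpow_def)

text \<open>
  This contains the well-definedness of \<open>btl\<close>: by spatiality, whether \<open>F\<close> is related to \<open>G\<close> depends only
  on the image of \<open>F\<close> under \<open>tight_at A\<close>.
\<close>

theorem btl_eq:
  assumes "A \<in> Cov"
  shows "btl A = induced_rel (Sp_top A) (tight_at A ` fst A) (\<lambda>p. p) (fst A) (tight_at A) (id_on_space (Sp_top A))"
proof -
  obtain S R where A: "A = (S, R)" by (cases A)
  have cr: "cover_relation S R" using assms by (simp add: A Cov_def)
  let ?t = "tight_at (S, R)" and ?X = "Sp_top (S, R)"
  let ?b = "induced_rel ?X (?t ` S) (\<lambda>p. p) S ?t (id_on_space ?X)"
  have R: "(F, G) \<in> R \<longleftrightarrow> (?t ` F, G) \<in> ?b" if "F \<in> Fpow S" for F G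
  proof -
    have "(F, G) \<in> R \<longleftrightarrow> (F, G) \<in> induced_rel ?X S ?t S ?t (id_on_space ?X)"
      by (simp only: cover_relation_spatial[OF cr])
    also have "\<dots> \<longleftrightarrow> (?t ` F, G) \<in> ?b"
      unfolding induced_rel_iff using that Fpow_image[OF that, of ?t] by simp
    finally show ?thesis .
  qed
  have "btl (S, R) = ?b"
  proof (intro equalityI subrelI)
    fix P G assume "(P, G) \<in> btl (S, R)"
    then obtain F where "P = ?t ` F" "F \<in> Fpow S" "(F, G) \<in> R" by auto
    then show "(P, G) \<in> ?b" using R by simp
  next
    fix P G assume PG: "(P, G) \<in> ?b"
    then have P: "finite P" "P \<subseteq> ?t ` S" "G \<in> Fpow S" unfolding induced_rel_iff by (auto simp: Fpow_def)
    obtain F where "F \<subseteq> S" "finite F" "P = ?t ` F" using finite_subset_image[OF P(1,2)] by (elim exE conjE)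
    moreover from this have F: "F \<in> Fpow S" by (simp add: Fpow_def)
    ultimately show "(P, G) \<in> btl (S, R)" using R[OF F, of G] PG P(3) by auto
  qed
  then show ?thesis by (simp add: A)
qed

lemma btl_well_defined:
  assumes A: "A \<in> Cov" and F: "F \<in> Fpow (fst A)"
  shows "(tight_at A ` F, G) \<in> btl A \<longleftrightarrow> (F, G) \<in> snd A"
proof -
  have "(F, G) \<in> snd A \<longleftrightarrow> (F, G) \<in> spatial_rel A A (id_on_space (Sp_top A))"
    using Cov_id_spatial[OF A] by (simp only: Cov_id_def)
  also have "\<dots> \<longleftrightarrow> (tight_at A ` F, G) \<in> btl A"
    unfolding btl_eq[OF A] induced_rel_iff using F Fpow_image[OF F, of "tight_at A"] by simp
  finally show ?thesis by simp
qed

lemma map_comp_id: "id_on_space X \<circ>\<^sub>m id_on_space X = id_on_space X"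
  by (auto simp: map_comp_def restrict_map_def)

theorem btl_iso:
  assumes A: "A \<in> Cov"
  shows "Cov_iso A (Ab (Sp A)) (btl A)"
proof -
  let ?X = "Sp_top A" and ?I = "tight_at A ` fst A"
  let ?u = "induced_rel ?X (fst A) (tight_at A) ?I (\<lambda>p. p) (id_on_space ?X)"
  have X: "(tight_at A ` fst A, ?X) \<in> SSub" by (rule Sp_SSub[OF A])
  note X' = SSub_image_id[OF X]
  note K = induced_cov_Sp[OF A] and K' = Ab_Sp[OF A] and b = btl_eq[OF A]
  have id: "id_on_space ?X \<in> SSub_hom (?I, ?X) (?I, ?X)" by (rule SSub_hom_id)
  have 1: "btl A \<in> Cov_hom A (Ab (Sp A))"
    using induced_rel_Cov_hom[OF X' X id] unfolding K K' b .
  have 2: "?u \<in> Cov_hom (Ab (Sp A)) A"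
    using induced_rel_Cov_hom[OF X X' id] unfolding K K' .
  have 3: "Cov_comp A (Ab (Sp A)) A ?u (btl A) = Cov_id A"
    using Cov_comp_induced[OF X X' X id id] unfolding K K' b map_comp_id Cov_id_spatial[OF A] .
  have 4: "Cov_comp (Ab (Sp A)) A (Ab (Sp A)) (btl A) ?u = Cov_id (Ab (Sp A))"
    using Cov_comp_induced[OF X' X X' id id]
    unfolding K map_comp_id K' b by (simp add: Cov_id_def induced_cov_def)
  show ?thesis unfolding Cov_iso_def using 1 2 3 4 by (intro conjI bexI)
qed

text \<open>
  Both composites are induced by \<open>Sp_mor A B f\<close>.
\<close>

theorem btl_natural:
  assumes A: "A \<in> Cov" and B: "B \<in> Cov" and f: "f \<in> Cov_hom A B"
  shows "Cov_comp A (Ab (Sp A)) (Ab (Sp B)) (Ab_mor (Sp B) (Sp A) (Sp_mor A B f)) (btl A) =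
    Cov_comp A B (Ab (Sp B)) (btl B) f"
proof -
  let ?\<phi> = "Sp_mor A B f"
  note XA = Sp_SSub[OF A] and XB = Sp_SSub[OF B]
  have \<phi>: "?\<phi> \<in> SSub_hom (tight_at B ` fst B, Sp_top B) (tight_at A ` fst A, Sp_top A)"
    by (rule Sp_mor_SSub_hom[OF A B f])
  have "Cov_comp A (Ab (Sp A)) (Ab (Sp B)) (Ab_mor (Sp B) (Sp A) ?\<phi>) (btl A) =
      induced_rel (Sp_top B) (tight_at B ` fst B) (\<lambda>p. p) (fst A) (tight_at A) ?\<phi>"
    using Cov_comp_induced[OF SSub_image_id[OF XB] SSub_image_id[OF XA] XA \<phi> SSub_hom_id]
    unfolding Ab_Sp[OF A] Ab_Sp[OF B] induced_cov_Sp[OF A] btl_eq[OF A] Ab_mor_Sp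
      id_map_comp(2)[OF \<phi>] .
  also have "\<dots> = Cov_comp A B (Ab (Sp B)) (btl B) f"
    using Cov_comp_induced[OF SSub_image_id[OF XB] XB XA SSub_hom_id \<phi>]
    unfolding Ab_Sp[OF B] induced_cov_Sp[OF A] induced_cov_Sp[OF B] btl_eq[OF B]
      id_map_comp(1)[OF \<phi>] Cov_hom_spatial[OF A B f] by (rule sym)
  finally show ?thesis .
qed

subsection \<open>The zigzag identities\<close>

theorem zigzag_Ab:
  assumes "A \<in> SSub"
  shows "Cov_comp (Ab A) (Ab (Sp (Ab A))) (Ab A) (Ab_mor A (Sp (Ab A)) (lam A)) (btl (Ab A)) = Cov_id (Ab A)"
proof -
  obtain S X where A: "A = (S, X)" by (cases A)
  note X = assms[unfolded A]
  let ?K = "Ab (S, X)"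
  have K: "?K \<in> Cov" by (rule Ab_in_Cov[OF X])
  note SK = Sp_SSub[OF K]
  have l: "lam (S, X) \<in> SSub_hom (S, X) (tight_at ?K ` fst ?K, Sp_top ?K)" by (rule lam_SSub_hom[OF X])
  have fK: "fst ?K = S" by simp
  have "induced_rel X S (\<lambda>p. p) (fst ?K) (tight_at ?K) (lam (S, X)) =
      induced_rel X S (\<lambda>p. p) S (\<lambda>p. p) (id_on_space X)"
  proof (intro set_eqI, clarify)
    fix F G
    have sb: "subbasis X ((\<lambda>p. p) ` S)" using X by (simp add: SSub_iff)
    show "(F, G) \<in> induced_rel X S (\<lambda>p. p) (fst ?K) (tight_at ?K) (lam (S, X)) \<longleftrightarrow>
        (F, G) \<in> induced_rel X S (\<lambda>p. p) S (\<lambda>p. p) (id_on_space X)"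
    proof (cases "G \<in> Fpow S")
      case True
      have e: "partial_vimage (lam (S, X)) (\<Union>(tight_at ?K ` G)) = \<Union>((\<lambda>p. p) ` G)"
        unfolding partial_vimage_Union using lam_vimage[OF X] Fpow_subset[OF True] by auto
      show ?thesis unfolding fK induced_rel_id_iff[OF sb] unfolding induced_rel_iff e ..
    qed (simp only: fK induced_rel_iff simp_thms)
  qed
  moreover have "Cov_comp ?K (Ab (Sp ?K)) ?K (Ab_mor (S, X) (Sp ?K) (lam (S, X))) (btl ?K) =
      induced_rel X S (\<lambda>p. p) (fst ?K) (tight_at ?K) (lam (S, X))"
    using Cov_comp_induced[OF SSub_image_id[OF X] SSub_image_id[OF SK] SK l SSub_hom_id]
    unfolding btl_eq[OF K] Ab_Sp[OF K] Ab_mor_Sp id_map_comp(2)[OF l] induced_cov_Sp[OF K]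
      Ab_eq[OF X, symmetric] .
  moreover have "Cov_id ?K = induced_rel X S (\<lambda>p. p) S (\<lambda>p. p) (id_on_space X)"
    unfolding Ab_eq[OF X] by (simp add: Cov_id_def induced_cov_def)
  ultimately show ?thesis unfolding A by simp
qed

theorem zigzag_Sp:
  assumes A: "A \<in> Cov"
  shows "Sp_mor A (Ab (Sp A)) (btl A) \<circ>\<^sub>m lam (Sp A) = SSub_id (Sp A)"
  unfolding SSub_id_eq
proof
  fix T
  let ?X = "Sp_top A" and ?I = "tight_at A ` fst A"
  note X = Sp_SSub[OF A]
  have lam: "lam (Sp A) T = (if T \<in> tight_sets A then Some {p \<in> ?I. T \<in> p} else None)"
    unfolding Sp_eq lam.simps topspace_Sp ..
  show "(Sp_mor A (Ab (Sp A)) (btl A) \<circ>\<^sub>m lam (Sp A)) T = id_on_space ?X T"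
  proof (cases "T \<in> tight_sets A")
    case False
    then show ?thesis using lam topspace_Sp[of A] by (simp add: restrict_map_def)
  next
    case True
    have Tt: "T \<in> topspace ?X" using True unfolding topspace_Sp .
    have t: "{p \<in> ?I. T \<in> p} \<in> tight_sets (Ab (Sp A))"
      using point_tight[OF SSub_image_id[OF X] Tt] unfolding Ab_Sp[OF A] .
    have "Sp_image (fst A, snd A) (btl A) {p \<in> ?I. T \<in> p} =
        {r \<in> fst A. T \<in> partial_vimage (id_on_space ?X) (tight_at A r)}"
      unfolding btl_eq[OF A] by (rule Sp_image_point[OF SSub_image_id[OF X] subbasis_Sp SSub_hom_id Tt])
    also have "\<dots> = {r \<in> fst A. T \<in> tight_at A r}"
      using Tt by (auto simp: partial_vimage_def restrict_map_def simp del: topology_generated_by_topspace)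
    also have "\<dots> = T" by (rule tight_at_point[OF True])
    finally have "Sp_image A (btl A) {p \<in> ?I. T \<in> p} = T" by simp
    moreover have "T \<noteq> {}" using True by (simp add: tight_sets_def)
    ultimately have "Sp_mor A (Ab (Sp A)) (btl A) {p \<in> ?I. T \<in> p} = Some T"
      using t by (simp add: Sp_mor_def)
    then show ?thesis using lam True Tt by (simp add: restrict_map_def del: topology_generated_by_topspace)
  qed
qed


section \<open>The duality\<close>

theorem theorem4p11:
  shows
    \<comment> \<open>\<open>Cov\<close> is a category\<close>
    "(\<forall>A\<in>(Cov :: 'p cov set). Cov_id A \<in> Cov_hom A A) \<and>
     (\<forall>A\<in>(Cov :: 'p cov set). \<forall>B\<in>(Cov :: 'q cov set). \<forall>C\<in>(Cov :: 'r cov set).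
        \<forall>f\<in>Cov_hom A B. \<forall>g\<in>Cov_hom B C. Cov_comp A B C g f \<in> Cov_hom A C) \<and>
     (\<forall>A\<in>(Cov :: 'p cov set). \<forall>B\<in>(Cov :: 'q cov set). \<forall>f\<in>Cov_hom A B.
        Cov_comp A A B f (Cov_id A) = f \<and> Cov_comp A B B (Cov_id B) f = f) \<and>
     (\<forall>A\<in>(Cov :: 'p cov set). \<forall>B\<in>(Cov :: 'q cov set). \<forall>C\<in>(Cov :: 'r cov set). \<forall>D\<in>(Cov :: 's cov set).
        \<forall>f\<in>Cov_hom A B. \<forall>g\<in>Cov_hom B C. \<forall>h\<in>Cov_hom C D.
          Cov_comp A B D (Cov_comp B C D h g) f = Cov_comp A C D h (Cov_comp A B C g f)) \<and>

     \<comment> \<open>\<open>SSub\<close> is a category\<close>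
     (\<forall>A\<in>(SSub :: 'a ssub set). SSub_id A \<in> SSub_hom A A) \<and>
     (\<forall>A\<in>(SSub :: 'a ssub set). \<forall>B\<in>(SSub :: 'b ssub set). \<forall>C\<in>(SSub :: 'c ssub set).
        \<forall>f\<in>SSub_hom A B. \<forall>g\<in>SSub_hom B C. g \<circ>\<^sub>m f \<in> SSub_hom A C) \<and>
     (\<forall>A\<in>(SSub :: 'a ssub set). \<forall>B\<in>(SSub :: 'b ssub set). \<forall>f\<in>SSub_hom A B.
        f \<circ>\<^sub>m SSub_id A = f \<and> SSub_id B \<circ>\<^sub>m f = f) \<and>
     (\<forall>A\<in>(SSub :: 'a ssub set). \<forall>B\<in>(SSub :: 'b ssub set). \<forall>C\<in>(SSub :: 'c ssub set). \<forall>D\<in>(SSub :: 'd ssub set).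
        \<forall>f\<in>SSub_hom A B. \<forall>g\<in>SSub_hom B C. \<forall>h\<in>SSub_hom C D.
          (h \<circ>\<^sub>m g) \<circ>\<^sub>m f = h \<circ>\<^sub>m (g \<circ>\<^sub>m f)) \<and>

     \<comment> \<open>\<open>Ab\<close> is a contravariant functor\<close>
     (\<forall>A\<in>(SSub :: 'a ssub set). Ab A \<in> Cov) \<and>
     (\<forall>A\<in>(SSub :: 'a ssub set). \<forall>B\<in>(SSub :: 'b ssub set). \<forall>\<phi>\<in>SSub_hom A B.
        Ab_mor A B \<phi> \<in> Cov_hom (Ab B) (Ab A)) \<and>
     (\<forall>A\<in>(SSub :: 'a ssub set). Ab_mor A A (SSub_id A) = Cov_id (Ab A)) \<and>
     (\<forall>A\<in>(SSub :: 'a ssub set). \<forall>B\<in>(SSub :: 'b ssub set). \<forall>C\<in>(SSub :: 'c ssub set).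
        \<forall>\<phi>\<in>SSub_hom A B. \<forall>\<psi>\<in>SSub_hom B C.
          Ab_mor A C (\<psi> \<circ>\<^sub>m \<phi>) = Cov_comp (Ab C) (Ab B) (Ab A) (Ab_mor A B \<phi>) (Ab_mor B C \<psi>)) \<and>

     \<comment> \<open>\<open>Sp\<close> is a contravariant functor\<close>
     (\<forall>A\<in>(Cov :: 'p cov set). Sp A \<in> SSub) \<and>
     (\<forall>A\<in>(Cov :: 'p cov set). \<forall>B\<in>(Cov :: 'q cov set). \<forall>f\<in>Cov_hom A B.
        Sp_mor A B f \<in> SSub_hom (Sp B) (Sp A)) \<and>
     (\<forall>A\<in>(Cov :: 'p cov set). Sp_mor A A (Cov_id A) = SSub_id (Sp A)) \<and>
     (\<forall>A\<in>(Cov :: 'p cov set). \<forall>B\<in>(Cov :: 'q cov set). \<forall>C\<in>(Cov :: 'r cov set).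
        \<forall>f\<in>Cov_hom A B. \<forall>g\<in>Cov_hom B C.
          Sp_mor A C (Cov_comp A B C g f) = Sp_mor A B f \<circ>\<^sub>m Sp_mor B C g) \<and>

     \<comment> \<open>\<open>lam\<close> is a natural isomorphism from the identity of \<open>SSub\<close> to \<open>Sp Ab\<close>\<close>
     (\<forall>A\<in>(SSub :: 'a ssub set). SSub_iso A (Sp (Ab A)) (lam A)) \<and>
     (\<forall>A\<in>(SSub :: 'a ssub set). \<forall>B\<in>(SSub :: 'b ssub set). \<forall>\<phi>\<in>SSub_hom A B.
        Sp_mor (Ab B) (Ab A) (Ab_mor A B \<phi>) \<circ>\<^sub>m lam A = lam B \<circ>\<^sub>m \<phi>) \<and>

     \<comment> \<open>\<open>btl\<close> is well defined and a natural isomorphism from the identity of \<open>Cov\<close> to \<open>Ab Sp\<close>\<close>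
     (\<forall>A\<in>(Cov :: 'p cov set). \<forall>F\<in>Fpow (fst A). \<forall>G\<in>Fpow (fst A).
        (tight_at A ` F, G) \<in> btl A \<longleftrightarrow> (F, G) \<in> snd A) \<and>
     (\<forall>A\<in>(Cov :: 'p cov set). Cov_iso A (Ab (Sp A)) (btl A)) \<and>
     (\<forall>A\<in>(Cov :: 'p cov set). \<forall>B\<in>(Cov :: 'q cov set). \<forall>f\<in>Cov_hom A B.
        Cov_comp A (Ab (Sp A)) (Ab (Sp B)) (Ab_mor (Sp B) (Sp A) (Sp_mor A B f)) (btl A) =
        Cov_comp A B (Ab (Sp B)) (btl B) f) \<and>

     \<comment> \<open>zigzag identities\<close>
     (\<forall>A\<in>(SSub :: 'a ssub set).
        Cov_comp (Ab A) (Ab (Sp (Ab A))) (Ab A) (Ab_mor A (Sp (Ab A)) (lam A)) (btl (Ab A)) =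
        Cov_id (Ab A)) \<and>
     (\<forall>A\<in>(Cov :: 'p cov set).
        Sp_mor A (Ab (Sp A)) (btl A) \<circ>\<^sub>m lam (Sp A) = SSub_id (Sp A))"
  by (intro conjI ballI;
      ((rule Cov_id_hom; assumption) | (rule Cov_comp_hom; assumption) |
       (rule Cov_comp_id; assumption) | (rule Cov_comp_assoc; assumption) |
       rule SSub_id_hom | (rule SSub_comp_hom; assumption) |
       (rule SSub_comp_id; assumption) | rule map_comp_assoc |
       (rule Ab_in_Cov; assumption) | (rule Ab_mor_hom; assumption) |
       (rule Ab_mor_id; assumption) | (rule Ab_mor_comp; assumption) |
       (rule Sp_in_SSub; assumption) | (rule Sp_mor_hom; assumption) |
       (rule Sp_mor_id; assumption) | (rule Sp_mor_comp; assumption) |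
       (rule lam_iso; assumption) | (rule lam_natural; assumption) |
       (rule btl_well_defined; assumption) | (rule btl_iso; assumption) |
       (rule btl_natural; assumption) | (rule zigzag_Ab; assumption) | (rule zigzag_Sp; assumption)))

end
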